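(* Let $\mathbb{H}$ be a separable (infinite-dimensional) Hilbert space with orthonormal basis $\{e_1,e_2,\ldots\}$, and let $A(x)$, $x\in D_0$, be a holomorphic family of bounded operators on $\mathbb{H}$ with domain $D_0$ in the complex plane such that $A(x)$ is self-adjoint for each $x\in D_0$. For $x \in D_0$ let $\nu(x)$ and $\mu(x)$ be the lower and upper bounds of $\sigma_e(A(x))$, let $\lambda_R^+(x)\le\cdots\le\lambda_2^+(x)\le\lambda_1^+(x)$ be the discrete eigenvalues of $A(x)$ lying above $\mu(x)$, and let $\lambda_1^-(x)\le\lambda_2^-(x)\le\cdots\le\lambda_S^-(x)$ be the discrete eigenvalues of $A(x)$ lying below $\nu(x)$, where $R=R(x)$ and $S=S(x)$ may be infinite. Let $\lambda_{1,n}(x)\ge\lambda_{2,n}(x)\ge\cdots\ge\lambda_{n,n}(x)$ be the eigenvalues of the truncation $A(x)_n$. Then for every fixed integer $k\ge 1$ and every $x \in D_0$, $$\lim_{n\to\infty}\lambda_{k,n}(x)=\begin{cases}\lambda_k^+(x), & \text{if } R=\infty \text{ or } 1\le k\le R,\\ \mu(x), & \text{if } R<\infty \text{ and } k\ge R+1,\end{cases}$$ $$\lim_{n\to\infty}\lambda_{n+1-k,n}(x)=\begin{cases}\lambda_k^-(x), & \text{if } S=\infty \text{ or } 1\le k\le S,\\ \nu(x), & \text{if } S<\infty \text{ and } k\ge S+1.\end{cases}$$ In particular, $$\lim_{k\to\infty}\lim_{n\to\infty}\lambda_{k,n}(x)=\mu(x)\quad\text{and}\quad \lim_{k\to\infty}\lim_{n\to\infty}\lambda_{n+1-k,n}(x)=\nu(x).$$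 Furthermore, in each of the cases given above, the convergence is uniform on all compact subsets of $D_0$.
   Context: A family of bounded operators $A(x)$, $x\in D_0\subseteq\mathbb{C}$, is called holomorphic if for each $y\in D_0$ the limit $\lim_{x\to y}\frac{\|A(x)-A(y)\|}{|x-y|}$ exists and is finite. $P_n$ is the orthogonal projection of $\mathbb{H}$ onto the span of $\{e_1,\ldots,e_n\}$, and $A(x)_n=P_nA(x)P_n$, regarded as an operator (an $n\times n$ matrix) on that $n$-dimensional span. $\sigma_e$ denotes the essential spectrum; discrete eigenvalues are isolated spectral points that are eigenvalues of finite multiplicity. All eigenvalues are counted with multiplicity. *)

theory Defs
  imports "HOL-Analysis.Analysis" "HOL-Library.Extended_Nat"
begin

text \<open>
  Complex Hilbert spaces. The inner product is linear in its second argument. The axiom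
  \<open>cinner_self\<close> ties it to the library norm and contains positive definiteness;
  completeness comes from \<^class>\<open>banach\<close>.
\<close>

class chilbert_space = banach +
  fixes scaleC :: "complex \<Rightarrow> 'a \<Rightarrow> 'a" (infixr "*\<^sub>C" 75)
    and cinner :: "'a \<Rightarrow> 'a \<Rightarrow> complex"
  assumes scaleC_add_right: "c *\<^sub>C (x + y) = c *\<^sub>C x + c *\<^sub>C y"
    and scaleC_add_left: "(c + d) *\<^sub>C x = c *\<^sub>C x + d *\<^sub>C x"
    and scaleC_scaleC: "c *\<^sub>C d *\<^sub>C x = (c * d) *\<^sub>C x"
    and scaleC_of_real: "complex_of_real r *\<^sub>C x = r *\<^sub>R x"
    and cinner_commute: "cinner x y = cnj (cinner y x)"
    and cinner_add_right: "cinner x (y + z) = cinner x y + cinner x z"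
    and cinner_scaleC_right: "cinner x (c *\<^sub>C y) = c * cinner x y"
    and cinner_self: "cinner x x = complex_of_real ((norm x)\<^sup>2)"

global_interpretation cvec: vector_space "scaleC :: complex \<Rightarrow> 'a \<Rightarrow> 'a::chilbert_space"
proof
  fix a b :: complex and x y :: 'a
  show "a *\<^sub>C (x + y) = a *\<^sub>C x + a *\<^sub>C y" by (rule scaleC_add_right)
  show "(a + b) *\<^sub>C x = a *\<^sub>C x + b *\<^sub>C x" by (rule scaleC_add_left)
  show "a *\<^sub>C b *\<^sub>C x = (a * b) *\<^sub>C x" by (rule scaleC_scaleC)
  show "1 *\<^sub>C x = x" using scaleC_of_real[of 1 x] by simp
qed

definition finite_cdim :: "'a::chilbert_space set \<Rightarrow> bool" where
  "finite_cdim V \<longleftrightarrow> (\<exists>B. finite B \<and> V \<subseteq> cvec.span B)"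

definition orthonormal_basis :: "(nat \<Rightarrow> 'a::chilbert_space) \<Rightarrow> bool" where
  "orthonormal_basis e \<longleftrightarrow>
     (\<forall>i j. cinner (e i) (e j) = (if i = j then 1 else 0)) \<and>
     closure (cvec.span (range e)) = UNIV"

definition bounded_clinear :: "('a::chilbert_space \<Rightarrow> 'a) \<Rightarrow> bool" where
  "bounded_clinear T \<longleftrightarrow> bounded_linear T \<and> (\<forall>c v. T (c *\<^sub>C v) = c *\<^sub>C T v)"

definition self_adjoint :: "('a::chilbert_space \<Rightarrow> 'a) \<Rightarrow> bool" where
  "self_adjoint T \<longleftrightarrow> bounded_clinear T \<and> (\<forall>u v. cinner (T u) v = cinner u (T v))"

text \<open>
  The difference quotient is formed with the operator norm; the set \<open>D\<close> need not be open
  and limits are taken within \<open>D\<close>.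
\<close>

definition holomorphic_family :: "complex set \<Rightarrow> (complex \<Rightarrow> 'a::chilbert_space \<Rightarrow> 'a) \<Rightarrow> bool" where
  "holomorphic_family D A \<longleftrightarrow>
     (\<forall>x\<in>D. bounded_clinear (A x)) \<and>
     (\<forall>y\<in>D. \<exists>L::real.
        ((\<lambda>x. onorm (\<lambda>v. A x v - A y v) / cmod (x - y)) \<longlongrightarrow> L) (at y within D))"

definition spectrum :: "('a::chilbert_space \<Rightarrow> 'a) \<Rightarrow> complex set" where
  "spectrum T = {z. \<not> (\<exists>B. bounded_clinear B \<and>
     (\<forall>v. B (T v - z *\<^sub>C v) = v) \<and> (\<forall>v. T (B v) - z *\<^sub>C B v = v))}"

definition fredholm :: "('a::chilbert_space \<Rightarrow> 'a) \<Rightarrow> bool" where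
  "fredholm T \<longleftrightarrow>
     finite_cdim {v. T v = 0} \<and> closed (range T) \<and>
     (\<exists>B. finite B \<and> cvec.span (range T \<union> B) = UNIV)"

definition ess_spectrum :: "('a::chilbert_space \<Rightarrow> 'a) \<Rightarrow> complex set" where
  "ess_spectrum T = {z. \<not> fredholm (\<lambda>v. T v - z *\<^sub>C v)}"

text \<open>
  From here on the operators are meant to be self-adjoint, so that all spectral points are
  real; suprema, infima and orderings are taken among real numbers.
\<close>

definition ess_upper :: "('a::chilbert_space \<Rightarrow> 'a) \<Rightarrow> real" where
  "ess_upper T = Sup (Re ` ess_spectrum T)"

definition ess_lower :: "('a::chilbert_space \<Rightarrow> 'a) \<Rightarrow> real" where
  "ess_lower T = Inf (Re ` ess_spectrum T)"

definition eigenspace_on :: "'a::chilbert_space set \<Rightarrow> ('a \<Rightarrow> 'a) \<Rightarrow> real \<Rightarrow> 'a set" where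
  "eigenspace_on V T t = {v \<in> V. T v = complex_of_real t *\<^sub>C v}"

definition eigenvalues_on :: "'a::chilbert_space set \<Rightarrow> ('a \<Rightarrow> 'a) \<Rightarrow> real set" where
  "eigenvalues_on V T = {t. \<exists>v \<in> eigenspace_on V T t. v \<noteq> 0}"

definition multiplicity_on :: "'a::chilbert_space set \<Rightarrow> ('a \<Rightarrow> 'a) \<Rightarrow> real \<Rightarrow> nat" where
  "multiplicity_on V T t = cvec.dim (eigenspace_on V T t)"

definition discrete_eigenvalues :: "('a::chilbert_space \<Rightarrow> 'a) \<Rightarrow> real set" where
  "discrete_eigenvalues T = {t \<in> eigenvalues_on UNIV T.
     complex_of_real t isolated_in spectrum T \<and> finite_cdim (eigenspace_on UNIV T t)}"

text \<open>
  The \<open>k\<close>-th entry (\<open>k \<ge> 1\<close>) when the elements \<open>s\<close> of \<open>S\<close>, each repeated \<open>m s\<close> times, are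
  listed in decreasing (resp. increasing) order: the element \<open>t\<close> with fewer than \<open>k\<close> entries
  strictly before it and at least \<open>k\<close> entries up to and including all copies of \<open>t\<close>.
  The set \<open>S\<close> may be infinite; the finiteness clause guards against the convention that sums
  over infinite sets are \<open>0\<close>.
\<close>

definition kth_largest :: "real set \<Rightarrow> (real \<Rightarrow> nat) \<Rightarrow> nat \<Rightarrow> real" where
  "kth_largest S m k = (THE t. t \<in> S \<and> finite {s \<in> S. s \<ge> t} \<and>
     (\<Sum>s \<in> {s \<in> S. s > t}. m s) < k \<and> k \<le> (\<Sum>s \<in> {s \<in> S. s \<ge> t}. m s))"

definition kth_smallest :: "real set \<Rightarrow> (real \<Rightarrow> nat) \<Rightarrow> nat \<Rightarrow> real" where
  "kth_smallest S m k = (THE t. t \<in> S \<and> finite {s \<in> S. s \<le> t} \<and>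
     (\<Sum>s \<in> {s \<in> S. s < t}. m s) < k \<and> k \<le> (\<Sum>s \<in> {s \<in> S. s \<le> t}. m s))"

definition count_with_mult :: "real set \<Rightarrow> (real \<Rightarrow> nat) \<Rightarrow> enat" where
  "count_with_mult S m = (if finite S then enat (\<Sum>s\<in>S. m s) else \<infinity>)"

definition discrete_above :: "('a::chilbert_space \<Rightarrow> 'a) \<Rightarrow> real set" where
  "discrete_above T = {t \<in> discrete_eigenvalues T. t > ess_upper T}"

definition discrete_below :: "('a::chilbert_space \<Rightarrow> 'a) \<Rightarrow> real set" where
  "discrete_below T = {t \<in> discrete_eigenvalues T. t < ess_lower T}"

definition num_above :: "('a::chilbert_space \<Rightarrow> 'a) \<Rightarrow> enat" where
  "num_above T = count_with_mult (discrete_above T) (multiplicity_on UNIV T)"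

definition num_below :: "('a::chilbert_space \<Rightarrow> 'a) \<Rightarrow> enat" where
  "num_below T = count_with_mult (discrete_below T) (multiplicity_on UNIV T)"

definition lambda_plus :: "('a::chilbert_space \<Rightarrow> 'a) \<Rightarrow> nat \<Rightarrow> real" where
  "lambda_plus T k = kth_largest (discrete_above T) (multiplicity_on UNIV T) k"

definition lambda_minus :: "('a::chilbert_space \<Rightarrow> 'a) \<Rightarrow> nat \<Rightarrow> real" where
  "lambda_minus T k = kth_smallest (discrete_below T) (multiplicity_on UNIV T) k"

text \<open>
  Truncations. The basis is indexed from \<open>0\<close>, so the first \<open>n\<close> basis vectors are
  \<open>e 0, \<dots>, e (n - 1)\<close>. For orthonormal \<open>e\<close> the finite Fourier sum below is the orthogonal
  projection onto their span.
\<close>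

definition proj :: "(nat \<Rightarrow> 'a::chilbert_space) \<Rightarrow> nat \<Rightarrow> 'a \<Rightarrow> 'a" where
  "proj e n v = (\<Sum>i<n. cinner (e i) v *\<^sub>C e i)"

definition truncation :: "(nat \<Rightarrow> 'a::chilbert_space) \<Rightarrow> nat \<Rightarrow> ('a \<Rightarrow> 'a) \<Rightarrow> 'a \<Rightarrow> 'a" where
  "truncation e n T = proj e n \<circ> T \<circ> proj e n"

definition lambda_trunc :: "(nat \<Rightarrow> 'a::chilbert_space) \<Rightarrow> ('a \<Rightarrow> 'a) \<Rightarrow> nat \<Rightarrow> nat \<Rightarrow> real" where
  "lambda_trunc e T k n =
     (let V = cvec.span (e ` {..<n})
      in kth_largest (eigenvalues_on V (truncation e n T)) (multiplicity_on V (truncation e n T)) k)"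

end

theory Submission
  imports Defs
begin

text \<open>
  For one self-adjoint operator \<open>T\<close> everything rests on \<^emph>\<open>deflation\<close>. Suppose that orthonormal
  eigenvectors \<open>u 0, \<dots>, u (k - 1)\<close> have been found, each maximising the quadratic form \<open>Re (cinner
  v (T v))\<close> over the unit vectors orthogonal to its predecessors; this is what \<open>top_system\<close>
  records. Let \<open>M\<close> be the supremum of the form over the unit vectors orthogonal to all of them. If
  \<open>T - M\<close> is Fredholm, then \<open>M\<close> is attained, at an eigenvector, and the list can be extended
  (\<open>form_maximum_attained\<close>, \<open>top_system_deflate\<close>): a Fredholm self-adjoint operator is bounded
  below on the orthogonal complement of its kernel (\<open>fredholm_imp_bounded_below\<close>), whereas vectors
  at which the form is almost maximal are almost eigenvectors. Conversely, if the form is at most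
  \<open>M\<close> on a subspace of finite codimension, then the essential spectrum is at most \<open>M\<close> as well
  (\<open>ess_spectrum_le_form_bound\<close>).

  Hence, with \<open>\<mu> = ess_upper T\<close>, deflation either goes on for ever with values above \<open>\<mu>\<close>, or stops
  after finitely many steps with the form bounded by \<open>\<mu>\<close> on what is left
  (\<open>top_system_above_cases\<close>). The values produced are exactly the discrete eigenvalues above \<open>\<mu>\<close>,
  in decreasing order and with the right multiplicities (\<open>top_system_value_entry\<close>,
  \<open>num_above_exhausted\<close>). When deflation does not stop, its values decrease to a point of the
  essential spectrum, so to \<open>\<mu>\<close> (\<open>limit_of_top_system_values\<close>).

  The truncation \<open>P T P\<close> on the span \<open>V\<close> of the first \<open>n\<close> basis vectors is diagonalised by the
  same deflation (\<open>truncation_top_system\<close>). Its eigenvalues are compared with the values for \<open>T\<close>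
  by counting dimensions in the manner of Courant and Fischer: a nonzero combination of the top
  \<open>k\<close> vectors of one system can be chosen orthogonal to any \<open>k - 1\<close> given vectors. From above this
  gives \<open>lambda_trunc_le_form_bound\<close>. From below, a \<open>k\<close>-dimensional space on which the form of \<open>T\<close>
  is at least \<open>t\<close> is moved into \<open>V\<close> by the projections \<open>P\<close>, which converge uniformly on it to the
  identity (\<open>lambda_trunc_eventually_gt\<close>); such spaces are spanned by the eigenvectors found by
  deflation, or, for \<open>t < \<mu>\<close>, come from \<open>exists_large_form_subspace\<close>. Together these give
  \<open>lambda_trunc_tendsto\<close>.

  The statements about the lower end follow by passing from \<open>T\<close> to \<open>-T\<close>, which reverses every
  ordered list of eigenvalues. Uniformity on compact sets holds because the eigenvalues of
  truncations are Lipschitz in \<open>T\<close> for the operator norm with constant \<open>1\<close>, independently of \<open>n\<close>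
  (\<open>lambda_trunc_lipschitz\<close>), and a holomorphic family is continuous in norm; pointwise
  convergence of an equicontinuous sequence on a compact set is uniform
  (\<open>equicontinuous_uniform_limit\<close>).
\<close>

section \<open>The inner product\<close>

lemma cinner_add_left: "cinner (x + y) (z::'a::chilbert_space) = cinner x z + cinner y z"
  by (metis cinner_commute cinner_add_right complex_cnj_add)

lemma cinner_scaleC_left: "cinner (c *\<^sub>C x) (y::'a::chilbert_space) = cnj c * cinner x y"
  by (metis cinner_commute cinner_scaleC_right complex_cnj_mult)

lemma cinner_zero_right [simp]: "cinner x (0::'a::chilbert_space) = 0"
  using cinner_scaleC_right[of x 0 0] by simp

lemma cinner_zero_left [simp]: "cinner (0::'a::chilbert_space) x = 0"
  using cinner_scaleC_left[of 0 0 x] by simp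

lemma uminus_scaleC: "- (x::'a::chilbert_space) = (-1) *\<^sub>C x"
  by simp

lemma cinner_minus_right [simp]: "cinner x (- (y::'a::chilbert_space)) = - cinner x y"
  by (simp only: uminus_scaleC cinner_scaleC_right) simp

lemma cinner_minus_left [simp]: "cinner (- x) (y::'a::chilbert_space) = - cinner x y"
  by (simp only: uminus_scaleC cinner_scaleC_left) simp

lemma cinner_diff_right: "cinner x (y - (z::'a::chilbert_space)) = cinner x y - cinner x z"
  using cinner_add_right[of x y "- z"] by simp

lemma cinner_diff_left: "cinner (x - y) (z::'a::chilbert_space) = cinner x z - cinner y z"
  using cinner_add_left[of x "- y" z] by simp

lemmas cinner_algebra = cinner_add_left cinner_add_right cinner_diff_left cinner_diff_right
  cinner_scaleC_left cinner_scaleC_right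

lemma cinner_sum_right: "cinner x (\<Sum>i\<in>I. f i) = (\<Sum>i\<in>I. cinner x (f i :: 'a::chilbert_space))"
  by (induction I rule: infinite_finite_induct) (auto simp: cinner_add_right)

lemma cinner_sum_left: "cinner (\<Sum>i\<in>I. f i) x = (\<Sum>i\<in>I. cinner (f i) (x :: 'a::chilbert_space))"
  by (induction I rule: infinite_finite_induct) (auto simp: cinner_add_left)

lemma cinner_self_eq_0 [simp]: "cinner x x = 0 \<longleftrightarrow> x = (0::'a::chilbert_space)"
  by (simp add: cinner_self)

lemma Re_cinner_self: "Re (cinner x x) = (norm (x::'a::chilbert_space))\<^sup>2"
  by (simp add: cinner_self)

lemma norm_scaleC: "norm (c *\<^sub>C (x::'a::chilbert_space)) = cmod c * norm x"
proof -
  have "complex_of_real ((norm (c *\<^sub>C x))\<^sup>2) = cinner (c *\<^sub>C x) (c *\<^sub>C x)"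
    by (simp only: cinner_self)
  also have "\<dots> = (cnj c * c) * cinner x x"
    by (simp add: cinner_algebra)
  also have "\<dots> = complex_of_real ((cmod c * norm x)\<^sup>2)"
    using complex_norm_square[of c]
    by (simp add: cinner_self mult.commute[of "cnj c"] power_mult_distrib)
  finally have "(norm (c *\<^sub>C x))\<^sup>2 = (cmod c * norm x)\<^sup>2"
    using of_real_eq_iff by blast
  then show ?thesis by simp
qed

lemma norm_add_square:
  "(norm (x + y))\<^sup>2 = (norm x)\<^sup>2 + 2 * Re (cinner x y) + (norm (y::'a::chilbert_space))\<^sup>2"
proof -
  have "Re (cinner y x) = Re (cinner x y)"
    by (metis cinner_commute cnj.simps(1))
  then show ?thesis
    by (simp only: Re_cinner_self[symmetric] cinner_algebra) simp
qed

lemma norm_add_square_orthogonal: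
  assumes "cinner x y = 0"
  shows "(norm (x + y))\<^sup>2 = (norm x)\<^sup>2 + (norm (y::'a::chilbert_space))\<^sup>2"
  using assms by (simp add: norm_add_square)

lemma norm_diff_square:
  "(norm (x - y))\<^sup>2 = (norm x)\<^sup>2 - 2 * Re (cinner x y) + (norm (y::'a::chilbert_space))\<^sup>2"
  using norm_add_square[of x "- y"] by simp

lemma norm_cinner_le: "cmod (cinner x y) \<le> norm x * norm (y::'a::chilbert_space)"
proof (cases "x = 0")
  case False
  define c where "c = cinner x y / complex_of_real ((norm x)\<^sup>2)"
  have "cinner x (y - c *\<^sub>C x) = 0"
    using False by (simp add: cinner_algebra cinner_self c_def)
  then have "cinner (c *\<^sub>C x) (y - c *\<^sub>C x) = 0"
    by (simp add: cinner_scaleC_left)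
  from norm_add_square_orthogonal[OF this]
  have "(norm (c *\<^sub>C x))\<^sup>2 \<le> (norm y)\<^sup>2" by simp
  then have "cmod c * norm x \<le> norm y"
    by (simp add: norm_scaleC abs_le_square_iff[symmetric])
  moreover have "cmod c * norm x = cmod (cinner x y) / norm x"
    using False by (simp add: c_def norm_divide power2_eq_square norm_mult)
  ultimately show ?thesis using False by (simp add: divide_le_eq mult.commute)
qed simp

lemma bounded_linear_cinner_right: "bounded_linear (cinner (x::'a::chilbert_space))"
proof (rule bounded_linear_intro[where K = "norm x"])
  fix y z :: 'a and r :: real
  show "cinner x (y + z) = cinner x y + cinner x z" by (rule cinner_add_right)
  have "cinner x (r *\<^sub>R y) = complex_of_real r * cinner x y"
    by (simp only: scaleC_of_real[symmetric] cinner_scaleC_right)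
  then show "cinner x (r *\<^sub>R y) = r *\<^sub>R cinner x y"
    by (simp add: scaleR_conv_of_real)
  show "norm (cinner x y) \<le> norm y * norm x"
    using norm_cinner_le[of x y] by (simp add: mult.commute)
qed

lemma bounded_linear_scaleC: "bounded_linear (\<lambda>x::'a::chilbert_space. c *\<^sub>C x)"
proof (rule bounded_linear_intro[where K = "cmod c"])
  fix y z :: 'a and r :: real
  show "c *\<^sub>C (y + z) = c *\<^sub>C y + c *\<^sub>C z" by (rule scaleC_add_right)
  show "c *\<^sub>C r *\<^sub>R y = r *\<^sub>R c *\<^sub>C y"
    by (simp only: scaleC_of_real[symmetric] scaleC_scaleC mult.commute)
  show "norm (c *\<^sub>C y) \<le> norm y * cmod c" by (simp add: norm_scaleC)
qed

lemma bounded_linear_scaleC_left: "bounded_linear (\<lambda>c. c *\<^sub>C (x::'a::chilbert_space))"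
proof (rule bounded_linear_intro[where K = "norm x"])
  fix a b :: complex and r :: real
  show "(a + b) *\<^sub>C x = a *\<^sub>C x + b *\<^sub>C x" by (rule scaleC_add_left)
  show "(r *\<^sub>R a) *\<^sub>C x = r *\<^sub>R a *\<^sub>C x"
    by (simp only: scaleC_of_real[symmetric] scaleC_scaleC scaleR_conv_of_real)
  show "norm (a *\<^sub>C x) \<le> norm a * norm x" by (simp add: norm_scaleC)
qed

lemmas continuous_on_cinner_right [continuous_intros] =
  bounded_linear.continuous_on[OF bounded_linear_cinner_right]

lemmas continuous_on_scaleC [continuous_intros] =
  bounded_linear.continuous_on[OF bounded_linear_scaleC_left]

section \<open>The projection theorem and uniform boundedness\<close>

text \<open>
  The projection theorem. The parallelogram identity makes a sequence minimising the distance to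
  \<open>v\<close> Cauchy; at its limit \<open>p\<close>, minimality forces \<open>v - p\<close> to be orthogonal to \<open>X\<close>.
\<close>

lemma closed_subspace_projection:
  fixes X :: "'a::chilbert_space set"
  assumes "closed X" and X: "cvec.subspace X"
  obtains p where "p \<in> X" and "\<And>x. x \<in> X \<Longrightarrow> cinner x (v - p) = 0"
proof -
  define d where "d = (INF x\<in>X. norm (v - x))"
  have ne: "X \<noteq> {}" using cvec.subspace_0[OF X] by auto
  have bdd: "bdd_below ((\<lambda>x. norm (v - x)) ` X)"
    by (rule bdd_belowI[of _ 0]) auto
  have d_le: "d \<le> norm (v - x)" if "x \<in> X" for x
    unfolding d_def using bdd that by (rule cINF_lower)
  have d0: "d \<ge> 0" unfolding d_def using ne by (intro cINF_greatest) auto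
  have "\<exists>x\<in>X. norm (v - x) < d + 1 / real (Suc n)" for n
  proof -
    have "d < d + 1 / real (Suc n)" by simp
    then show ?thesis unfolding d_def using cINF_less_iff[OF ne bdd] by blast
  qed
  then obtain y where y: "\<And>n. y n \<in> X" "\<And>n. norm (v - y n) < d + 1 / real (Suc n)"
    by metis
  have par: "(norm (a - b))\<^sup>2 \<le> 2 * (norm (v - a))\<^sup>2 + 2 * (norm (v - b))\<^sup>2 - 4 * d\<^sup>2"
    if "a \<in> X" "b \<in> X" for a b
  proof -
    have "(1/2) *\<^sub>C (a + b) \<in> X"
      using X that by (intro cvec.subspace_scale cvec.subspace_add)
    then have "d \<le> norm (v - (1/2) *\<^sub>C (a + b))" by (rule d_le)
    moreover have "2 * norm (v - (1/2) *\<^sub>C (a + b)) = norm ((v - a) + (v - b))"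
    proof -
      have "2 *\<^sub>C v = v + v"
        using scaleC_add_left[of 1 1 v] by simp
      then have "(v - a) + (v - b) = 2 *\<^sub>C (v - (1/2) *\<^sub>C (a + b))"
        by (simp add: cvec.scale_right_diff_distrib)
      then show ?thesis by (simp add: norm_scaleC)
    qed
    ultimately have "2 * d \<le> norm ((v - a) + (v - b))" by simp
    then have "(2 * d)\<^sup>2 \<le> (norm ((v - a) + (v - b)))\<^sup>2" using d0 by (intro power_mono) auto
    moreover have "a - b = (v - b) - (v - a)" by simp
    ultimately show ?thesis
      using norm_add_square[of "v - b" "v - a"] norm_diff_square[of "v - b" "v - a"]
      by (simp add: power_mult_distrib add.commute)
  qed
  have lim_d: "(\<lambda>n. norm (v - y n)) \<longlonglongrightarrow> d"
  proof (rule tendsto_sandwich[of "\<lambda>n. d" _ _ "\<lambda>n. d + 1 / real (Suc n)"])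
    have "(\<lambda>n. d + 1 / real (Suc n)) \<longlonglongrightarrow> d + 0"
      by (intro tendsto_intros LIMSEQ_Suc[OF lim_1_over_n])
    then show "(\<lambda>n. d + 1 / real (Suc n)) \<longlonglongrightarrow> d" by simp
  qed (use d_le y in \<open>auto simp: less_imp_le\<close>)
  have "Cauchy y"
  proof (rule CauchyI)
    fix e :: real assume e: "0 < e"
    have "(\<lambda>n. (norm (v - y n))\<^sup>2) \<longlonglongrightarrow> d\<^sup>2" using lim_d by (intro tendsto_intros)
    moreover have "d\<^sup>2 < d\<^sup>2 + e\<^sup>2 / 4" using e by simp
    ultimately have "\<forall>\<^sub>F n in sequentially. (norm (v - y n))\<^sup>2 < d\<^sup>2 + e\<^sup>2 / 4"
      by (rule order_tendstoD(2))
    then obtain N where N: "\<And>n. n \<ge> N \<Longrightarrow> (norm (v - y n))\<^sup>2 < d\<^sup>2 + e\<^sup>2 / 4"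
      by (auto simp: eventually_sequentially)
    have "norm (y m - y n) < e" if "m \<ge> N" "n \<ge> N" for m n
    proof -
      have "(norm (y m - y n))\<^sup>2 < e\<^sup>2"
        using par[OF y(1)[of m] y(1)[of n]] N[OF that(1)] N[OF that(2)] by linarith
      then show ?thesis using e by (simp add: power2_less_imp_less)
    qed
    then show "\<exists>M. \<forall>m\<ge>M. \<forall>n\<ge>M. norm (y m - y n) < e" by blast
  qed
  then obtain p where p: "y \<longlonglongrightarrow> p" using convergent_eq_Cauchy by (auto simp: convergent_def)
  have pX: "p \<in> X" using closed_sequentially[OF \<open>closed X\<close>] y(1) p by blast
  have "(\<lambda>n. norm (v - y n)) \<longlonglongrightarrow> norm (v - p)" using p by (intro tendsto_intros)
  then have nd: "norm (v - p) = d" using lim_d LIMSEQ_unique by blast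
  have "cinner x (v - p) = 0" if x: "x \<in> X" for x
  proof (cases "x = 0")
    case False
    define c where "c = cinner x (v - p) / complex_of_real ((norm x)\<^sup>2)"
    have "cinner x (v - p - c *\<^sub>C x) = 0"
      using False by (simp add: cinner_diff_right cinner_scaleC_right cinner_self c_def)
    then have "cinner (c *\<^sub>C x) (v - p - c *\<^sub>C x) = 0" by (simp add: cinner_scaleC_left)
    from norm_add_square_orthogonal[OF this]
    have *: "(norm (v - p))\<^sup>2 = (norm (c *\<^sub>C x))\<^sup>2 + (norm (v - (p + c *\<^sub>C x)))\<^sup>2"
      by (simp add: algebra_simps)
    have "p + c *\<^sub>C x \<in> X" using X pX x by (intro cvec.subspace_add cvec.subspace_scale)
    from d_le[OF this] have "d\<^sup>2 \<le> (norm (v - (p + c *\<^sub>C x)))\<^sup>2"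
      using d0 by (intro power_mono) auto
    with * nd have "norm (c *\<^sub>C x) = 0" by simp
    then show ?thesis using False by (simp add: c_def)
  qed simp
  with pX show ?thesis using that by blast
qed

text \<open>
  Uniform boundedness for the functionals \<open>cinner w\<close>: by Baire's theorem one of the closed sets on
  which they are bounded by \<open>m\<close> contains a ball.
\<close>

lemma weakly_bounded_imp_bounded:
  fixes W :: "'a::chilbert_space set"
  assumes pt: "\<And>y. \<exists>m. \<forall>w\<in>W. cmod (cinner w y) \<le> m"
  obtains C where "\<And>w. w \<in> W \<Longrightarrow> norm w \<le> C"
proof -
  define F where "F m = {y. \<forall>w\<in>W. cmod (cinner w y) \<le> real m}" for m :: nat
  have closed: "closed (F m)" for m
  proof -
    have "F m = (\<Inter>w\<in>W. {y. cmod (cinner w y) \<le> real m})" by (auto simp: F_def)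
    moreover have "closed {y. cmod (cinner w y) \<le> real m}" for w
      by (intro closed_Collect_le continuous_intros)
    ultimately show ?thesis by auto
  qed
  have cover: "\<Union>(range F) = UNIV"
  proof -
    have "y \<in> \<Union>(range F)" for y
    proof -
      obtain m where m: "\<And>w. w \<in> W \<Longrightarrow> cmod (cinner w y) \<le> m" using pt by blast
      obtain k :: nat where "m \<le> real k" using real_arch_simple by blast
      with m have "y \<in> F k" unfolding F_def by force
      then show ?thesis by blast
    qed
    then show ?thesis by blast
  qed
  have "\<exists>m. interior (F m) \<noteq> {}"
  proof (rule ccontr)
    assume "\<nexists>m. interior (F m) \<noteq> {}"
    then have "interior (\<Union>(range F)) = {}"
      using closed Met_TC.metric_Baire_category_alt[where \<G> = "range F" and 'a = 'a]
      by (auto simp: complete_UNIV)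
    then show False using cover by simp
  qed
  then obtain m y0 where "y0 \<in> interior (F m)" by blast
  then obtain r where r: "r > 0" "cball y0 r \<subseteq> F m" by (auto simp: mem_interior_cball)
  have "norm w \<le> 2 * real m / r" if w: "w \<in> W" for w
  proof (cases "w = 0")
    case False
    define y where "y = y0 + complex_of_real (r / norm w) *\<^sub>C w"
    have "y \<in> F m" and "y0 \<in> F m"
      using r False by (auto simp: y_def dist_norm norm_scaleC norm_divide intro!: subsetD[OF r(2)])
    then have "cmod (cinner w y) \<le> m" "cmod (cinner w y0) \<le> m"
      using w by (auto simp: F_def)
    moreover have "cinner w y - cinner w y0 = complex_of_real (r * norm w)"
      using False by (simp add: y_def cinner_algebra cinner_self power2_eq_square)
    moreover have "cmod (complex_of_real (r * norm w)) = r * norm w"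
      using r by (simp add: norm_mult)
    ultimately have "r * norm w \<le> 2 * m"
      using norm_triangle_ineq4[of "cinner w y" "cinner w y0"] by simp
    then show ?thesis using r by (simp add: field_simps)
  qed (use r in simp)
  then show ?thesis using that by blast
qed

section \<open>Bounded and self-adjoint operators\<close>

lemma bounded_clinear_linear: "bounded_clinear T \<Longrightarrow> bounded_linear T"
  by (simp add: bounded_clinear_def)

lemma bounded_clinear_scaleC: "bounded_clinear T \<Longrightarrow> T (c *\<^sub>C v) = c *\<^sub>C T v"
  by (simp add: bounded_clinear_def)

lemma bounded_clinear_simps:
  assumes "bounded_clinear T"
  shows "T (x + y) = T x + T y" "T (x - y) = T x - T y" "T (- x) = - T x" "T 0 = 0"
    "T (c *\<^sub>C v) = c *\<^sub>C T v" "T (sum f I) = (\<Sum>i\<in>I. T (f i))"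
proof -
  interpret bounded_linear T using assms by (rule bounded_clinear_linear)
  show "T (x + y) = T x + T y" "T (x - y) = T x - T y" "T (- x) = - T x" "T 0 = 0"
    "T (sum f I) = (\<Sum>i\<in>I. T (f i))"
    by (auto simp: add diff neg zero sum)
  show "T (c *\<^sub>C v) = c *\<^sub>C T v" using assms by (rule bounded_clinear_scaleC)
qed

lemma bounded_clinear_shift:
  assumes "bounded_clinear T"
  shows "bounded_clinear (\<lambda>v. T v - z *\<^sub>C v)"
  unfolding bounded_clinear_def
proof (intro conjI allI)
  show "bounded_linear (\<lambda>v. T v - z *\<^sub>C v)"
    by (intro bounded_linear_sub bounded_clinear_linear[OF assms] bounded_linear_scaleC)
  show "T (c *\<^sub>C v) - z *\<^sub>C c *\<^sub>C v = c *\<^sub>C (T v - z *\<^sub>C v)" for c v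
    by (simp add: bounded_clinear_simps[OF assms] cvec.scale_right_diff_distrib scaleC_scaleC
        mult.commute)
qed

lemma subspace_image:
  assumes T: "bounded_clinear T" and X: "cvec.subspace X"
  shows "cvec.subspace (T ` X)"
  unfolding cvec.subspace_def
proof (intro conjI ballI allI)
  show "0 \<in> T ` X"
    using cvec.subspace_0[OF X] bounded_clinear_simps(4)[OF T] by (metis imageI)
  show "x + y \<in> T ` X" if "x \<in> T ` X" "y \<in> T ` X" for x y
    using that cvec.subspace_add[OF X] by (auto simp flip: bounded_clinear_simps(1)[OF T])
  show "c *\<^sub>C x \<in> T ` X" if "x \<in> T ` X" for c x
    using that cvec.subspace_scale[OF X] by (auto simp flip: bounded_clinear_simps(5)[OF T])
qed

lemmas subspace_range = subspace_image[OF _ cvec.subspace_UNIV]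

lemma subspace_kernel:
  assumes "bounded_clinear T"
  shows "cvec.subspace {v. T v = 0}"
  by (auto simp: cvec.subspace_def bounded_clinear_simps[OF assms])

lemma closed_kernel:
  assumes "bounded_clinear T"
  shows "closed {v. T v = 0}"
  using linear_continuous_on[OF bounded_clinear_linear[OF assms]]
  by (rule closed_Collect_eq) (rule continuous_on_const)

lemma subspace_imp_real_subspace:
  assumes "cvec.subspace X"
  shows "subspace (X :: 'a::chilbert_space set)"
  using assms unfolding cvec.subspace_def subspace_def by (metis scaleC_of_real)

lemma self_adjoint_bounded_clinear: "self_adjoint T \<Longrightarrow> bounded_clinear T"
  by (simp add: self_adjoint_def)

lemma self_adjoint_cinner: "self_adjoint T \<Longrightarrow> cinner (T u) v = cinner u (T v)"
  by (simp add: self_adjoint_def)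

lemma self_adjoint_shift_cinner:
  assumes "self_adjoint T"
  shows "cinner (T u - z *\<^sub>C u) v = cinner u (T v - cnj z *\<^sub>C v)"
  by (simp add: cinner_algebra self_adjoint_cinner[OF assms])

lemma orthogonal_range_iff_kernel:
  assumes "self_adjoint T"
  shows "(\<forall>x\<in>range (\<lambda>v. T v - z *\<^sub>C v). cinner x y = 0) \<longleftrightarrow> T y - cnj z *\<^sub>C y = 0"
proof
  assume "\<forall>x\<in>range (\<lambda>v. T v - z *\<^sub>C v). cinner x y = 0"
  then have "cinner x (T y - cnj z *\<^sub>C y) = 0" for x
    by (simp add: self_adjoint_shift_cinner[OF assms, symmetric])
  then show "T y - cnj z *\<^sub>C y = 0" using cinner_self_eq_0 by blast
qed (auto simp: self_adjoint_shift_cinner[OF assms])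

text \<open>
  The orthogonal complement of the range of \<open>T - z\<close> is the kernel of its adjoint \<open>T - cnj z\<close>, and
  a closed range is complemented by its orthogonal complement.
\<close>

lemma range_plus_kernel:
  assumes sa: "self_adjoint T" and "closed (range (\<lambda>v. T v - z *\<^sub>C v))"
  obtains p q where "v = p + q" "p \<in> range (\<lambda>v. T v - z *\<^sub>C v)" "T q - cnj z *\<^sub>C q = 0"
proof -
  obtain p where p: "p \<in> range (\<lambda>v. T v - z *\<^sub>C v)"
    "\<And>x. x \<in> range (\<lambda>v. T v - z *\<^sub>C v) \<Longrightarrow> cinner x (v - p) = 0"
    using closed_subspace_projection[OF assms(2)
        subspace_range[OF bounded_clinear_shift[OF self_adjoint_bounded_clinear[OF sa]]], of v]
    by blast
  then have "T (v - p) - cnj z *\<^sub>C (v - p) = 0"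
    using orthogonal_range_iff_kernel[OF sa] by blast
  with p(1) that[of p "v - p"] show ?thesis by simp
qed

section \<open>Fredholm criteria for self-adjoint operators\<close>

text \<open>
  A gap around \<open>l\<close>, by uniform boundedness. Put \<open>S = T - l\<close> and consider the \<open>w\<close> orthogonal to the
  kernel of \<open>S\<close> with \<open>norm (S w) \<le> 1\<close>. Every \<open>y\<close> has the form \<open>S x + q\<close> with \<open>S q = 0\<close>, so \<open>cinner
  w y = cinner (S w) x\<close> is bounded in \<open>w\<close>; hence these \<open>w\<close> are bounded in norm.
\<close>

lemma fredholm_imp_bounded_below:
  assumes sa: "self_adjoint T" and fr: "fredholm (\<lambda>v. T v - complex_of_real l *\<^sub>C v)"
  obtains c where "c > 0"
    "\<And>v. (\<And>y. T y = complex_of_real l *\<^sub>C y \<Longrightarrow> cinner y v = 0) \<Longrightarrow>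
      c * norm v \<le> norm (T v - complex_of_real l *\<^sub>C v)"
proof -
  let ?S = "\<lambda>v. T v - complex_of_real l *\<^sub>C v"
  define W where "W = {v. (\<forall>y. T y = complex_of_real l *\<^sub>C y \<longrightarrow> cinner y v = 0) \<and> norm (?S v) \<le> 1}"
  have bcS: "bounded_clinear ?S"
    using sa by (intro bounded_clinear_shift self_adjoint_bounded_clinear)
  have cl: "closed (range ?S)" using fr by (simp add: fredholm_def)
  have "\<exists>m. \<forall>w\<in>W. cmod (cinner w y) \<le> m" for y
  proof -
    obtain p q where pq: "y = p + q" "p \<in> range ?S" "T q - cnj (complex_of_real l) *\<^sub>C q = 0"
      by (rule range_plus_kernel[OF sa cl])
    then obtain x where y: "y = ?S x + q" and q: "?S q = 0" by auto
    have "cmod (cinner w y) \<le> norm x" if w: "w \<in> W" for w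
    proof -
      have "cinner q w = 0" using w q by (auto simp: W_def)
      then have "cinner w q = 0" by (metis cinner_commute complex_cnj_zero)
      then have "cinner w y = cinner (?S w) x"
        using self_adjoint_shift_cinner[OF sa, of w "complex_of_real l" x] y
        by (simp add: cinner_add_right)
      also have "cmod \<dots> \<le> norm (?S w) * norm x" by (rule norm_cinner_le)
      also have "\<dots> \<le> 1 * norm x" using w by (intro mult_right_mono) (auto simp: W_def)
      finally show ?thesis by simp
    qed
    then show ?thesis by blast
  qed
  then obtain C where C: "\<And>w. w \<in> W \<Longrightarrow> norm w \<le> C"
    using weakly_bounded_imp_bounded by blast
  have "1 / max C 1 * norm v \<le> norm (?S v)"
    if v: "\<And>y. T y = complex_of_real l *\<^sub>C y \<Longrightarrow> cinner y v = 0" for v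
  proof (cases "?S v = 0")
    case True
    then have "cinner v v = 0" by (intro v) simp
    then show ?thesis by simp
  next
    case False
    define r where "r = complex_of_real (1 / norm (?S v))"
    have "?S (r *\<^sub>C v) = r *\<^sub>C ?S v" by (rule bounded_clinear_simps(5)[OF bcS])
    moreover have "norm (r *\<^sub>C ?S v) = 1" unfolding r_def norm_scaleC using False by (simp add: norm_divide)
    ultimately have "r *\<^sub>C v \<in> W" using v by (auto simp: W_def cinner_scaleC_right)
    then have "norm (r *\<^sub>C v) \<le> max C 1" using C by fastforce
    moreover have "norm (r *\<^sub>C v) = norm v / norm (?S v)"
      by (simp add: r_def norm_scaleC norm_divide)
    ultimately show ?thesis using False by (simp add: divide_le_eq mult.commute)
  qed
  with that[of "1 / max C 1"] show ?thesis by simp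
qed

text \<open>
  To add one vector \<open>b\<close> to a closed subspace \<open>Y\<close>, replace it by its component orthogonal to \<open>Y\<close>.
  The enlarged span is then the preimage of \<open>Y\<close> under the continuous map that removes this
  component.
\<close>

lemma closed_span_Un_finite:
  fixes X :: "'a::chilbert_space set"
  assumes "closed X" "cvec.subspace X" "finite B"
  shows "closed (cvec.span (X \<union> B))"
  using assms(3)
proof (induction B rule: finite_induct)
  case empty
  then show ?case using assms by (simp add: cvec.span_eq_iff[THEN iffD2])
next
  case (insert b B)
  let ?Y = "cvec.span (X \<union> B)"
  obtain p where p: "p \<in> ?Y" "\<And>x. x \<in> ?Y \<Longrightarrow> cinner x (b - p) = 0"
    using closed_subspace_projection[OF insert.IH cvec.subspace_span] by blast
  let ?b = "b - p"
  have orth: "cinner ?b x = 0" if "x \<in> ?Y" for x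
    using p(2)[OF that] by (metis cinner_commute complex_cnj_zero)
  define g where "g y = y - (cinner ?b y / complex_of_real ((norm ?b)\<^sup>2)) *\<^sub>C ?b" for y
  have "cvec.span (X \<union> insert b B) = {y. g y \<in> ?Y}"
  proof (intro set_eqI iffI)
    fix y assume "y \<in> cvec.span (X \<union> insert b B)"
    then obtain k where k: "y - k *\<^sub>C b \<in> ?Y" by (auto simp: cvec.span_insert)
    have "y - k *\<^sub>C b + k *\<^sub>C p \<in> ?Y" using k p(1) by (intro cvec.span_add cvec.span_scale)
    then have y: "y - k *\<^sub>C ?b \<in> ?Y" by (simp add: cvec.scale_right_diff_distrib algebra_simps)
    from orth[OF this] have "cinner ?b y = k * complex_of_real ((norm ?b)\<^sup>2)"
      by (simp add: cinner_diff_right[of _ y] cinner_scaleC_right cinner_self)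
    then have "g y = y - k *\<^sub>C ?b" unfolding g_def by (cases "?b = 0") simp_all
    then show "y \<in> {y. g y \<in> ?Y}" using y by simp
  next
    fix y assume "y \<in> {y. g y \<in> ?Y}"
    then obtain k where k: "y - k *\<^sub>C ?b \<in> ?Y" by (auto simp: g_def)
    have "y - k *\<^sub>C ?b - k *\<^sub>C p \<in> ?Y" by (rule cvec.span_diff[OF k cvec.span_scale[OF p(1)]])
    moreover have "y - k *\<^sub>C ?b - k *\<^sub>C p = y - k *\<^sub>C b"
      by (simp add: cvec.scale_right_diff_distrib)
    ultimately have "\<exists>k. y - k *\<^sub>C b \<in> ?Y" by metis
    then show "y \<in> cvec.span (X \<union> insert b B)" by (simp add: cvec.span_insert)
  qed
  moreover have "continuous_on UNIV g"
    unfolding g_def by (cases "?b = 0") (auto intro!: continuous_intros)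
  ultimately show ?case
    using closed_vimage[OF insert.IH, of g] by (simp add: vimage_def)
qed

text \<open>
  Finite systems are initial segments of sequences, so that a system of length \<open>k\<close> is extended by
  the update \<open>u(k := x)\<close>.
\<close>

definition orthonormal :: "(nat \<Rightarrow> 'a::chilbert_space) \<Rightarrow> nat \<Rightarrow> bool" where
  "orthonormal u k \<longleftrightarrow> (\<forall>i<k. \<forall>j<k. cinner (u i) (u j) = (if i = j then 1 else 0))"

definition orth_compl :: "(nat \<Rightarrow> 'a::chilbert_space) \<Rightarrow> nat \<Rightarrow> 'a set" where
  "orth_compl u k = {v. \<forall>i<k. cinner (u i) v = 0}"

lemma subspace_orth_compl: "cvec.subspace (orth_compl u k)"
  by (auto simp: cvec.subspace_def orth_compl_def cinner_algebra)

lemma closed_orth_compl: "closed (orth_compl u k)"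
proof -
  have "orth_compl u k = (\<Inter>i<k. {v. cinner (u i) v = 0})" by (auto simp: orth_compl_def)
  moreover have "closed {v. cinner (u i) v = 0}" for i
    by (intro closed_Collect_eq continuous_intros)
  ultimately show ?thesis by auto
qed

lemma cinner_proj:
  assumes "orthonormal u k" "i < k"
  shows "cinner (u i) (proj u k v) = cinner (u i) v"
proof -
  have "cinner (u i) (proj u k v) = (\<Sum>j<k. if i = j then cinner (u i) v else 0)"
    unfolding proj_def cinner_sum_right
    using assms by (intro sum.cong) (auto simp: orthonormal_def cinner_scaleC_right)
  then show ?thesis using assms(2) by simp
qed

lemma proj_compl: "orthonormal u k \<Longrightarrow> v - proj u k v \<in> orth_compl u k"
  by (simp add: orth_compl_def cinner_diff_right cinner_proj)

lemma proj_in_span: "proj u k v \<in> cvec.span (u ` {..<k})"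
  unfolding proj_def by (intro cvec.span_sum cvec.span_scale cvec.span_base) auto

lemma bounded_clinear_proj: "bounded_clinear (proj u k)"
  unfolding bounded_clinear_def
proof (intro conjI allI)
  show "bounded_linear (proj u k)"
    unfolding proj_def
    by (intro bounded_linear_sum bounded_linear_compose[OF bounded_linear_scaleC_left
          bounded_linear_cinner_right])
  show "proj u k (c *\<^sub>C v) = c *\<^sub>C proj u k v" for c v
    by (simp add: proj_def cinner_scaleC_right cvec.scale_sum_right)
qed

text \<open>
  The orthogonal projection onto the span of \<open>u\<close> is injective on \<open>N\<close>, so \<open>N\<close> is the image of a
  finite-dimensional space under a linear left inverse.
\<close>

lemma finite_cdim_if_orth_compl_trivial:
  assumes N: "cvec.subspace N" and "orthonormal u k" and triv: "N \<inter> orth_compl u k \<subseteq> {0}"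
  shows "finite_cdim N"
proof -
  interpret P: vector_space_pair "scaleC :: complex \<Rightarrow> 'a \<Rightarrow> 'a" "scaleC :: complex \<Rightarrow> 'a \<Rightarrow> 'a"
    by unfold_locales
  have lin: "Vector_Spaces.linear scaleC scaleC (proj u k)"
    using bounded_clinear_proj[of u k]
    by (simp add: Vector_Spaces.linear_iff bounded_clinear_simps cvec.vector_space_axioms)
  have "inj_on (proj u k) N"
  proof (rule inj_onI)
    fix x y assume xy: "x \<in> N" "y \<in> N" "proj u k x = proj u k y"
    then have "proj u k (x - y) = 0" by (simp add: bounded_clinear_simps[OF bounded_clinear_proj])
    then have "x - y \<in> N \<inter> orth_compl u k"
      using xy cvec.subspace_diff[OF N] proj_compl[OF assms(2), of "x - y"] by simp
    then show "x = y" using triv by auto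
  qed
  then obtain g where g: "Vector_Spaces.linear scaleC scaleC g" "\<And>v. v \<in> N \<Longrightarrow> g (proj u k v) = v"
    using P.linear_exists_left_inverse_on[OF lin N] by blast
  interpret G: Vector_Spaces.linear scaleC scaleC g by (rule g)
  have "N \<subseteq> cvec.span (g ` u ` {..<k})"
  proof
    fix v assume "v \<in> N"
    then have "v = g (proj u k v)" using g(2) by simp
    then show "v \<in> cvec.span (g ` u ` {..<k})"
      using proj_in_span[of u k v] G.span_image[of "u ` {..<k}"] by blast
  qed
  then show ?thesis
    unfolding finite_cdim_def by (intro exI[of _ "g ` u ` {..<k}"] conjI finite_imageI) simp_all
qed

text \<open>
  The image of the complement of \<open>u\<close> is complete because \<open>S\<close> is bounded below there, and the
  images of finitely many vectors \<open>u i\<close> supply the rest of the range.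
\<close>

lemma closed_range_if_bounded_below:
  assumes bc: "bounded_clinear S" and on: "orthonormal u k" and c: "c > 0"
    and below: "\<And>v. v \<in> orth_compl u k \<Longrightarrow> c * norm v \<le> norm (S v)"
  shows "closed (range S)"
proof -
  let ?W = "orth_compl u k"
  have "complete (S ` ?W)"
  proof (rule complete_isometric_image[OF c])
    show "subspace ?W" by (intro subspace_imp_real_subspace subspace_orth_compl)
    show "bounded_linear S" by (rule bounded_clinear_linear[OF bc])
    show "\<forall>x\<in>?W. c * norm x \<le> norm (S x)" using below by blast
    show "complete ?W" by (simp only: complete_eq_closed closed_orth_compl)
  qed
  then have "closed (S ` ?W)" by (simp only: complete_eq_closed)
  moreover have "cvec.subspace (S ` ?W)"
    by (rule subspace_image[OF bc subspace_orth_compl])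
  ultimately have "closed (cvec.span (S ` ?W \<union> S ` u ` {..<k}))"
    by (intro closed_span_Un_finite) auto
  moreover have "range S = cvec.span (S ` ?W \<union> S ` u ` {..<k})"
  proof
    show "cvec.span (S ` ?W \<union> S ` u ` {..<k}) \<subseteq> range S"
      by (intro cvec.span_minimal subspace_range[OF bc]) auto
    show "range S \<subseteq> cvec.span (S ` ?W \<union> S ` u ` {..<k})"
    proof
      fix y assume "y \<in> range S"
      then obtain v where "y = S v" by blast
      also have "v = (v - proj u k v) + proj u k v" by simp
      also have "S \<dots> = S (v - proj u k v) + (\<Sum>i<k. cinner (u i) v *\<^sub>C S (u i))"
        unfolding bounded_clinear_simps(1)[OF bc]
        by (simp add: proj_def bounded_clinear_simps[OF bc])
      also have "\<dots> \<in> cvec.span (S ` ?W \<union> S ` u ` {..<k})"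
        using proj_compl[OF on]
        by (intro cvec.span_add cvec.span_sum cvec.span_scale cvec.span_base) auto
      finally show "y \<in> cvec.span (S ` ?W \<union> S ` u ` {..<k})" .
    qed
  qed
  ultimately show ?thesis by simp
qed

text \<open>
  A converse to \<open>fredholm_imp_bounded_below\<close>. The bound for \<open>cnj z\<close> controls the kernel of the
  adjoint, which is the orthogonal complement of the range.
\<close>

lemma fredholm_if_bounded_below:
  assumes sa: "self_adjoint T" and on: "orthonormal u k" and c: "c > 0"
    and below: "\<And>v. v \<in> orth_compl u k \<Longrightarrow> c * norm v \<le> norm (T v - z *\<^sub>C v)"
    and below_cnj: "\<And>v. v \<in> orth_compl u k \<Longrightarrow> c * norm v \<le> norm (T v - cnj z *\<^sub>C v)"
  shows "fredholm (\<lambda>v. T v - z *\<^sub>C v)"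
proof -
  have bc: "bounded_clinear (\<lambda>v. T v - w *\<^sub>C v)" for w
    using sa by (intro bounded_clinear_shift self_adjoint_bounded_clinear)
  have ker: "finite_cdim {v. T v - w *\<^sub>C v = 0}"
    if "\<And>v. v \<in> orth_compl u k \<Longrightarrow> c * norm v \<le> norm (T v - w *\<^sub>C v)" for w
  proof (rule finite_cdim_if_orth_compl_trivial[OF subspace_kernel[OF bc] on])
    show "{v. T v - w *\<^sub>C v = 0} \<inter> orth_compl u k \<subseteq> {0}"
    proof
      fix v assume v: "v \<in> {v. T v - w *\<^sub>C v = 0} \<inter> orth_compl u k"
      then have "c * norm v \<le> norm (T v - w *\<^sub>C v)" using that by blast
      then have "c * norm v \<le> 0" using v by simp
      then show "v \<in> {0}" using c by (simp add: mult_le_0_iff)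
    qed
  qed
  have cl: "closed (range (\<lambda>v. T v - z *\<^sub>C v))"
    by (rule closed_range_if_bounded_below[OF bc on c below])
  obtain B where B: "finite B" "{v. T v - cnj z *\<^sub>C v = 0} \<subseteq> cvec.span B"
    using ker[OF below_cnj] by (auto simp: finite_cdim_def)
  have "cvec.span (range (\<lambda>v. T v - z *\<^sub>C v) \<union> B) = UNIV"
  proof -
    have "v \<in> cvec.span (range (\<lambda>v. T v - z *\<^sub>C v) \<union> B)" for v
    proof -
      obtain p q where "v = p + q" "p \<in> range (\<lambda>v. T v - z *\<^sub>C v)" "T q - cnj z *\<^sub>C q = 0"
        using range_plus_kernel[OF sa cl] by blast
      then show ?thesis
        using B(2) cvec.span_mono[of B "range (\<lambda>v. T v - z *\<^sub>C v) \<union> B"]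
        by (auto intro!: cvec.span_add intro: cvec.span_base)
    qed
    then show ?thesis by blast
  qed
  then show ?thesis
    unfolding fredholm_def using ker[OF below] cl B(1) by (intro conjI exI[of _ B])
qed

lemma not_in_spectrum_if_bounded_below:
  assumes sa: "self_adjoint T" and c: "c > 0"
    and below: "\<And>v. c * norm v \<le> norm (T v - z *\<^sub>C v)"
    and below_cnj: "\<And>v. c * norm v \<le> norm (T v - cnj z *\<^sub>C v)"
  shows "z \<notin> spectrum T"
proof -
  define S where "S = (\<lambda>v. T v - z *\<^sub>C v)"
  have bc: "bounded_clinear S"
    unfolding S_def using sa by (intro bounded_clinear_shift self_adjoint_bounded_clinear)
  have cl: "closed (range S)"
    \<comment> \<open>The system of length \<open>0\<close>, whose complement is the whole space.\<close>
    using closed_range_if_bounded_below[OF bc, of "\<lambda>_. 0" 0 c] c below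
    by (simp add: orthonormal_def S_def)
  have surj: "\<exists>x. S x = y" for y
  proof -
    obtain p q where pq: "y = p + q" "p \<in> range S" "T q - cnj z *\<^sub>C q = 0"
      using range_plus_kernel[OF sa cl[unfolded S_def], of y] unfolding S_def by blast
    have "c * norm q \<le> 0" using below_cnj[of q] unfolding pq(3) by simp
    then have "q = 0" using c by (simp add: mult_le_0_iff)
    then show ?thesis using pq by auto
  qed
  have inj: "x = y" if "S x = S y" for x y
  proof -
    have "S (x - y) = 0" using that by (simp add: bounded_clinear_simps[OF bc])
    then have "c * norm (x - y) \<le> 0" using below[of "x - y"] by (simp add: S_def)
    then show ?thesis using c by (simp add: mult_le_0_iff)
  qed
  obtain R where SR: "\<And>y. S (R y) = y" using surj by metis
  then have RS: "R (S x) = x" for x using inj by blast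
  have "bounded_clinear R"
    unfolding bounded_clinear_def
  proof (intro conjI allI)
    show "R (a *\<^sub>C v) = a *\<^sub>C R v" for a v
      by (rule inj) (simp add: SR bounded_clinear_simps[OF bc])
    show "bounded_linear R"
    proof (rule bounded_linear_intro[where K = "1 / c"])
      show "R (x + y) = R x + R y" for x y
        by (rule inj) (simp add: SR bounded_clinear_simps[OF bc])
      show "R (r *\<^sub>R x) = r *\<^sub>R R x" for r x
        by (rule inj) (simp add: SR scaleC_of_real[symmetric] bounded_clinear_simps[OF bc])
      have "c * norm (R x) \<le> norm (S (R x))" for x
        unfolding S_def by (rule below)
      then show "norm (R x) \<le> norm x * (1 / c)" for x
        using c by (simp add: SR field_simps)
    qed
  qed
  with SR RS show ?thesis unfolding spectrum_def S_def by blast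
qed

lemma ess_spectrum_norm_le:
  assumes sa: "self_adjoint T" and "z \<in> ess_spectrum T"
  shows "cmod z \<le> onorm T"
proof (rule ccontr)
  assume less: "\<not> cmod z \<le> onorm T"
  have "(cmod z - onorm T) * norm v \<le> norm (T v - w *\<^sub>C v)" if "cmod w = cmod z" for w v
  proof -
    have "norm (w *\<^sub>C v) - norm (T v) \<le> norm (T v - w *\<^sub>C v)"
      by (metis norm_minus_commute norm_triangle_ineq2)
    moreover have "norm (T v) \<le> onorm T * norm v"
      by (rule onorm[OF bounded_clinear_linear[OF self_adjoint_bounded_clinear[OF sa]]])
    ultimately show ?thesis using that by (simp add: norm_scaleC algebra_simps)
  qed
  then have "fredholm (\<lambda>v. T v - z *\<^sub>C v)"
    using less by (intro fredholm_if_bounded_below[OF sa, of "\<lambda>_. 0" 0 "cmod z - onorm T"])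
      (auto simp: orthonormal_def)
  then show False using assms(2) by (simp add: ess_spectrum_def)
qed

text \<open>
  If \<open>Re z > M\<close>, then \<open>z - T\<close> is coercive on a subspace of finite codimension, so \<open>T - z\<close> is
  Fredholm.
\<close>

lemma ess_spectrum_le_form_bound:
  assumes sa: "self_adjoint T" and on: "orthonormal u k"
    and upper: "\<And>v. v \<in> orth_compl u k \<Longrightarrow> Re (cinner v (T v)) \<le> M * (norm v)\<^sup>2"
    and z: "z \<in> ess_spectrum T"
  shows "Re z \<le> M"
proof (rule ccontr)
  assume less: "\<not> Re z \<le> M"
  have "(Re z - M) * norm v \<le> norm (T v - w *\<^sub>C v)"
    if v: "v \<in> orth_compl u k" and w: "Re w = Re z" for v w
  proof (cases "v = 0")
    case False
    have "(Re z - M) * (norm v)\<^sup>2 \<le> Re (cinner v (w *\<^sub>C v - T v))"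
      using upper[OF v] w by (simp add: cinner_algebra cinner_self algebra_simps)
    also have "\<dots> \<le> cmod (cinner v (w *\<^sub>C v - T v))" by (rule complex_Re_le_cmod)
    also have "\<dots> \<le> norm v * norm (w *\<^sub>C v - T v)" by (rule norm_cinner_le)
    finally show ?thesis
      using False by (simp add: power2_eq_square norm_minus_commute)
  qed simp
  then have "fredholm (\<lambda>v. T v - z *\<^sub>C v)"
    using less by (intro fredholm_if_bounded_below[OF sa on, of "Re z - M"]) auto
  then show False using z by (simp add: ess_spectrum_def)
qed

text \<open>
  Let \<open>E\<close> be the eigenspace of \<open>l\<close>. For \<open>w\<close> near \<open>l\<close> the operator \<open>T - w\<close> respects the splitting
  into \<open>E\<close> and its orthogonal complement: on \<open>E\<close> it is multiplication by \<open>l - w\<close>, on the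
  complement it is a small perturbation of \<open>T - l\<close>, which is bounded below there. So only \<open>w = l\<close>
  can be spectral.
\<close>

lemma isolated_in_spectrum:
  assumes sa: "self_adjoint T" and fr: "complex_of_real l \<notin> ess_spectrum T"
    and ev: "T x = complex_of_real l *\<^sub>C x" "x \<noteq> 0"
  shows "complex_of_real l isolated_in spectrum T"
proof -
  let ?l = "complex_of_real l"
  have bc: "bounded_clinear T" using sa by (rule self_adjoint_bounded_clinear)
  define E where "E = {v. T v - ?l *\<^sub>C v = 0}"
  have E: "closed E" "cvec.subspace E"
    unfolding E_def by (intro closed_kernel subspace_kernel bounded_clinear_shift bc)+
  obtain c where c: "c > 0"
    "\<And>v. (\<And>y. T y = ?l *\<^sub>C y \<Longrightarrow> cinner y v = 0) \<Longrightarrow> c * norm v \<le> norm (T v - ?l *\<^sub>C v)"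
    using fredholm_imp_bounded_below[OF sa, of l] fr by (auto simp: ess_spectrum_def)
  have below: "min (cmod (w - ?l)) (c - cmod (w - ?l)) * norm v \<le> norm (T v - w *\<^sub>C v)"
    if w: "cmod (w - ?l) < c" for w v
  proof -
    let ?m = "min (cmod (w - ?l)) (c - cmod (w - ?l))"
    obtain p where p: "p \<in> E" "\<And>x. x \<in> E \<Longrightarrow> cinner x (v - p) = 0"
      using closed_subspace_projection[OF E, of v] by blast
    define q where "q = v - p"
    have v: "v = p + q" by (simp add: q_def)
    have Eq: "cinner y q = 0" if "T y = ?l *\<^sub>C y" for y
      using p(2)[of y] that by (simp add: E_def q_def)
    have Tp: "T p = ?l *\<^sub>C p" using p(1) by (simp add: E_def)
    have pq: "cinner p q = 0" by (rule Eq[OF Tp])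
    have "cinner p (T q) = cinner (T p) q" by (simp add: self_adjoint_cinner[OF sa])
    then have pTq: "cinner p (T q) = 0" by (simp add: Tp cinner_scaleC_left pq)
    have "T v - w *\<^sub>C v = (?l - w) *\<^sub>C p + (T q - w *\<^sub>C q)"
      by (simp add: v bounded_clinear_simps[OF bc] Tp cvec.scale_right_distrib
          cvec.scale_left_diff_distrib)
    moreover have "cinner ((?l - w) *\<^sub>C p) (T q - w *\<^sub>C q) = 0"
      by (simp add: cinner_algebra pq pTq)
    ultimately have Tv: "(norm (T v - w *\<^sub>C v))\<^sup>2 =
        (cmod (w - ?l) * norm p)\<^sup>2 + (norm (T q - w *\<^sub>C q))\<^sup>2"
      by (simp only: norm_add_square_orthogonal norm_scaleC norm_minus_commute[of w])
    have "T q - w *\<^sub>C q = (T q - ?l *\<^sub>C q) - (w - ?l) *\<^sub>C q"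
      by (simp add: cvec.scale_left_diff_distrib)
    then have "norm (T q - ?l *\<^sub>C q) - cmod (w - ?l) * norm q \<le> norm (T q - w *\<^sub>C q)"
      by (metis norm_scaleC norm_triangle_ineq2)
    with c(2)[OF Eq] have "(c - cmod (w - ?l)) * norm q \<le> norm (T q - w *\<^sub>C q)"
      by (force simp: algebra_simps)
    moreover have "?m * norm q \<le> (c - cmod (w - ?l)) * norm q"
      by (intro mult_right_mono) auto
    ultimately have "?m * norm q \<le> norm (T q - w *\<^sub>C q)" by linarith
    moreover have "?m * norm p \<le> cmod (w - ?l) * norm p" by (intro mult_right_mono) auto
    moreover have "?m \<ge> 0" using w by simp
    ultimately have "(?m * norm p)\<^sup>2 + (?m * norm q)\<^sup>2 \<le> (norm (T v - w *\<^sub>C v))\<^sup>2"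
      unfolding Tv by (intro add_mono power_mono) auto
    moreover have "(?m * norm v)\<^sup>2 = (?m * norm p)\<^sup>2 + (?m * norm q)\<^sup>2"
      using norm_add_square_orthogonal[OF pq] by (simp add: v power_mult_distrib algebra_simps)
    ultimately show ?thesis by (metis norm_ge_zero power2_le_imp_le)
  qed
  have "y \<notin> spectrum T" if y: "dist ?l y < c" "y \<noteq> ?l" for y
  proof (rule not_in_spectrum_if_bounded_below[OF sa])
    have y1: "cmod (y - ?l) < c" using y(1) by (simp add: dist_norm norm_minus_commute)
    then show "min (cmod (y - ?l)) (c - cmod (y - ?l)) > 0" using y(2) by simp
    show "min (cmod (y - ?l)) (c - cmod (y - ?l)) * norm v \<le> norm (T v - y *\<^sub>C v)" for v
      by (rule below[OF y1])
    have "cmod (cnj y - ?l) = cmod (y - ?l)"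
      by (metis complex_cnj_complex_of_real complex_cnj_diff complex_mod_cnj)
    then show "min (cmod (y - ?l)) (c - cmod (y - ?l)) * norm v \<le> norm (T v - cnj y *\<^sub>C v)" for v
      using below[of "cnj y" v] y1 by simp
  qed
  moreover have "?l \<in> spectrum T"
  proof -
    have "\<not> (bounded_clinear B \<and> (\<forall>v. B (T v - ?l *\<^sub>C v) = v))" for B
      using ev by (metis bounded_clinear_simps(4) right_minus_eq)
    then show ?thesis by (auto simp: spectrum_def)
  qed
  ultimately show ?thesis using c(1) by (auto simp: isolated_in_dist_Ex_iff)
qed

section \<open>Deflation: extracting the largest eigenvalues\<close>

text \<open>
  A homogeneous linear system with more unknowns than equations has a nontrivial solution, by
  elimination of one unknown \<open>p\<close> at a time.
\<close>

lemma exists_combination_in_kernel: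
  fixes a :: "'i \<Rightarrow> nat \<Rightarrow> complex"
  assumes "finite I" "m < card I"
  shows "\<exists>c. (\<exists>i\<in>I. c i \<noteq> 0) \<and> (\<forall>j<m. (\<Sum>i\<in>I. c i * a i j) = 0)"
  using assms
proof (induction m arbitrary: I a)
  case 0
  then have "I \<noteq> {}" by auto
  then show ?case by (intro exI[of _ "\<lambda>_. 1"]) auto
next
  case (Suc m)
  show ?case
  proof (cases "\<forall>i\<in>I. a i m = 0")
    case True
    obtain c where c: "\<exists>i\<in>I. c i \<noteq> 0" "\<And>j. j < m \<Longrightarrow> (\<Sum>i\<in>I. c i * a i j) = 0"
      using Suc.IH[of I a] Suc.prems by auto
    have "(\<Sum>i\<in>I. c i * a i j) = 0" if "j < Suc m" for j
      using c(2)[of j] True that by (cases "j = m") auto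
    with c(1) show ?thesis by blast
  next
    case False
    then obtain p where p: "p \<in> I" "a p m \<noteq> 0" by blast
    define b where "b i j = a i j - a i m / a p m * a p j" for i j
    have "finite (I - {p})" "m < card (I - {p})" using Suc.prems p by auto
    then obtain c where c: "\<exists>i\<in>I - {p}. c i \<noteq> 0"
      "\<And>j. j < m \<Longrightarrow> (\<Sum>i\<in>I - {p}. c i * b i j) = 0"
      using Suc.IH[of "I - {p}" b] by blast
    define d where "d = c(p := - (\<Sum>i\<in>I - {p}. c i * a i m) / a p m)"
    have split: "(\<Sum>i\<in>I. d i * a i j) = d p * a p j + (\<Sum>i\<in>I - {p}. c i * a i j)" for j
    proof -
      have "(\<Sum>i\<in>I. d i * a i j) = d p * a p j + (\<Sum>i\<in>I - {p}. d i * a i j)"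
        by (rule sum.remove) (use Suc.prems p in auto)
      also have "(\<Sum>i\<in>I - {p}. d i * a i j) = (\<Sum>i\<in>I - {p}. c i * a i j)"
        by (intro sum.cong) (auto simp: d_def)
      finally show ?thesis .
    qed
    have eq: "(\<Sum>i\<in>I. d i * a i j) = (\<Sum>i\<in>I - {p}. c i * b i j)" for j
    proof -
      have "d p * a p j = - (\<Sum>i\<in>I - {p}. c i * (a i m / a p m * a p j))"
        by (simp add: d_def sum_divide_distrib sum_distrib_right mult.assoc)
      then show ?thesis
        unfolding split b_def by (simp add: right_diff_distrib sum_subtractf)
    qed
    have "(\<Sum>i\<in>I. d i * a i j) = 0" if "j < Suc m" for j
    proof (cases "j = m")
      case True
      then show ?thesis unfolding eq using p by (simp add: b_def)
    next
      case False
      then show ?thesis using eq c(2)[of j] that by simp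
    qed
    moreover have "\<exists>i\<in>I. d i \<noteq> 0" using c(1) by (auto simp: d_def)
    ultimately show ?thesis by blast
  qed
qed

lemma cinner_combination:
  assumes "orthonormal u k" "j < k"
  shows "cinner (u j) (\<Sum>i<k. c i *\<^sub>C u i) = c j"
proof -
  have "cinner (u j) (\<Sum>i<k. c i *\<^sub>C u i) = (\<Sum>i<k. if j = i then c j else 0)"
    unfolding cinner_sum_right
    using assms by (intro sum.cong) (auto simp: orthonormal_def cinner_scaleC_right)
  then show ?thesis using assms(2) by simp
qed

lemma cinner_combinations:
  assumes "orthonormal u k"
  shows "cinner (\<Sum>i<k. c i *\<^sub>C u i) (\<Sum>i<k. d i *\<^sub>C u i) = (\<Sum>i<k. cnj (c i) * d i)"
  by (simp add: cinner_sum_left[of _ "{..<k}"] cinner_scaleC_left cinner_combination[OF assms])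

lemma norm_combination:
  assumes "orthonormal u k"
  shows "(norm (\<Sum>i<k. c i *\<^sub>C u i))\<^sup>2 = (\<Sum>i<k. (cmod (c i))\<^sup>2)"
proof -
  have "Re (cnj a * a) = (cmod a)\<^sup>2" for a
    by (metis Re_complex_of_real complex_norm_square mult.commute)
  then show ?thesis
    unfolding Re_cinner_self[symmetric] cinner_combinations[OF assms] by simp
qed

lemma orthonormal_mono: "orthonormal u k \<Longrightarrow> j \<le> k \<Longrightarrow> orthonormal u j"
  by (auto simp: orthonormal_def)

lemma orthonormal_norm: "orthonormal u k \<Longrightarrow> i < k \<Longrightarrow> norm (u i) = 1"
  using Re_cinner_self[of "u i"] by (simp add: orthonormal_def abs_square_eq_1)

lemma orthonormal_inj:
  assumes on: "orthonormal u k"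
  shows "inj_on u {..<k}"
proof (rule inj_onI)
  fix i j assume "i \<in> {..<k}" "j \<in> {..<k}" "u i = u j"
  then have "cinner (u i) (u j) = 1" and "cinner (u i) (u j) = (if i = j then 1 else 0)"
    using on unfolding orthonormal_def by (metis lessThan_iff)+
  then show "i = j" by (metis zero_neq_one)
qed

lemma orthonormal_independent:
  assumes on: "orthonormal u k"
  shows "cvec.independent (u ` {..<k})"
proof (rule cvec.independent_if_scalars_zero)
  fix f x assume s: "(\<Sum>x\<in>u ` {..<k}. f x *\<^sub>C x) = 0" and x: "x \<in> u ` {..<k}"
  have "(\<Sum>i<k. f (u i) *\<^sub>C u i) = 0"
    using s by (simp add: sum.reindex[OF orthonormal_inj[OF on]])
  moreover obtain j where j: "j < k" "x = u j" using x by auto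
  ultimately show "f x = 0"
    using cinner_combination[OF on j(1), of "\<lambda>i. f (u i)"] by simp
qed simp

lemma orthonormal_in_orth_compl: "orthonormal u k \<Longrightarrow> i \<le> j \<Longrightarrow> j < k \<Longrightarrow> u j \<in> orth_compl u i"
  by (auto simp: orthonormal_def orth_compl_def)

lemma orth_compl_antimono: "i \<le> j \<Longrightarrow> orth_compl u j \<subseteq> orth_compl u i"
  by (auto simp: orth_compl_def)

lemma orth_compl_upd: "i \<le> k \<Longrightarrow> orth_compl (u(k := x)) i = orth_compl u i"
  by (auto simp: orth_compl_def)

lemma orthonormal_extend:
  assumes "orthonormal u k" "x \<in> orth_compl u k" "norm x = 1"
  shows "orthonormal (u(k := x)) (Suc k)"
proof -
  have "cinner (u i) x = 0" "cinner x (u i) = 0" if "i < k" for i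
    using assms(2) that cinner_commute[of x "u i"] by (auto simp: orth_compl_def)
  moreover have "cinner x x = 1" using assms(3) by (simp add: cinner_self)
  ultimately show ?thesis using assms(1) by (auto simp: orthonormal_def less_Suc_eq)
qed

lemma normalize_in_subspace:
  assumes "cvec.subspace X" "v \<in> X" "v \<noteq> 0"
  shows "complex_of_real (1 / norm v) *\<^sub>C v \<in> X" "norm (complex_of_real (1 / norm v) *\<^sub>C v) = 1"
  using assms by (auto simp: norm_scaleC norm_divide intro: cvec.subspace_scale)

text \<open>
  The dimension count behind every comparison of eigenvalues below.
\<close>

lemma exists_orthogonal_combination:
  assumes on: "orthonormal u k" and "m < k"
  obtains c where "(\<Sum>p<k. c p *\<^sub>C u p) \<noteq> 0" "(\<Sum>p<k. c p *\<^sub>C u p) \<in> orth_compl w m"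
proof -
  obtain c where c: "\<exists>j<k. c j \<noteq> 0" "\<And>j. j < m \<Longrightarrow> (\<Sum>p<k. c p * cinner (w j) (u p)) = 0"
    using exists_combination_in_kernel[of "{..<k}" m "\<lambda>p j. cinner (w j) (u p)"] assms(2) by auto
  obtain j where "j < k" "c j \<noteq> 0" using c(1) by blast
  moreover from this(1) have "cinner (u j) (\<Sum>p<k. c p *\<^sub>C u p) = c j"
    by (rule cinner_combination[OF on])
  ultimately have "(\<Sum>p<k. c p *\<^sub>C u p) \<noteq> 0" by auto
  moreover have "(\<Sum>p<k. c p *\<^sub>C u p) \<in> orth_compl w m"
    using c(2) by (simp add: orth_compl_def cinner_sum_right cinner_scaleC_right)
  ultimately show ?thesis using that by blast
qed

lemma exists_unit_orthogonal:
  assumes e: "orthonormal e n" and "k < n"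
  obtains v where "v \<in> cvec.span (e ` {..<n})" "v \<in> orth_compl u k" "norm v = 1"
proof -
  obtain c where c: "(\<Sum>i<n. c i *\<^sub>C e i) \<noteq> 0" "(\<Sum>i<n. c i *\<^sub>C e i) \<in> orth_compl u k"
    using exists_orthogonal_combination[OF assms] by blast
  let ?V = "cvec.span (e ` {..<n}) \<inter> orth_compl u k"
  define x where "x = (\<Sum>i<n. c i *\<^sub>C e i)"
  have "x \<in> cvec.span (e ` {..<n})"
    unfolding x_def by (intro cvec.span_sum cvec.span_scale cvec.span_base) auto
  then have x: "x \<in> ?V" "x \<noteq> 0" using c by (auto simp: x_def)
  have V: "cvec.subspace ?V"
    by (intro cvec.subspace_inter cvec.subspace_span subspace_orth_compl)
  show ?thesis using that normalize_in_subspace[OF V x] by blast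
qed

text \<open>
  Eigenvectors for different eigenvalues are orthogonal, so the projection of an eigenvector onto
  a system of eigenvectors only sees members with the same eigenvalue.
\<close>

lemma eigenvector_residual:
  assumes sa: "self_adjoint T" and on: "orthonormal u k"
    and ev: "\<And>i. i < k \<Longrightarrow> T (u i) = complex_of_real (l i) *\<^sub>C u i"
    and v: "T v = complex_of_real s *\<^sub>C v"
  shows "\<And>i. i < k \<Longrightarrow> l i \<noteq> s \<Longrightarrow> cinner (u i) v = 0"
    and "T (v - proj u k v) = complex_of_real s *\<^sub>C (v - proj u k v)"
proof -
  show *: "cinner (u i) v = 0" if "i < k" "l i \<noteq> s" for i
  proof -
    have "cinner (T (u i)) v = cinner (u i) (T v)" by (rule self_adjoint_cinner[OF sa])
    then show ?thesis using ev[OF that(1)] v that(2) by (simp add: cinner_algebra)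
  qed
  have "T (proj u k v) = complex_of_real s *\<^sub>C proj u k v"
    unfolding proj_def bounded_clinear_simps[OF self_adjoint_bounded_clinear[OF sa]] cvec.scale_sum_right
  proof (intro sum.cong refl)
    fix i assume i: "i \<in> {..<k}"
    show "cinner (u i) v *\<^sub>C T (u i) = complex_of_real s *\<^sub>C cinner (u i) v *\<^sub>C u i"
      using ev[of i] *[of i] i by (cases "l i = s") (simp_all add: scaleC_scaleC mult.commute)
  qed
  then show "T (v - proj u k v) = complex_of_real s *\<^sub>C (v - proj u k v)"
    using v by (simp add: bounded_clinear_simps[OF self_adjoint_bounded_clinear[OF sa]]
        cvec.scale_right_diff_distrib)
qed

lemma orth_compl_invariant:
  assumes sa: "self_adjoint T"
    and ev: "\<And>i. i < k \<Longrightarrow> T (u i) = complex_of_real (l i) *\<^sub>C u i"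
    and v: "v \<in> orth_compl u k"
  shows "T v \<in> orth_compl u k"
proof -
  have "cinner (u i) (T v) = 0" if "i < k" for i
    using ev[OF that] v that self_adjoint_cinner[OF sa, of "u i" v]
    by (simp add: orth_compl_def cinner_scaleC_left)
  then show ?thesis by (simp add: orth_compl_def)
qed

lemma form_le_onorm:
  assumes "bounded_linear T"
  shows "\<bar>Re (cinner v (T v))\<bar> \<le> onorm T * (norm v)\<^sup>2"
proof -
  have "\<bar>Re (cinner v (T v))\<bar> \<le> cmod (cinner v (T v))" by (rule abs_Re_le_cmod)
  also have "\<dots> \<le> norm v * norm (T v)" by (rule norm_cinner_le)
  also have "\<dots> \<le> norm v * (onorm T * norm v)" by (intro mult_left_mono onorm assms) auto
  finally show ?thesis by (simp add: power2_eq_square mult_ac)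
qed

lemma form_scaleC:
  assumes "bounded_clinear T"
  shows "Re (cinner (a *\<^sub>C v) (T (a *\<^sub>C v))) = (cmod a)\<^sup>2 * Re (cinner v (T v))"
proof -
  have "cinner (a *\<^sub>C v) (T (a *\<^sub>C v)) = complex_of_real ((cmod a)\<^sup>2) * cinner v (T v)"
    using complex_norm_square[of a]
    by (simp add: bounded_clinear_simps[OF assms] cinner_algebra)
  then show ?thesis by simp
qed

lemma form_eigenvector:
  assumes "T x = complex_of_real l *\<^sub>C x" "norm x = 1"
  shows "Re (cinner x (T x)) = l"
  using assms by (simp add: cinner_scaleC_right cinner_self)

text \<open>
  Suppose that no eigenvector for \<open>M\<close> is orthogonal to \<open>u\<close>. Then the kernel of \<open>T - M\<close> lies in the
  span of \<open>u\<close>, and by the Fredholm gap \<open>T - M\<close> is bounded below by some \<open>c\<close> on the complement \<open>W\<close>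
  of \<open>u\<close>. On the other hand, the form \<open>Q\<close> of \<open>M - T\<close> is nonnegative on \<open>W\<close>, and its value at \<open>v\<close>
  therefore controls the norm of \<open>(M - T) v\<close>; choosing \<open>v\<close> with small \<open>Q v\<close> gives a contradiction.
\<close>

lemma form_maximum_attained:
  assumes sa: "self_adjoint T" and on: "orthonormal u k"
    and ev: "\<And>i. i < k \<Longrightarrow> T (u i) = complex_of_real (l i) *\<^sub>C u i"
    and upper: "\<And>v. v \<in> orth_compl u k \<Longrightarrow> Re (cinner v (T v)) \<le> M * (norm v)\<^sup>2"
    and approx: "\<And>d. d > 0 \<Longrightarrow> \<exists>v\<in>orth_compl u k. norm v = 1 \<and> M - d < Re (cinner v (T v))"
    and fr: "fredholm (\<lambda>v. T v - complex_of_real M *\<^sub>C v)"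
  obtains x where "x \<in> orth_compl u k" "norm x = 1" "T x = complex_of_real M *\<^sub>C x"
proof (rule ccontr)
  assume no: "\<not> thesis"
  let ?M = "complex_of_real M"
  let ?W = "orth_compl u k"
  have bc: "bounded_clinear T" using sa by (rule self_adjoint_bounded_clinear)
  have nox: "x = 0" if "x \<in> ?W" "T x = ?M *\<^sub>C x" for x
  proof (rule ccontr)
    assume "x \<noteq> 0"
    let ?x = "complex_of_real (1 / norm x) *\<^sub>C x"
    have "?x \<in> ?W" "norm ?x = 1"
      using normalize_in_subspace[OF subspace_orth_compl that(1) \<open>x \<noteq> 0\<close>] by auto
    moreover have "T ?x = ?M *\<^sub>C ?x"
      by (simp add: bounded_clinear_simps[OF bc] that(2) scaleC_scaleC mult.commute)
    ultimately show False using no \<open>\<And>x. x \<in> ?W \<Longrightarrow> norm x = 1 \<Longrightarrow> T x = ?M *\<^sub>C x \<Longrightarrow> thesis\<close> by blast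
  qed
  obtain c where c: "c > 0"
    "\<And>v. (\<And>y. T y = ?M *\<^sub>C y \<Longrightarrow> cinner y v = 0) \<Longrightarrow> c * norm v \<le> norm (T v - ?M *\<^sub>C v)"
    using fredholm_imp_bounded_below[OF sa fr] by blast
  have orth: "cinner y v = 0" if y: "T y = ?M *\<^sub>C y" and v: "v \<in> ?W" for y v
  proof -
    have "y - proj u k y = 0"
      using nox proj_compl[OF on] eigenvector_residual(2)[OF sa on ev y] by blast
    then have "cinner y v = cinner (proj u k y) v" by simp
    also have "\<dots> = 0"
      unfolding proj_def cinner_sum_left cinner_scaleC_left
      using v by (auto simp: orth_compl_def intro: sum.neutral)
    finally show ?thesis .
  qed
  \<comment> \<open>\<open>K\<close> bounds the norm of \<open>M - T\<close>, and the added \<open>1\<close> makes it positive.\<close>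
  define K where "K = \<bar>M\<bar> + onorm T + 1"
  have K: "K > 0" using onorm_pos_le[OF bounded_clinear_linear[OF bc]] by (simp add: K_def)
  obtain v where v: "v \<in> ?W" "norm v = 1" "M - c\<^sup>2 / K < Re (cinner v (T v))"
    using approx[of "c\<^sup>2 / K"] c(1) K by auto
  \<comment> \<open>Nonnegativity of \<open>Q\<close> at \<open>v - w / K\<close> yields the square of the norm of \<open>w\<close> as a lower bound for
    \<open>K * Q v\<close>.\<close>
  define w where "w = ?M *\<^sub>C v - T v"
  have wW: "w \<in> ?W"
    unfolding w_def using v(1) orth_compl_invariant[OF sa ev v(1)]
    by (intro cvec.subspace_diff[OF subspace_orth_compl] cvec.subspace_scale[OF subspace_orth_compl])
  define Q where "Q = (\<lambda>x. M * (norm x)\<^sup>2 - Re (cinner x (T x)))"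
  let ?t = "complex_of_real (1 / K)"
  have Tw: "Re (cinner v (T w)) = Re (cinner w (T v))"
    using self_adjoint_cinner[OF sa, of v w] cinner_commute[of w "T v"] by simp
  have ww: "M * Re (cinner w v) - Re (cinner w (T v)) = (norm w)\<^sup>2"
    unfolding Re_cinner_self[symmetric]
    by (subst (3) w_def) (simp add: cinner_diff_right cinner_scaleC_right)
  have "Q (v - ?t *\<^sub>C w) = Q v - 2 / K * (norm w)\<^sup>2 + (1 / K)\<^sup>2 * Q w"
  proof -
    have a1: "(norm (v - ?t *\<^sub>C w))\<^sup>2 = (norm v)\<^sup>2 - 2 / K * Re (cinner w v) + (1 / K)\<^sup>2 * (norm w)\<^sup>2"
      using cinner_commute[of w v] K
      by (simp add: norm_diff_square cinner_scaleC_right norm_scaleC power_mult_distrib norm_divide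
          power_divide)
    have a2: "Re (cinner (v - ?t *\<^sub>C w) (T (v - ?t *\<^sub>C w))) =
        Re (cinner v (T v)) - 2 / K * Re (cinner w (T v)) + (1 / K)\<^sup>2 * Re (cinner w (T w))"
      using Tw K by (simp add: bounded_clinear_simps[OF bc] cinner_algebra power2_eq_square
          diff_divide_distrib)
    show ?thesis
      unfolding Q_def a1 a2 ww[symmetric] by (simp add: algebra_simps)
  qed
  moreover have "Q (v - ?t *\<^sub>C w) \<ge> 0"
  proof -
    have "v - ?t *\<^sub>C w \<in> ?W"
      by (rule cvec.subspace_diff[OF subspace_orth_compl v(1)
            cvec.subspace_scale[OF subspace_orth_compl wW]])
    from upper[OF this] show ?thesis by (simp add: Q_def)
  qed
  moreover have "Q w \<le> K * (norm w)\<^sup>2"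
  proof -
    have "- Re (cinner w (T w)) \<le> onorm T * (norm w)\<^sup>2"
      using form_le_onorm[OF bounded_clinear_linear[OF bc], of w] by simp
    moreover have "M * (norm w)\<^sup>2 \<le> (\<bar>M\<bar> + 1) * (norm w)\<^sup>2" by (intro mult_right_mono) auto
    ultimately show ?thesis by (simp add: Q_def K_def algebra_simps)
  qed
  then have "(1 / K)\<^sup>2 * Q w \<le> 1 / K * (norm w)\<^sup>2"
    using K by (simp add: power2_eq_square field_simps)
  ultimately have "1 / K * (norm w)\<^sup>2 \<le> Q v" by (simp add: field_simps)
  moreover have "Q v < c\<^sup>2 / K" using v by (simp add: Q_def)
  ultimately have "(norm w)\<^sup>2 < c\<^sup>2" using K by (simp add: field_simps)
  moreover have "c \<le> norm w"
    using c(2)[of v] orth v by (auto simp: w_def norm_minus_commute)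
  then have "c\<^sup>2 \<le> (norm w)\<^sup>2" using c(1) by (intro power_mono) auto
  ultimately show False by simp
qed

text \<open>
  The first \<open>k\<close> stages of deflation inside the subspace \<open>V\<close>: each \<open>u i\<close> is an eigenvector whose
  eigenvalue \<open>l i\<close> is the maximum of the quadratic form on the unit vectors of \<open>V\<close> orthogonal to
  the earlier ones.
\<close>

definition top_system ::
    "'a::chilbert_space set \<Rightarrow> ('a \<Rightarrow> 'a) \<Rightarrow> nat \<Rightarrow> (nat \<Rightarrow> 'a) \<Rightarrow> (nat \<Rightarrow> real) \<Rightarrow> bool" where
  "top_system V T k u l \<longleftrightarrow> orthonormal u k \<and>
     (\<forall>i<k. u i \<in> V \<and> T (u i) = complex_of_real (l i) *\<^sub>C u i \<and>
        (\<forall>v\<in>V \<inter> orth_compl u i. Re (cinner v (T v)) \<le> l i * (norm v)\<^sup>2))"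

lemma top_systemD:
  assumes "top_system V T k u l"
  shows "orthonormal u k" "\<And>i. i < k \<Longrightarrow> u i \<in> V"
    "\<And>i. i < k \<Longrightarrow> T (u i) = complex_of_real (l i) *\<^sub>C u i"
    "\<And>i v. i < k \<Longrightarrow> v \<in> V \<Longrightarrow> v \<in> orth_compl u i \<Longrightarrow> Re (cinner v (T v)) \<le> l i * (norm v)\<^sup>2"
  using assms by (auto simp: top_system_def)

lemma top_system_0: "top_system V T 0 u l"
  by (simp add: top_system_def orthonormal_def)

lemma top_system_mono: "top_system V T k u l \<Longrightarrow> j \<le> k \<Longrightarrow> top_system V T j u l"
  by (auto simp: top_system_def intro: orthonormal_mono)

lemma top_system_decreasing:
  assumes ts: "top_system V T k u l" and "i \<le> j" "j < k"
  shows "l j \<le> l i"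
proof -
  have u: "norm (u j) = 1" "u j \<in> orth_compl u i"
    using top_systemD(1)[OF ts] assms by (auto intro: orthonormal_norm orthonormal_in_orth_compl)
  have "l j = Re (cinner (u j) (T (u j)))"
    using form_eigenvector[of T "u j" "l j"] top_systemD(3)[OF ts assms(3)] u(1) by simp
  also have "\<dots> \<le> l i * (norm (u j))\<^sup>2"
    using assms by (intro top_systemD(4)[OF ts] top_systemD(2)[OF ts] u) auto
  finally show ?thesis using u by simp
qed

lemma top_system_extend:
  assumes ts: "top_system V T k u l" and x: "x \<in> V \<inter> orth_compl u k" "norm x = 1"
    "T x = complex_of_real M *\<^sub>C x"
    and upper: "\<And>v. v \<in> V \<Longrightarrow> v \<in> orth_compl u k \<Longrightarrow> Re (cinner v (T v)) \<le> M * (norm v)\<^sup>2"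
  shows "top_system V T (Suc k) (u(k := x)) (l(k := M))"
  unfolding top_system_def
proof (intro conjI allI impI ballI)
  show "orthonormal (u(k := x)) (Suc k)"
    using ts x by (intro orthonormal_extend) (auto simp: top_system_def)
  fix i assume i: "i < Suc k"
  show "(u(k := x)) i \<in> V" using i x ts by (auto simp: top_system_def less_Suc_eq)
  show "T ((u(k := x)) i) = complex_of_real ((l(k := M)) i) *\<^sub>C (u(k := x)) i"
    using i x ts by (auto simp: top_system_def less_Suc_eq)
  fix v assume "v \<in> V \<inter> orth_compl (u(k := x)) i"
  then show "Re (cinner v (T v)) \<le> (l(k := M)) i * (norm v)\<^sup>2"
    using i upper ts orth_compl_upd[of i k u x] by (auto simp: top_system_def less_Suc_eq)
qed

text \<open>
  One step of deflation. The next value \<open>M\<close> is the supremum of the form over the unit sphere of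
  the complement, which has to exceed \<open>\<mu>\<close> as soon as the form is not bounded by \<open>\<mu>\<close>.
\<close>

lemma top_system_deflate:
  assumes sa: "self_adjoint T" and ts: "top_system UNIV T k u l"
    and ne: "\<exists>v\<in>orth_compl u k. norm v = 1"
    and fr: "\<And>M. M > \<mu> \<Longrightarrow> fredholm (\<lambda>v. T v - complex_of_real M *\<^sub>C v)"
    and big: "\<not> (\<forall>v\<in>orth_compl u k. Re (cinner v (T v)) \<le> \<mu> * (norm v)\<^sup>2)"
  obtains x M where "M > \<mu>" "top_system UNIV T (Suc k) (u(k := x)) (l(k := M))"
proof -
  let ?W = "orth_compl u k"
  have bc: "bounded_clinear T" using sa by (rule self_adjoint_bounded_clinear)
  define R where "R = (\<lambda>v. Re (cinner v (T v))) ` {v \<in> ?W. norm v = 1}"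
  define M where "M = Sup R"
  have bdd: "bdd_above R"
    unfolding R_def
  proof (rule bdd_aboveI2)
    fix v assume "v \<in> {v \<in> ?W. norm v = 1}"
    then show "Re (cinner v (T v)) \<le> onorm T"
      using form_le_onorm[OF bounded_clinear_linear[OF bc], of v] by simp
  qed
  have neR: "R \<noteq> {}" using ne by (auto simp: R_def)
  have upper: "Re (cinner v (T v)) \<le> M * (norm v)\<^sup>2" if "v \<in> ?W" for v
  proof (cases "v = 0")
    case False
    let ?a = "complex_of_real (1 / norm v)"
    have "Re (cinner (?a *\<^sub>C v) (T (?a *\<^sub>C v))) \<in> R"
      unfolding R_def using normalize_in_subspace[OF subspace_orth_compl that False]
      by (intro image_eqI[OF refl]) simp
    then have "Re (cinner (?a *\<^sub>C v) (T (?a *\<^sub>C v))) \<le> M"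
      unfolding M_def using bdd by (rule cSup_upper)
    then show ?thesis
      using False unfolding form_scaleC[OF bc]
      by (simp add: norm_divide power_divide divide_le_eq)
  qed simp
  have "M > \<mu>"
  proof -
    obtain v where v: "v \<in> ?W" "Re (cinner v (T v)) > \<mu> * (norm v)\<^sup>2" using big by auto
    then have "\<mu> * (norm v)\<^sup>2 < M * (norm v)\<^sup>2" using upper[of v] by simp
    then show ?thesis by (rule mult_right_less_imp_less) simp
  qed
  have approx: "\<exists>v\<in>?W. norm v = 1 \<and> M - d < Re (cinner v (T v))" if "d > 0" for d
  proof -
    have "\<exists>r\<in>R. M - d < r"
      using less_cSup_iff[OF neR bdd, of "M - d"] that by (simp add: M_def)
    then show ?thesis by (auto simp: R_def)
  qed
  obtain x where "x \<in> ?W" "norm x = 1" "T x = complex_of_real M *\<^sub>C x"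
    using form_maximum_attained[OF sa top_systemD(1)[OF ts] top_systemD(3)[OF ts] upper approx
        fr[OF \<open>M > \<mu>\<close>]] by blast
  then have "top_system UNIV T (Suc k) (u(k := x)) (l(k := M))"
    using upper by (intro top_system_extend[OF ts]) auto
  with \<open>M > \<mu>\<close> that show ?thesis by blast
qed

lemma top_system_combination_form:
  assumes ts: "top_system V T k u l" and T: "bounded_clinear T" and i: "i < k"
  shows "l i * (norm (\<Sum>p<Suc i. c p *\<^sub>C u p))\<^sup>2 \<le>
    Re (cinner (\<Sum>p<Suc i. c p *\<^sub>C u p) (T (\<Sum>p<Suc i. c p *\<^sub>C u p)))"
proof -
  have on: "orthonormal u (Suc i)" using top_systemD(1)[OF ts] i by (auto intro: orthonormal_mono)
  have "T (\<Sum>p<Suc i. c p *\<^sub>C u p) = (\<Sum>p<Suc i. (c p * complex_of_real (l p)) *\<^sub>C u p)"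
    unfolding bounded_clinear_simps[OF T]
    using top_systemD(3)[OF ts] i by (intro sum.cong) (auto simp: scaleC_scaleC)
  then have "cinner (\<Sum>p<Suc i. c p *\<^sub>C u p) (T (\<Sum>p<Suc i. c p *\<^sub>C u p)) =
      (\<Sum>p<Suc i. cnj (c p) * (c p * complex_of_real (l p)))"
    using cinner_combinations[OF on] by simp
  moreover have "cnj (c p) * (c p * complex_of_real (l p)) = complex_of_real (l p * (cmod (c p))\<^sup>2)" for p
    using complex_norm_square[of "c p"] by (simp add: mult_ac)
  ultimately have "Re (cinner (\<Sum>p<Suc i. c p *\<^sub>C u p) (T (\<Sum>p<Suc i. c p *\<^sub>C u p))) =
      (\<Sum>p<Suc i. l p * (cmod (c p))\<^sup>2)" by simp
  moreover have "l i * (norm (\<Sum>p<Suc i. c p *\<^sub>C u p))\<^sup>2 = (\<Sum>p<Suc i. l i * (cmod (c p))\<^sup>2)"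
    unfolding norm_combination[OF on] by (simp add: sum_distrib_left distrib_left)
  moreover have "(\<Sum>p<Suc i. l i * (cmod (c p))\<^sup>2) \<le> (\<Sum>p<Suc i. l p * (cmod (c p))\<^sup>2)"
    using i top_system_decreasing[OF ts] by (intro sum_mono mult_right_mono) auto
  ultimately show ?thesis by simp
qed

text \<open>
  The Courant-Fischer principle: some nonzero combination of \<open>u 0, \<dots>, u i\<close> is orthogonal to \<open>w 0,
  \<dots>, w (i - 1)\<close>, and on it the form is at least \<open>l i\<close> and at most \<open>M\<close>.
\<close>

lemma top_system_value_le:
  assumes ts: "top_system V T k u l" and V: "cvec.subspace V" and T: "bounded_clinear T"
    and i: "i < k"
    and upper: "\<And>v. v \<in> V \<Longrightarrow> v \<in> orth_compl w i \<Longrightarrow> Re (cinner v (T v)) \<le> M * (norm v)\<^sup>2"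
  shows "l i \<le> M"
proof -
  have on: "orthonormal u (Suc i)" using top_systemD(1)[OF ts] i by (auto intro: orthonormal_mono)
  obtain c where c: "(\<Sum>p<Suc i. c p *\<^sub>C u p) \<noteq> 0" "(\<Sum>p<Suc i. c p *\<^sub>C u p) \<in> orth_compl w i"
    using exists_orthogonal_combination[OF on] by blast
  define v where "v = (\<Sum>p<Suc i. c p *\<^sub>C u p)"
  have "v \<in> V"
    unfolding v_def using top_systemD(2)[OF ts] i
    by (intro cvec.subspace_sum[OF V] cvec.subspace_scale[OF V]) auto
  then have "l i * (norm v)\<^sup>2 \<le> M * (norm v)\<^sup>2"
    using top_system_combination_form[OF ts T i, of c] upper[of v] c(2)
    unfolding v_def[symmetric] by linarith
  then show ?thesis by (rule mult_right_le_imp_le) (use c(1) in \<open>simp add: v_def\<close>)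
qed

lemma top_system_value_unique:
  assumes ts: "top_system V T k u l" and ts': "top_system V T k' u' l'"
    and V: "cvec.subspace V" and T: "bounded_clinear T" and i: "i < k" "i < k'"
  shows "l i = l' i"
  using top_system_value_le[OF ts V T i(1), of u' "l' i"] top_systemD(4)[OF ts' i(2)]
    top_system_value_le[OF ts' V T i(2), of u "l i"] top_systemD(4)[OF ts i(1)]
  by (intro antisym) auto

section \<open>The top of the essential spectrum\<close>

text \<open>
  If \<open>T - r\<close> were Fredholm, the gap around \<open>r\<close> would leave no eigenvalue near \<open>r\<close> except \<open>r\<close>
  itself. So the values would equal \<open>r\<close> from some index on, and \<open>r\<close> would have infinite
  multiplicity.
\<close>

lemma limit_of_top_system_values:
  assumes sa: "self_adjoint T" and ts: "\<And>k. \<exists>u. top_system UNIV T k u L"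
  obtains r where "L \<longlonglongrightarrow> r" "complex_of_real r \<in> ess_spectrum T"
proof -
  have bc: "bounded_clinear T" using sa by (rule self_adjoint_bounded_clinear)
  have dec: "decseq L"
  proof (rule decseq_SucI)
    fix i
    obtain u where u: "top_system UNIV T (Suc (Suc i)) u L" using ts by blast
    then show "L (Suc i) \<le> L i" by (rule top_system_decreasing) auto
  qed
  have lower: "- onorm T \<le> L i" for i
  proof -
    obtain u where u: "top_system UNIV T (Suc i) u L" using ts by blast
    have "norm (u i) = 1" using orthonormal_norm[OF top_systemD(1)[OF u]] by simp
    moreover have "Re (cinner (u i) (T (u i))) = L i"
      using top_systemD(3)[OF u] calculation by (intro form_eigenvector) auto
    ultimately show ?thesis
      using form_le_onorm[OF bounded_clinear_linear[OF bc], of "u i"] by simp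
  qed
  obtain r where r: "L \<longlonglongrightarrow> r" using decseq_convergent[OF dec, of "- onorm T"] lower by blast
  have "complex_of_real r \<in> ess_spectrum T"
  proof (rule ccontr)
    let ?r = "complex_of_real r"
    assume "?r \<notin> ess_spectrum T"
    then have fr: "fredholm (\<lambda>v. T v - ?r *\<^sub>C v)" by (simp add: ess_spectrum_def)
    obtain c where c: "c > 0"
      "\<And>v. (\<And>y. T y = ?r *\<^sub>C y \<Longrightarrow> cinner y v = 0) \<Longrightarrow> c * norm v \<le> norm (T v - ?r *\<^sub>C v)"
      using fredholm_imp_bounded_below[OF sa fr] by blast
    obtain N where N: "\<And>i. i \<ge> N \<Longrightarrow> \<bar>L i - r\<bar> < c"
      using LIMSEQ_D[OF r c(1)] by auto
    have Lr: "L i = r" if "i \<ge> N" for i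
    proof (rule ccontr)
      assume ne: "L i \<noteq> r"
      obtain u where u: "top_system UNIV T (Suc i) u L" using ts by blast
      have nu: "norm (u i) = 1" using orthonormal_norm[OF top_systemD(1)[OF u]] by simp
      have Tu: "T (u i) = complex_of_real (L i) *\<^sub>C u i" using top_systemD(3)[OF u] by simp
      have "cinner y (u i) = 0" if y: "T y = ?r *\<^sub>C y" for y
      proof -
        have "cinner (T y) (u i) = cinner y (T (u i))" by (rule self_adjoint_cinner[OF sa])
        then show ?thesis using ne by (simp add: y Tu cinner_algebra)
      qed
      then have "c * norm (u i) \<le> norm (T (u i) - ?r *\<^sub>C u i)" by (rule c(2))
      also have "T (u i) - ?r *\<^sub>C u i = complex_of_real (L i - r) *\<^sub>C u i"
        by (simp add: Tu cvec.scale_left_diff_distrib)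
      also have "norm \<dots> = \<bar>L i - r\<bar>" by (simp only: norm_scaleC norm_of_real nu mult_1_right)
      finally show False using N[OF that] nu by simp
    qed
    obtain B where B: "finite B" "{v. T v - ?r *\<^sub>C v = 0} \<subseteq> cvec.span B"
      using fr by (auto simp: fredholm_def finite_cdim_def)
    obtain u where u: "top_system UNIV T (N + Suc (card B)) u L" using ts by blast
    have on: "orthonormal u (N + Suc (card B))" by (rule top_systemD(1)[OF u])
    let ?I = "{N..<N + Suc (card B)}"
    have "u ` ?I \<subseteq> {v. T v - ?r *\<^sub>C v = 0}"
      using top_systemD(3)[OF u] Lr by auto
    then have "u ` ?I \<subseteq> cvec.span B" using B(2) by blast
    moreover have "cvec.independent (u ` ?I)"
      by (rule cvec.independent_mono[OF orthonormal_independent[OF on]]) auto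
    ultimately have "card (u ` ?I) \<le> card B" using cvec.independent_span_bound[OF B(1)] by blast
    moreover have "card (u ` ?I) = card ?I"
      by (intro card_image inj_on_subset[OF orthonormal_inj[OF on]]) auto
    ultimately show False by simp
  qed
  with r that show ?thesis by blast
qed

section \<open>Truncations\<close>

lemma orth_compl_proj_0: "v \<in> orth_compl u k \<Longrightarrow> proj u k v = 0"
  by (simp add: orth_compl_def proj_def)

lemma proj_span_id:
  assumes e: "orthonormal e n" and v: "v \<in> cvec.span (e ` {..<n})"
  shows "proj e n v = v"
proof -
  have "cvec.span (e ` {..<n}) \<subseteq> {v. proj e n v = v}"
  proof (rule cvec.span_minimal)
    show "cvec.subspace {v. proj e n v = v}"
      by (auto simp: cvec.subspace_def bounded_clinear_simps[OF bounded_clinear_proj])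
    have "proj e n (e j) = e j" if "j < n" for j
    proof -
      have "proj e n (e j) = (\<Sum>i<n. if i = j then e j else 0)"
        unfolding proj_def using e that by (intro sum.cong) (auto simp: orthonormal_def)
      then show ?thesis using that by simp
    qed
    then show "e ` {..<n} \<subseteq> {v. proj e n v = v}" by auto
  qed
  with v show ?thesis by blast
qed

lemma cinner_proj_left: "cinner (proj e n v) w = cinner v (proj e n w)"
  unfolding proj_def cinner_sum_left cinner_sum_right cinner_scaleC_left cinner_scaleC_right
  by (intro sum.cong refl) (metis cinner_commute mult.commute)

lemma norm_proj_le:
  assumes "orthonormal e n"
  shows "norm (proj e n v) \<le> norm v"
proof -
  have "proj e n (v - proj e n v) = 0" using proj_compl[OF assms] by (rule orth_compl_proj_0)
  then have "cinner (proj e n v) (v - proj e n v) = 0" by (simp add: cinner_proj_left)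
  from norm_add_square_orthogonal[OF this] have "(norm (proj e n v))\<^sup>2 \<le> (norm v)\<^sup>2" by simp
  then show ?thesis by (rule power2_le_imp_le) simp
qed

lemma bounded_clinear_compose:
  "bounded_clinear S \<Longrightarrow> bounded_clinear T \<Longrightarrow> bounded_clinear (S \<circ> T)"
  unfolding bounded_clinear_def o_def by (auto intro: bounded_linear_compose)

lemma self_adjoint_truncation:
  assumes "self_adjoint T"
  shows "self_adjoint (truncation e n T)"
  unfolding self_adjoint_def truncation_def
  using assms bounded_clinear_proj[of e n]
  by (auto simp: cinner_proj_left self_adjoint_cinner intro!: bounded_clinear_compose
      dest: self_adjoint_bounded_clinear)

lemma form_truncation:
  assumes "orthonormal e n" "v \<in> cvec.span (e ` {..<n})"
  shows "cinner v (truncation e n T v) = cinner v (T v)"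
  using proj_span_id[OF assms] cinner_proj_left[of e n v "T v"] by (simp add: truncation_def)

text \<open>
  Diagonalisation of the truncation, by deflation in the whole space. Let \<open>S\<close> act as the
  truncation on \<open>V\<close> and as the constant \<open>-c\<close> on its orthogonal complement, where \<open>-c\<close> is smaller
  than every value of the form of \<open>T\<close> at a unit vector. The complement of \<open>V\<close> has finite
  codimension, so \<open>S - M\<close> is Fredholm for all \<open>M\<close> away from \<open>-c\<close>; and as long as fewer than \<open>n\<close>
  eigenvectors have been found, the remaining part of \<open>V\<close> keeps the supremum away from \<open>-c\<close>.
\<close>

lemma truncation_top_system:
  assumes e: "orthonormal e n" and sa: "self_adjoint T"
  obtains u l where "top_system (cvec.span (e ` {..<n})) (truncation e n T) n u l"
proof -
  let ?V = "cvec.span (e ` {..<n})"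
  let ?T = "truncation e n T"
  let ?P = "proj e n"
  define c where "c = onorm T + 1"
  \<comment> \<open>\<open>\<mu>\<close> separates the value \<open>-c\<close> on the complement of \<open>V\<close> from the values of the form on \<open>V\<close>,
    with a margin of \<open>1 / 2\<close> on both sides.\<close>
  define \<mu> where "\<mu> = - onorm T - 1 / 2"
  define S where "S v = ?T v - complex_of_real c *\<^sub>C (v - ?P v)" for v
  note bcT = self_adjoint_bounded_clinear[OF self_adjoint_truncation[OF sa, of e n]]
  note bcP = bounded_clinear_proj[of e n]
  have bl: "bounded_linear T"
    by (intro bounded_clinear_linear self_adjoint_bounded_clinear sa)
  have S: "self_adjoint S"
    unfolding self_adjoint_def bounded_clinear_def
  proof (intro conjI allI)
    show "bounded_linear S"
      unfolding S_def
      by (intro bounded_linear_sub bounded_linear_compose[OF bounded_linear_scaleC]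
          bounded_linear_ident bounded_clinear_linear bcT bcP)
    show "S (a *\<^sub>C v) = a *\<^sub>C S v" for a v
      by (simp add: S_def bounded_clinear_simps[OF bcT] bounded_clinear_simps[OF bcP]
          cvec.scale_right_diff_distrib scaleC_scaleC mult.commute)
    show "cinner (S u) v = cinner u (S v)" for u v
      by (simp add: S_def cinner_algebra cinner_proj_left
          self_adjoint_cinner[OF self_adjoint_truncation[OF sa]])
  qed
  have S_V: "S v = ?T v" if "v \<in> ?V" for v
    using proj_span_id[OF e that] by (simp add: S_def)
  have S_perp: "S v = - complex_of_real c *\<^sub>C v" if "v \<in> orth_compl e n" for v
    using orth_compl_proj_0[OF that] bounded_clinear_simps(4)[OF self_adjoint_bounded_clinear[OF sa]]
      bounded_clinear_simps(4)[OF bcP]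
    by (simp add: S_def truncation_def)
  have fr: "fredholm (\<lambda>v. S v - complex_of_real M *\<^sub>C v)" if "M > \<mu>" for M
  proof (rule fredholm_if_bounded_below[OF S e])
    show below: "1 / 2 * norm v \<le> norm (S v - complex_of_real M *\<^sub>C v)" if v: "v \<in> orth_compl e n" for v
    proof -
      have "S v - complex_of_real M *\<^sub>C v = - complex_of_real (c + M) *\<^sub>C v"
        by (simp add: S_perp[OF v] cvec.scale_left_diff_distrib)
      then have "norm (S v - complex_of_real M *\<^sub>C v) = \<bar>c + M\<bar> * norm v"
        by (simp only: norm_scaleC norm_minus_cancel norm_of_real)
      moreover have "1 / 2 * norm v \<le> \<bar>c + M\<bar> * norm v"
        using \<open>M > \<mu>\<close> by (intro mult_right_mono) (auto simp: c_def \<mu>_def)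
      ultimately show ?thesis by simp
    qed
    then show "1 / 2 * norm v \<le> norm (S v - cnj (complex_of_real M) *\<^sub>C v)"
      if "v \<in> orth_compl e n" for v using that by simp
  qed simp
  have "k \<le> n \<Longrightarrow> \<exists>u l. top_system UNIV S k u l \<and> (\<forall>i<k. l i > \<mu>)" for k
  proof (induction k)
    case 0
    then show ?case using top_system_0 by blast
  next
    case (Suc k)
    then obtain u l where ul: "top_system UNIV S k u l" "\<forall>i<k. l i > \<mu>" by auto
    obtain v where v: "v \<in> ?V" "v \<in> orth_compl u k" "norm v = 1"
      using exists_unit_orthogonal[OF e, of k] Suc.prems by auto
    have "Re (cinner v (S v)) = Re (cinner v (T v))"
      using v by (simp add: S_V form_truncation[OF e])
    then have "\<not> Re (cinner v (S v)) \<le> \<mu> * (norm v)\<^sup>2"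
      using form_le_onorm[OF bl, of v] v by (simp add: \<mu>_def)
    then obtain x M where xM: "M > \<mu>" "top_system UNIV S (Suc k) (u(k := x)) (l(k := M))"
      using top_system_deflate[OF S ul(1) _ fr, where \<mu>=\<mu>] v by blast
    moreover have "\<forall>i<Suc k. (l(k := M)) i > \<mu>" using xM(1) ul(2) by (auto simp: less_Suc_eq)
    ultimately show ?case by blast
  qed
  then obtain u l where ul: "top_system UNIV S n u l" "\<And>i. i < n \<Longrightarrow> l i > \<mu>" by blast
  have V: "u i \<in> ?V" if i: "i < n" for i
  proof -
    have "?P (?P w) = ?P w" for w using proj_span_id[OF e proj_in_span] by blast
    then have "S (u i) - ?P (S (u i)) = - complex_of_real c *\<^sub>C (u i - ?P (u i))"
      by (simp add: S_def truncation_def bounded_clinear_simps[OF bcP])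
    moreover have "S (u i) - ?P (S (u i)) = complex_of_real (l i) *\<^sub>C (u i - ?P (u i))"
      using top_systemD(3)[OF ul(1) i]
      by (simp add: bounded_clinear_simps[OF bcP] cvec.scale_right_diff_distrib)
    ultimately have "complex_of_real (l i) *\<^sub>C (u i - ?P (u i)) + complex_of_real c *\<^sub>C (u i - ?P (u i)) = 0"
      by simp
    then have "complex_of_real (l i + c) *\<^sub>C (u i - ?P (u i)) = 0"
      by (simp add: cvec.scale_left_distrib)
    moreover have "l i + c \<noteq> 0" using ul(2)[OF i] by (simp add: c_def \<mu>_def)
    then have "complex_of_real (l i + c) \<noteq> 0" by (simp only: of_real_eq_0_iff not_False_eq_True)
    ultimately have "u i = ?P (u i)" by (simp only: cvec.scale_eq_0_iff) simp
    then show ?thesis using proj_in_span[of e n "u i"] by simp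
  qed
  have "top_system ?V ?T n u l"
    using ul(1) V unfolding top_system_def by (auto simp flip: S_V)
  then show ?thesis using that by blast
qed

section \<open>Eigenvalues above the essential spectrum\<close>

lemma top_system_cong:
  assumes "top_system V T k u l" "\<And>i. i < k \<Longrightarrow> l i = l' i"
  shows "top_system V T k u l'"
  using assms by (simp add: top_system_def)

text \<open>
  Systems of different lengths share their values, by uniqueness, although not their vectors.
\<close>

lemma infinite_top_system:
  assumes sa: "self_adjoint T" and ex: "\<And>k. \<exists>u l. top_system UNIV T k u l"
  obtains L where "\<And>k. \<exists>u. top_system UNIV T k u L"
proof -
  obtain U l where ul: "\<And>k. top_system UNIV T k (U k) (l k)" using ex by metis
  have "top_system UNIV T k (U k) (\<lambda>i. l (Suc i) i)" for k
  proof (rule top_system_cong[OF ul])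
    show "l k i = l (Suc i) i" if "i < k" for i
      using that by (intro top_system_value_unique[OF ul ul] self_adjoint_bounded_clinear sa) auto
  qed
  then show ?thesis using that by blast
qed

text \<open>
  Otherwise deflation never stops, and its values converge to a point of the essential spectrum.
\<close>

lemma ess_spectrum_nonempty:
  fixes e :: "nat \<Rightarrow> 'a::chilbert_space" and T :: "'a \<Rightarrow> 'a"
  assumes e: "\<And>n. orthonormal e n" and sa: "self_adjoint T"
  shows "ess_spectrum T \<noteq> {}"
proof
  assume empty: "ess_spectrum T = {}"
  have bl: "bounded_linear T" by (intro bounded_clinear_linear self_adjoint_bounded_clinear sa)
  have fr: "fredholm (\<lambda>v. T v - complex_of_real M *\<^sub>C v)" for M
    using empty by (auto simp: ess_spectrum_def)
  have "\<exists>u l. top_system UNIV T k u l" for k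
  proof (induction k)
    case 0
    then show ?case using top_system_0 by blast
  next
    case (Suc k)
    then obtain u l where ul: "top_system UNIV T k u l" by blast
    obtain v where v: "v \<in> orth_compl u k" "norm v = 1"
      using exists_unit_orthogonal[OF e, of k "Suc k" u] by auto
    \<comment> \<open>Any threshold below all values of the form will do.\<close>
    have "\<not> Re (cinner v (T v)) \<le> (- onorm T - 1) * (norm v)\<^sup>2"
      using form_le_onorm[OF bl, of v] v by simp
    then show ?case
      using top_system_deflate[OF sa ul _ fr, where \<mu> = "- onorm T - 1"] v by metis
  qed
  then obtain L where "\<And>k. \<exists>u. top_system UNIV T k u L" using infinite_top_system[OF sa] by blast
  then show False using limit_of_top_system_values[OF sa] empty by blast
qed

lemma ess_spectrum_Re_bdd:
  assumes "self_adjoint T"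
  shows "bdd_above (Re ` ess_spectrum T)"
proof (rule bdd_aboveI2)
  show "Re z \<le> onorm T" if "z \<in> ess_spectrum T" for z
    using ess_spectrum_norm_le[OF assms that] complex_Re_le_cmod[of z] by simp
qed

lemma ess_upper_upper:
  assumes "self_adjoint T" "complex_of_real r \<in> ess_spectrum T"
  shows "r \<le> ess_upper T"
  unfolding ess_upper_def
  using cSup_upper[OF imageI[OF assms(2), of Re] ess_spectrum_Re_bdd[OF assms(1)]] by simp

lemma ess_upper_le_form_bound:
  fixes e :: "nat \<Rightarrow> 'a::chilbert_space" and T :: "'a \<Rightarrow> 'a"
  assumes e: "\<And>n. orthonormal e n" and sa: "self_adjoint T" and on: "orthonormal u k"
    and upper: "\<And>v. v \<in> orth_compl u k \<Longrightarrow> Re (cinner v (T v)) \<le> M * (norm v)\<^sup>2"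
  shows "ess_upper T \<le> M"
  unfolding ess_upper_def
  using ess_spectrum_nonempty[OF e sa] ess_spectrum_le_form_bound[OF sa on upper]
  by (intro cSup_least) auto

lemma top_system_above_extend:
  fixes e :: "nat \<Rightarrow> 'a::chilbert_space" and T :: "'a \<Rightarrow> 'a"
  assumes e: "\<And>n. orthonormal e n" and sa: "self_adjoint T"
    and ul: "top_system UNIV T k u l" "\<forall>i<k. l i > ess_upper T"
    and big: "\<not> (\<forall>v\<in>orth_compl u k. Re (cinner v (T v)) \<le> ess_upper T * (norm v)\<^sup>2)"
  shows "\<exists>u l. top_system UNIV T (Suc k) u l \<and> (\<forall>i<Suc k. l i > ess_upper T)"
proof -
  have fr: "fredholm (\<lambda>v. T v - complex_of_real M *\<^sub>C v)" if "M > ess_upper T" for M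
    using ess_upper_upper[OF sa, of M] that by (auto simp: ess_spectrum_def)
  obtain v where v: "v \<in> orth_compl u k" "norm v = 1"
    using exists_unit_orthogonal[OF e, of k "Suc k" u] by auto
  obtain x M where xM: "M > ess_upper T" "top_system UNIV T (Suc k) (u(k := x)) (l(k := M))"
    using top_system_deflate[OF sa ul(1) _ fr big] v by blast
  moreover have "\<forall>i<Suc k. (l(k := M)) i > ess_upper T"
    using xM(1) ul(2) by (auto simp: less_Suc_eq)
  ultimately show ?thesis by blast
qed

section \<open>Counting eigenvalues with multiplicity\<close>

text \<open>
  The property that the definite description in \<^const>\<open>kth_largest\<close> refers to. It is kept as a
  predicate because the description can be unfolded and reflected only where such an entry exists.
\<close>

definition kth_largest_entry :: "real set \<Rightarrow> (real \<Rightarrow> nat) \<Rightarrow> nat \<Rightarrow> real \<Rightarrow> bool" where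
  "kth_largest_entry S m k t \<longleftrightarrow> t \<in> S \<and> finite {s \<in> S. s \<ge> t} \<and>
     (\<Sum>s \<in> {s \<in> S. s > t}. m s) < k \<and> k \<le> (\<Sum>s \<in> {s \<in> S. s \<ge> t}. m s)"

lemma kth_largest_eqI:
  assumes "kth_largest_entry S m k t"
  shows "kth_largest S m k = t"
proof -
  have no: "\<not> t1 < t2" if "kth_largest_entry S m k t1" "kth_largest_entry S m k t2" for t1 t2
  proof
    assume "t1 < t2"
    have "(\<Sum>s \<in> {s \<in> S. s \<ge> t2}. m s) \<le> (\<Sum>s \<in> {s \<in> S. s > t1}. m s)"
    proof (rule sum_mono2)
      have "finite {s \<in> S. s \<ge> t1}" using that(1) by (simp add: kth_largest_entry_def)
      then show "finite {s \<in> S. s > t1}" by (rule finite_subset[rotated]) auto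
    qed (use \<open>t1 < t2\<close> in auto)
    then show False using that by (simp add: kth_largest_entry_def)
  qed
  have "kth_largest S m k = (THE t. kth_largest_entry S m k t)"
    by (simp add: kth_largest_def kth_largest_entry_def)
  also have "\<dots> = t"
    using assms no by (intro the_equality) (auto simp: not_less intro: antisym)
  finally show ?thesis .
qed

text \<open>
  The last premise says that the system has exhausted the eigenvalue \<open>s\<close>: no eigenvector for \<open>s\<close>
  is orthogonal to it. The residual of any eigenvector after projection onto the system must then
  vanish.
\<close>

lemma eigenspace_top_system:
  assumes ts: "top_system V T k u l" and sa: "self_adjoint T" and V: "cvec.subspace V"
    and exh: "\<And>v. v \<in> V \<Longrightarrow> v \<in> orth_compl u k \<Longrightarrow> T v = complex_of_real s *\<^sub>C v \<Longrightarrow> v = 0"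
  shows "eigenspace_on V T s = cvec.span (u ` {i. i < k \<and> l i = s})"
proof
  note on = top_systemD(1)[OF ts]
  note ev = top_systemD(3)[OF ts]
  note bc = self_adjoint_bounded_clinear[OF sa]
  show "eigenspace_on V T s \<subseteq> cvec.span (u ` {i. i < k \<and> l i = s})"
  proof
    fix v assume "v \<in> eigenspace_on V T s"
    then have v: "v \<in> V" "T v = complex_of_real s *\<^sub>C v" by (auto simp: eigenspace_on_def)
    have pV: "proj u k v \<in> V"
      unfolding proj_def using top_systemD(2)[OF ts]
      by (intro cvec.subspace_sum[OF V] cvec.subspace_scale[OF V]) auto
    have "v - proj u k v = 0"
      using eigenvector_residual(2)[OF sa on ev v(2)] proj_compl[OF on]
        cvec.subspace_diff[OF V v(1) pV] by (intro exh) auto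
    then have "v = (\<Sum>i<k. cinner (u i) v *\<^sub>C u i)" by (simp add: proj_def)
    also have "\<dots> \<in> cvec.span (u ` {i. i < k \<and> l i = s})"
    proof (rule cvec.span_sum)
      fix i assume i: "i \<in> {..<k}"
      show "cinner (u i) v *\<^sub>C u i \<in> cvec.span (u ` {i. i < k \<and> l i = s})"
      proof (cases "l i = s")
        case True
        then show ?thesis using i by (intro cvec.span_scale cvec.span_base) auto
      next
        case False
        then show ?thesis
          using eigenvector_residual(1)[OF sa on ev v(2)] i by (simp add: cvec.span_zero)
      qed
    qed
    finally show "v \<in> cvec.span (u ` {i. i < k \<and> l i = s})" .
  qed
  have "cvec.subspace (eigenspace_on V T s)"
    using V by (auto simp: cvec.subspace_def eigenspace_on_def bounded_clinear_simps[OF bc]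
        cvec.scale_right_distrib scaleC_scaleC mult.commute)
  then show "cvec.span (u ` {i. i < k \<and> l i = s}) \<subseteq> eigenspace_on V T s"
    using top_systemD(2)[OF ts] ev by (intro cvec.span_minimal) (auto simp: eigenspace_on_def)
qed

lemma multiplicity_top_system:
  assumes ts: "top_system V T k u l" and sa: "self_adjoint T" and V: "cvec.subspace V"
    and exh: "\<And>v. v \<in> V \<Longrightarrow> v \<in> orth_compl u k \<Longrightarrow> T v = complex_of_real s *\<^sub>C v \<Longrightarrow> v = 0"
  shows "multiplicity_on V T s = card {i. i < k \<and> l i = s}"
proof -
  let ?I = "{i. i < k \<and> l i = s}"
  have eq: "eigenspace_on V T s = cvec.span (u ` ?I)"
    by (rule eigenspace_top_system[OF ts sa V exh])
  have "multiplicity_on V T s = card (u ` ?I)"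
    unfolding multiplicity_on_def eq
    by (intro cvec.dim_span_eq_card_independent
        cvec.independent_mono[OF orthonormal_independent[OF top_systemD(1)[OF ts]]]) auto
  also have "\<dots> = card ?I"
    by (intro card_image inj_on_subset[OF orthonormal_inj[OF top_systemD(1)[OF ts]]]) auto
  finally show ?thesis .
qed

text \<open>
  The dimension of an infinite-dimensional space is \<open>0\<close> by convention, so finiteness of the
  eigenspace matters.
\<close>

lemma multiplicity_ge_top_system:
  assumes ts: "top_system V T k u l" and fin: "finite_cdim (eigenspace_on V T s)"
  shows "card {i. i < k \<and> l i = s} \<le> multiplicity_on V T s"
proof -
  let ?I = "{i. i < k \<and> l i = s}"
  obtain B where B: "B \<subseteq> eigenspace_on V T s" "cvec.independent B"
    "eigenspace_on V T s \<subseteq> cvec.span B" "card B = multiplicity_on V T s"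
    unfolding multiplicity_on_def using cvec.basis_exists by blast
  obtain C where C: "finite C" "eigenspace_on V T s \<subseteq> cvec.span C"
    using fin by (auto simp: finite_cdim_def)
  have "finite B" using cvec.independent_span_bound[OF C(1) B(2)] B(1) C(2) by blast
  moreover have "cvec.independent (u ` ?I)"
    by (rule cvec.independent_mono[OF orthonormal_independent[OF top_systemD(1)[OF ts]]]) auto
  moreover have "u ` ?I \<subseteq> cvec.span B"
    using B(3) top_systemD(2,3)[OF ts] by (auto simp: eigenspace_on_def)
  ultimately have "card (u ` ?I) \<le> card B" using cvec.independent_span_bound by blast
  moreover have "card (u ` ?I) = card ?I"
    by (intro card_image inj_on_subset[OF orthonormal_inj[OF top_systemD(1)[OF ts]]]) auto
  ultimately show ?thesis using B(4) by simp
qed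

lemma sum_card_fibres:
  assumes "finite S"
  shows "(\<Sum>s\<in>S. card {i. i < k \<and> l i = s}) = card {i::nat. i < k \<and> l i \<in> S}"
proof -
  have "card (\<Union>s\<in>S. {i. i < k \<and> l i = s}) = (\<Sum>s\<in>S. card {i. i < k \<and> l i = s})"
    by (intro card_UN_disjoint) (use assms in auto)
  moreover have "(\<Union>s\<in>S. {i. i < k \<and> l i = s}) = {i. i < k \<and> l i \<in> S}" by auto
  ultimately show ?thesis by simp
qed

lemma eigenvalue_in_top_system:
  assumes ts: "top_system V T k u l" and sa: "self_adjoint T" and V: "cvec.subspace V"
    and exh: "\<And>v. v \<in> V \<Longrightarrow> v \<in> orth_compl u k \<Longrightarrow> T v = complex_of_real s *\<^sub>C v \<Longrightarrow> v = 0"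
    and s: "s \<in> eigenvalues_on V T"
  shows "s \<in> l ` {..<k}"
proof (rule ccontr)
  assume "s \<notin> l ` {..<k}"
  then have empty: "{i. i < k \<and> l i = s} = {}" by auto
  have "eigenspace_on V T s = cvec.span (u ` {i. i < k \<and> l i = s})"
    by (rule eigenspace_top_system[OF ts sa V exh])
  then have "eigenspace_on V T s = {0}" unfolding empty by simp
  then show False using s by (auto simp: eigenvalues_on_def)
qed

lemma top_system_exhausts_above:
  assumes "\<And>v. v \<in> V \<Longrightarrow> v \<in> orth_compl u k \<Longrightarrow> Re (cinner v (T v)) \<le> M * (norm v)\<^sup>2"
    and "M < s" "v \<in> V" "v \<in> orth_compl u k" "T v = complex_of_real s *\<^sub>C v"
  shows "v = 0"
proof (rule ccontr)
  assume "v \<noteq> 0"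
  then have "M * (norm v)\<^sup>2 < s * (norm v)\<^sup>2" using assms(2) by simp
  moreover have "Re (cinner v (T v)) = s * (norm v)\<^sup>2"
    using assms(5) by (simp add: cinner_scaleC_right cinner_self)
  ultimately show False using assms(1)[OF assms(3,4)] by simp
qed

text \<open>
  The system \<open>u 0, \<dots>, u i\<close> has exhausted every eigenvalue above \<open>l i\<close>, so these are counted
  exactly, and at most \<open>i\<close> of its members belong to them. Further copies of \<open>l i\<close> itself may come
  later, so for them only a lower bound on the multiplicity is available, which is all that is
  asked for.
\<close>

lemma top_system_kth_largest_entry:
  assumes ts: "top_system V T k u l" and sa: "self_adjoint T" and V: "cvec.subspace V"
    and S: "S \<subseteq> eigenvalues_on V T" and l: "\<And>j. j < k \<Longrightarrow> l j \<in> S" and i: "i < k"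
    and fin: "finite_cdim (eigenspace_on V T (l i))"
  shows "kth_largest_entry S (multiplicity_on V T) (Suc i) (l i)"
proof -
  let ?m = "multiplicity_on V T"
  have ts': "top_system V T (Suc i) u l" using ts i by (intro top_system_mono[OF ts]) auto
  have exh: "v = 0" if "s > l i" "v \<in> V" "v \<in> orth_compl u (Suc i)" "T v = complex_of_real s *\<^sub>C v" for s v
    using top_system_exhausts_above[of V u "Suc i" T "l i" s v] that
      top_systemD(4)[OF ts i] orth_compl_antimono[of i "Suc i" u] by auto
  have above: "{s \<in> S. s > l i} \<subseteq> l ` {..<Suc i}"
  proof
    fix s assume s: "s \<in> {s \<in> S. s > l i}"
    show "s \<in> l ` {..<Suc i}"
      by (rule eigenvalue_in_top_system[OF ts' sa V exh[of s]]) (use s S in auto)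
  qed
  have eq: "{s \<in> S. s \<ge> l i} = l ` {..<Suc i}"
  proof
    show "{s \<in> S. s \<ge> l i} \<subseteq> l ` {..<Suc i}" using above by (auto simp: le_less)
    show "l ` {..<Suc i} \<subseteq> {s \<in> S. s \<ge> l i}"
      using l i top_system_decreasing[OF ts _ i] by auto
  qed
  have finA: "finite {s \<in> S. s > l i}" using above by (rule finite_subset) simp
  have m: "?m s = card {j. j < Suc i \<and> l j = s}" if "s > l i" for s
    using that by (intro multiplicity_top_system[OF ts' sa V] exh)
  have "(\<Sum>s \<in> {s \<in> S. s > l i}. ?m s) = (\<Sum>s \<in> {s \<in> S. s > l i}. card {j. j < Suc i \<and> l j = s})"
    using m by (intro sum.cong) auto
  also have "\<dots> = card {j. j < Suc i \<and> l j \<in> {s \<in> S. s > l i}}" by (rule sum_card_fibres[OF finA])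
  also have "\<dots> \<le> card {..<i}" by (intro card_mono) (auto simp: less_Suc_eq)
  finally have 1: "(\<Sum>s \<in> {s \<in> S. s > l i}. ?m s) < Suc i" by simp
  have "Suc i = card {j. j < Suc i \<and> l j \<in> {s \<in> S. s \<ge> l i}}"
  proof -
    have "{j. j < Suc i \<and> l j \<in> {s \<in> S. s \<ge> l i}} = {..<Suc i}" unfolding eq by auto
    then show ?thesis by simp
  qed
  also have "\<dots> = (\<Sum>s \<in> {s \<in> S. s \<ge> l i}. card {j. j < Suc i \<and> l j = s})"
    unfolding eq by (rule sum_card_fibres[symmetric]) simp
  also have "\<dots> \<le> (\<Sum>s \<in> {s \<in> S. s \<ge> l i}. ?m s)"
  proof (rule sum_mono)
    fix s assume "s \<in> {s \<in> S. s \<ge> l i}"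
    then consider "s = l i" | "s > l i" by fastforce
    then show "card {j. j < Suc i \<and> l j = s} \<le> ?m s"
      using multiplicity_ge_top_system[OF ts'] fin m by cases auto
  qed
  finally have 2: "Suc i \<le> (\<Sum>s \<in> {s \<in> S. s \<ge> l i}. ?m s)" .
  show ?thesis
    unfolding kth_largest_entry_def using 1 2 l[OF i] eq by simp
qed

lemma top_system_exhaustive_count:
  assumes ts: "top_system V T k u l" and sa: "self_adjoint T" and V: "cvec.subspace V"
    and S: "S \<subseteq> eigenvalues_on V T" and l: "\<And>j. j < k \<Longrightarrow> l j \<in> S"
    and exh: "\<And>s v. s \<in> S \<Longrightarrow> v \<in> V \<Longrightarrow> v \<in> orth_compl u k \<Longrightarrow> T v = complex_of_real s *\<^sub>C v \<Longrightarrow> v = 0"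
  shows "finite S" "(\<Sum>s\<in>S. multiplicity_on V T s) = k"
proof -
  have S_eq: "S = l ` {..<k}"
  proof
    show "S \<subseteq> l ` {..<k}"
    proof
      fix s assume s: "s \<in> S"
      show "s \<in> l ` {..<k}"
        by (rule eigenvalue_in_top_system[OF ts sa V exh[OF s]]) (use s S in auto)
    qed
  qed (use l in auto)
  then show fin: "finite S" by simp
  have "(\<Sum>s\<in>S. multiplicity_on V T s) = (\<Sum>s\<in>S. card {i. i < k \<and> l i = s})"
    by (intro sum.cong refl multiplicity_top_system[OF ts sa V] exh)
  also have "\<dots> = card {i. i < k \<and> l i \<in> S}" by (rule sum_card_fibres[OF fin])
  also have "{i. i < k \<and> l i \<in> S} = {..<k}" using l by auto
  finally show "(\<Sum>s\<in>S. multiplicity_on V T s) = k" by simp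
qed

section \<open>Eigenvalues of truncations\<close>

lemma orthonormal_basis_orthonormal: "orthonormal_basis e \<Longrightarrow> orthonormal e n"
  by (simp add: orthonormal_basis_def orthonormal_def)

text \<open>
  Vectors in the span of the basis are eventually fixed by the projections, which are
  contractions.
\<close>

lemma tendsto_proj:
  assumes e: "orthonormal_basis e"
  shows "(\<lambda>n. proj e n v) \<longlonglongrightarrow> v"
proof (rule LIMSEQ_I)
  fix r :: real assume r: "r > 0"
  note on = orthonormal_basis_orthonormal[OF e]
  have "v \<in> closure (cvec.span (range e))" using e by (simp add: orthonormal_basis_def)
  then obtain x where x: "x \<in> cvec.span (range e)" "dist x v < r / 2"
    using r by (metis closure_approachable half_gt_zero)
  have "cvec.span (range e) \<subseteq> {x. \<exists>N. \<forall>n\<ge>N. proj e n x = x}"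
  proof (rule cvec.span_minimal)
    show "range e \<subseteq> {x. \<exists>N. \<forall>n\<ge>N. proj e n x = x}"
    proof clarify
      fix i
      have "proj e n (e i) = e i" if "n \<ge> Suc i" for n
        using that by (intro proj_span_id[OF on] cvec.span_base) auto
      then show "\<exists>N. \<forall>n\<ge>N. proj e n (e i) = e i" by blast
    qed
    show "cvec.subspace {x. \<exists>N. \<forall>n\<ge>N. proj e n x = x}"
      unfolding cvec.subspace_def mem_Collect_eq
    proof (intro conjI ballI allI)
      show "\<exists>N. \<forall>n\<ge>N. proj e n 0 = 0" by (simp add: bounded_clinear_simps[OF bounded_clinear_proj])
      fix x assume "x \<in> {x. \<exists>N. \<forall>n\<ge>N. proj e n x = x}"
      then obtain N where N: "\<And>n. n \<ge> N \<Longrightarrow> proj e n x = x" by blast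
      show "\<exists>N. \<forall>n\<ge>N. proj e n (c *\<^sub>C x) = c *\<^sub>C x" for c
        using N by (intro exI[of _ N]) (simp add: bounded_clinear_simps[OF bounded_clinear_proj])
      fix y assume "y \<in> {x. \<exists>N. \<forall>n\<ge>N. proj e n x = x}"
      then obtain N' where N': "\<And>n. n \<ge> N' \<Longrightarrow> proj e n y = y" by blast
      show "\<exists>N. \<forall>n\<ge>N. proj e n (x + y) = x + y"
        using N N' by (intro exI[of _ "max N N'"])
          (simp add: bounded_clinear_simps[OF bounded_clinear_proj])
    qed
  qed
  then obtain N where N: "\<And>n. n \<ge> N \<Longrightarrow> proj e n x = x" using x(1) by blast
  have "norm (proj e n v - v) < r" if "n \<ge> N" for n
  proof -
    have "proj e n v - v = proj e n (v - x) + (x - v)"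
      using N[OF that] by (simp add: bounded_clinear_simps[OF bounded_clinear_proj])
    then have "norm (proj e n v - v) \<le> norm (proj e n (v - x)) + norm (x - v)"
      by (metis norm_triangle_ineq)
    also have "\<dots> \<le> norm (v - x) + norm (x - v)"
      using norm_proj_le[OF on] by simp
    also have "\<dots> < r" using x(2) by (simp add: dist_norm norm_minus_commute)
    finally show ?thesis .
  qed
  then show "\<exists>N. \<forall>n\<ge>N. norm (proj e n v - v) < r" by blast
qed

lemma top_system_eigenvalue: "top_system V T k u l \<Longrightarrow> i < k \<Longrightarrow> l i \<in> eigenvalues_on V T"
  using top_systemD(2,3)[of V T k u l i] orthonormal_norm[OF top_systemD(1), of V T k u l i]
  by (auto simp: eigenvalues_on_def eigenspace_on_def intro!: bexI[of _ "u i"])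

lemma lambda_trunc_entry:
  assumes sa: "self_adjoint T" and e: "orthonormal e n"
    and ts: "top_system (cvec.span (e ` {..<n})) (truncation e n T) n u l" and i: "i < n"
  shows "kth_largest_entry (eigenvalues_on (cvec.span (e ` {..<n})) (truncation e n T))
    (multiplicity_on (cvec.span (e ` {..<n})) (truncation e n T)) (Suc i) (l i)"
proof (rule top_system_kth_largest_entry[OF ts self_adjoint_truncation[OF sa] cvec.subspace_span _ _ i])
  show "finite_cdim (eigenspace_on (cvec.span (e ` {..<n})) (truncation e n T) (l i))"
    unfolding finite_cdim_def
    by (intro exI[of _ "e ` {..<n}"]) (auto simp: eigenspace_on_def)
qed (use top_system_eigenvalue[OF ts] in auto)

lemma lambda_trunc_top_system:
  assumes "self_adjoint T" "orthonormal e n"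
    "top_system (cvec.span (e ` {..<n})) (truncation e n T) n u l" "i < n"
  shows "lambda_trunc e T (Suc i) n = l i"
  unfolding lambda_trunc_def Let_def using assms by (intro kth_largest_eqI lambda_trunc_entry)

text \<open>
  A vector of \<open>V\<close> orthogonal to \<open>n\<close> orthonormal eigenvectors in \<open>V\<close> would give \<open>n + 1\<close> orthonormal
  vectors in an \<open>n\<close>-dimensional space, so the eigenvectors exhaust the truncation.
\<close>

lemma sum_multiplicity_truncation:
  assumes sa: "self_adjoint T" and e: "orthonormal e n"
    and ts: "top_system (cvec.span (e ` {..<n})) (truncation e n T) n u l"
  defines "S \<equiv> eigenvalues_on (cvec.span (e ` {..<n})) (truncation e n T)"
  shows "finite S" "(\<Sum>s\<in>S. multiplicity_on (cvec.span (e ` {..<n})) (truncation e n T) s) = n"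
proof -
  let ?V = "cvec.span (e ` {..<n})"
  have triv: "v = 0" if v: "v \<in> ?V" "v \<in> orth_compl u n" for v
  proof (rule ccontr)
    assume "v \<noteq> 0"
    define x where "x = complex_of_real (1 / norm v) *\<^sub>C v"
    have x: "x \<in> ?V \<inter> orth_compl u n" "norm x = 1"
      using normalize_in_subspace[of "?V \<inter> orth_compl u n" v] v \<open>v \<noteq> 0\<close>
        cvec.subspace_inter[OF cvec.subspace_span subspace_orth_compl] by (auto simp: x_def)
    let ?w = "u(n := x)"
    have on: "orthonormal ?w (Suc n)"
      using top_systemD(1)[OF ts] x by (intro orthonormal_extend) auto
    obtain c where c: "(\<Sum>p<Suc n. c p *\<^sub>C ?w p) \<noteq> 0" "(\<Sum>p<Suc n. c p *\<^sub>C ?w p) \<in> orth_compl e n"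
      using exists_orthogonal_combination[OF on] by blast
    have "(\<Sum>p<Suc n. c p *\<^sub>C ?w p) \<in> ?V"
      using top_systemD(2)[OF ts] x
      by (intro cvec.span_sum cvec.span_scale) (auto simp: less_Suc_eq)
    from proj_span_id[OF e this] orth_compl_proj_0[OF c(2)] c(1) show False by simp
  qed
  show "finite S" "(\<Sum>s\<in>S. multiplicity_on ?V (truncation e n T) s) = n"
    unfolding S_def
    by (intro top_system_exhaustive_count[OF ts self_adjoint_truncation[OF sa] cvec.subspace_span
        order_refl] top_system_eigenvalue[OF ts] triv; assumption)+
qed

lemma lambda_trunc_le_form_bound:
  assumes sa: "self_adjoint T" and e: "orthonormal e n" and i: "i < n"
    and upper: "\<And>v. v \<in> orth_compl w i \<Longrightarrow> Re (cinner v (T v)) \<le> M * (norm v)\<^sup>2"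
  shows "lambda_trunc e T (Suc i) n \<le> M"
proof -
  obtain u l where ts: "top_system (cvec.span (e ` {..<n})) (truncation e n T) n u l"
    using truncation_top_system[OF e sa] by blast
  have "l i \<le> M"
    by (rule top_system_value_le[OF ts cvec.subspace_span
          self_adjoint_bounded_clinear[OF self_adjoint_truncation[OF sa]] i, of w])
      (simp add: form_truncation[OF e] upper)
  then show ?thesis using lambda_trunc_top_system[OF sa e ts i] by simp
qed

text \<open>
  The forms of \<open>S\<close> and \<open>T\<close> differ by at most the norm of \<open>S - T\<close>, and Courant-Fischer carries this
  over to the eigenvalues.
\<close>

lemma lambda_trunc_lipschitz:
  assumes sa: "self_adjoint S" "self_adjoint T" and e: "orthonormal e n" and i: "i < n"
  shows "lambda_trunc e S (Suc i) n \<le> lambda_trunc e T (Suc i) n + onorm (\<lambda>v. S v - T v)"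
proof -
  let ?V = "cvec.span (e ` {..<n})"
  have bl: "bounded_linear (\<lambda>v. S v - T v)"
    using sa by (intro bounded_linear_sub bounded_clinear_linear self_adjoint_bounded_clinear)
  obtain u l where S: "top_system ?V (truncation e n S) n u l"
    using truncation_top_system[OF e sa(1)] by blast
  obtain u' l' where T: "top_system ?V (truncation e n T) n u' l'"
    using truncation_top_system[OF e sa(2)] by blast
  have "l i \<le> l' i + onorm (\<lambda>v. S v - T v)"
  proof (rule top_system_value_le[OF S cvec.subspace_span
        self_adjoint_bounded_clinear[OF self_adjoint_truncation[OF sa(1)]] i, of u'])
    fix v assume v: "v \<in> ?V" "v \<in> orth_compl u' i"
    have "Re (cinner v (T v)) \<le> l' i * (norm v)\<^sup>2"
      using top_systemD(4)[OF T i v] by (simp add: form_truncation[OF e v(1)])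
    moreover have "Re (cinner v (S v)) - Re (cinner v (T v)) \<le> onorm (\<lambda>v. S v - T v) * (norm v)\<^sup>2"
      using form_le_onorm[OF bl, of v] by (simp add: cinner_diff_right)
    ultimately show "Re (cinner v (truncation e n S v)) \<le> (l' i + onorm (\<lambda>v. S v - T v)) * (norm v)\<^sup>2"
      by (simp add: form_truncation[OF e v(1)] algebra_simps)
  qed
  then show ?thesis
    using lambda_trunc_top_system[OF sa(1) e S i] lambda_trunc_top_system[OF sa(2) e T i] by simp
qed

lemma lambda_trunc_ge_minus_onorm:
  assumes sa: "self_adjoint T" and e: "orthonormal e n" and i: "i < n"
  shows "- onorm T \<le> lambda_trunc e T (Suc i) n"
proof -
  let ?V = "cvec.span (e ` {..<n})"
  obtain u l where ts: "top_system ?V (truncation e n T) n u l"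
    using truncation_top_system[OF e sa] by blast
  have u: "u i \<in> ?V" "norm (u i) = 1"
    using top_systemD(2)[OF ts i] orthonormal_norm[OF top_systemD(1)[OF ts] i] by auto
  have "l i = Re (cinner (u i) (truncation e n T (u i)))"
    using form_eigenvector[of "truncation e n T" "u i" "l i"] top_systemD(3)[OF ts i] u(2) by simp
  then have "l i = Re (cinner (u i) (T (u i)))" by (simp only: form_truncation[OF e u(1)])
  moreover have "\<bar>Re (cinner (u i) (T (u i)))\<bar> \<le> onorm T"
    using form_le_onorm[of T "u i"] u sa by (simp add: bounded_clinear_linear self_adjoint_def)
  ultimately show ?thesis using lambda_trunc_top_system[OF sa e ts i] by simp
qed

text \<open>
  Let \<open>F\<close> be the span of \<open>f 0, \<dots>, f i\<close>, on which the form is at least \<open>t\<close>. Choose \<open>v\<close> in \<open>F\<close>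
  orthogonal to the top \<open>i\<close> eigenvectors of the truncation; since these lie in \<open>V\<close>, its projection
  \<open>p\<close> is orthogonal to them as well, and the form at \<open>p\<close> is at most \<open>l i\<close> times the square of the
  norm. As \<open>norm (v - p) \<le> d n * norm v\<close> with \<open>d n\<close> tending to \<open>0\<close> and independent of \<open>v\<close>, passing
  from \<open>v\<close> to \<open>p\<close> costs arbitrarily little.
\<close>

lemma lambda_trunc_eventually_gt:
  assumes e: "orthonormal_basis e" and sa: "self_adjoint T" and f: "orthonormal f (Suc i)"
    and lower: "\<And>c. t * (norm (\<Sum>p<Suc i. c p *\<^sub>C f p))\<^sup>2 \<le>
      Re (cinner (\<Sum>p<Suc i. c p *\<^sub>C f p) (T (\<Sum>p<Suc i. c p *\<^sub>C f p)))"
    and a: "a < t"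
  shows "\<forall>\<^sub>F n in sequentially. a < lambda_trunc e T (Suc i) n"
proof -
  note on = orthonormal_basis_orthonormal[OF e]
  have bc: "bounded_clinear T" and bl: "bounded_linear T"
    using sa by (auto simp: self_adjoint_def bounded_clinear_def)
  define K where "K = onorm T"
  have K: "K \<ge> 0" unfolding K_def by (rule onorm_pos_le[OF bl])
  define d where "d n = (\<Sum>p<Suc i. norm (f p - proj e n (f p)))" for n
  have "d \<longlonglongrightarrow> (\<Sum>p<Suc i. norm (f p - f p))"
    unfolding d_def by (intro tendsto_intros tendsto_proj[OF e])
  then have d0: "d \<longlonglongrightarrow> 0" by simp
  have "(\<lambda>n. t - 2 * K * d n - K * (d n)\<^sup>2) \<longlonglongrightarrow> t - 2 * K * 0 - K * 0\<^sup>2"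
    by (intro tendsto_intros d0)
  then have ev: "\<forall>\<^sub>F n in sequentially. a < t - 2 * K * d n - K * (d n)\<^sup>2"
    using a by (intro order_tendstoD(1)) auto
  have ge: "t - 2 * K * d n - K * (d n)\<^sup>2 \<le> lambda_trunc e T (Suc i) n" if n: "n > i" for n
  proof -
    let ?V = "cvec.span (e ` {..<n})"
    obtain u l where ts: "top_system ?V (truncation e n T) n u l"
      using truncation_top_system[OF on sa] by blast
    have l: "lambda_trunc e T (Suc i) n = l i" by (rule lambda_trunc_top_system[OF sa on ts n])
    obtain c where c: "(\<Sum>p<Suc i. c p *\<^sub>C f p) \<noteq> 0" "(\<Sum>p<Suc i. c p *\<^sub>C f p) \<in> orth_compl u i"
      using exists_orthogonal_combination[OF f] by blast
    define v where "v = (\<Sum>p<Suc i. c p *\<^sub>C f p)"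
    have v: "v \<noteq> 0" "v \<in> orth_compl u i" using c by (auto simp: v_def)
    define p where "p = proj e n v"
    have pV: "p \<in> ?V" unfolding p_def by (rule proj_in_span)
    have "cinner (u j) p = cinner (u j) v" if "j < i" for j
      using proj_span_id[OF on top_systemD(2)[OF ts, of j]] that n cinner_proj_left[of e n "u j" v]
      by (simp add: p_def)
    then have "p \<in> orth_compl u i" using v(2) by (simp add: orth_compl_def)
    then have Tp: "Re (cinner p (T p)) \<le> l i * (norm p)\<^sup>2"
      using top_systemD(4)[OF ts n pV] by (simp add: form_truncation[OF on pV])
    have cp: "cmod (c q) \<le> norm v" if "q < Suc i" for q
    proof -
      have "cinner (f q) v = c q" unfolding v_def by (rule cinner_combination[OF f that])
      then show ?thesis
        using norm_cinner_le[of "f q" v] orthonormal_norm[OF f that] by simp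
    qed
    have "v - p = (\<Sum>q<Suc i. c q *\<^sub>C (f q - proj e n (f q)))"
      by (simp only: p_def v_def bounded_clinear_simps[OF bounded_clinear_proj] sum_subtractf
          cvec.scale_right_diff_distrib)
    then have "norm (v - p) \<le> (\<Sum>q<Suc i. norm (c q *\<^sub>C (f q - proj e n (f q))))"
      by (simp only: norm_sum)
    also have "\<dots> \<le> (\<Sum>q<Suc i. norm v * norm (f q - proj e n (f q)))"
      unfolding norm_scaleC by (intro sum_mono mult_right_mono cp) auto
    also have "\<dots> = d n * norm v" by (simp only: d_def sum_distrib_left[symmetric] mult.commute)
    finally have vp: "norm (v - p) \<le> d n * norm v" .
    have pv: "norm p \<le> norm v" unfolding p_def by (rule norm_proj_le[OF on])
    have "Re (cinner v (T v)) - Re (cinner p (T p)) = Re (cinner (v - p) (T v) + cinner p (T (v - p)))"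
      by (simp add: cinner_algebra bounded_clinear_simps[OF bc])
    also have "\<dots> \<le> cmod (cinner (v - p) (T v)) + cmod (cinner p (T (v - p)))"
      using complex_Re_le_cmod norm_triangle_ineq order_trans by blast
    also have "\<dots> \<le> norm (v - p) * (K * norm v) + norm p * (K * norm (v - p))"
      unfolding K_def
      by (intro add_mono order_trans[OF norm_cinner_le] mult_left_mono onorm[OF bl]) auto
    also have "\<dots> \<le> d n * norm v * (K * norm v) + norm v * (K * (d n * norm v))"
      using K vp pv by (intro add_mono mult_mono mult_right_mono mult_left_mono mult_nonneg_nonneg) auto
    finally have 1: "Re (cinner v (T v)) - Re (cinner p (T p)) \<le> 2 * K * d n * (norm v)\<^sup>2"
      by (simp add: power2_eq_square algebra_simps)
    have "cinner p (v - p) = 0"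
    proof -
      have "v - p \<in> orth_compl e n" unfolding p_def by (rule proj_compl[OF on])
      then show ?thesis unfolding p_def using orth_compl_proj_0 cinner_proj_left[of e n v "v - p"]
        by (metis cinner_zero_right p_def)
    qed
    from norm_add_square_orthogonal[OF this] have "(norm p)\<^sup>2 = (norm v)\<^sup>2 - (norm (v - p))\<^sup>2" by simp
    then have "l i * (norm p)\<^sup>2 = l i * (norm v)\<^sup>2 + (- l i) * (norm (v - p))\<^sup>2"
      by (simp only: right_diff_distrib)
    also have "\<dots> \<le> l i * (norm v)\<^sup>2 + K * (d n * norm v)\<^sup>2"
    proof -
      have "- l i \<le> K" using lambda_trunc_ge_minus_onorm[OF sa on n] l by (simp add: K_def)
      then have "(- l i) * (norm (v - p))\<^sup>2 \<le> K * (norm (v - p))\<^sup>2" by (intro mult_right_mono) auto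
      also have "\<dots> \<le> K * (d n * norm v)\<^sup>2" using vp K by (intro mult_left_mono power_mono) auto
      finally show ?thesis by simp
    qed
    finally have "t * (norm v)\<^sup>2 \<le> l i * (norm v)\<^sup>2 + K * (d n * norm v)\<^sup>2 + 2 * K * d n * (norm v)\<^sup>2"
      using 1 Tp lower[of c] unfolding v_def[symmetric] by linarith
    then have "(t - 2 * K * d n - K * (d n)\<^sup>2) * (norm v)\<^sup>2 \<le> l i * (norm v)\<^sup>2"
      by (simp add: algebra_simps power_mult_distrib)
    then have "t - 2 * K * d n - K * (d n)\<^sup>2 \<le> l i"
      by (rule mult_right_le_imp_le) (use v in simp)
    then show ?thesis using l by simp
  qed
  show ?thesis
  proof (rule eventually_mono[OF eventually_conj[OF ev eventually_gt_at_top[of i]]])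
    fix n assume "a < t - 2 * K * d n - K * (d n)\<^sup>2 \<and> i < n"
    then show "a < lambda_trunc e T (Suc i) n" using ge[of n] by linarith
  qed
qed

section \<open>Pointwise limits\<close>

text \<open>
  Gram-Schmidt orthogonalisation.
\<close>

lemma orthonormal_span_finite:
  assumes "finite (B :: 'a::chilbert_space set)"
  shows "\<exists>g m. orthonormal g m \<and> B \<subseteq> cvec.span (g ` {..<m})"
  using assms
proof (induction B rule: finite_induct)
  case empty
  then show ?case by (auto simp: orthonormal_def)
next
  case (insert b B)
  then obtain g m where g: "orthonormal g m" "B \<subseteq> cvec.span (g ` {..<m})" by blast
  define r where "r = b - proj g m b"
  have r: "r \<in> orth_compl g m" unfolding r_def by (rule proj_compl[OF g(1)])
  have b: "b = proj g m b + r" by (simp add: r_def)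
  show ?case
  proof (cases "r = 0")
    case True
    then have "b \<in> cvec.span (g ` {..<m})" using b proj_in_span[of g m b] by simp
    then show ?thesis using g by blast
  next
    case False
    let ?h = "g(m := complex_of_real (1 / norm r) *\<^sub>C r)"
    have "orthonormal ?h (Suc m)"
      using normalize_in_subspace[OF subspace_orth_compl r False] g(1) by (intro orthonormal_extend)
    moreover have sub: "g ` {..<m} \<subseteq> ?h ` {..<Suc m}" by (auto simp: image_iff less_Suc_eq)
    have "complex_of_real (norm r) *\<^sub>C ?h m \<in> cvec.span (?h ` {..<Suc m})"
      by (intro cvec.span_scale cvec.span_base) blast
    moreover have "complex_of_real (norm r) *\<^sub>C ?h m = r" using False by (simp add: scaleC_scaleC)
    ultimately have "orthonormal ?h (Suc m)" "r \<in> cvec.span (?h ` {..<Suc m})" by simp_all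
    moreover have "b \<in> cvec.span (?h ` {..<Suc m})"
      using b cvec.span_add[OF subsetD[OF cvec.span_mono[OF sub] proj_in_span[of g m b]] calculation(2)]
      by simp
    moreover have "B \<subseteq> cvec.span (?h ` {..<Suc m})" using g(2) cvec.span_mono[OF sub] by blast
    ultimately show ?thesis by blast
  qed
qed

lemma form_gt_below_ess_upper:
  fixes e :: "nat \<Rightarrow> 'a::chilbert_space" and T :: "'a \<Rightarrow> 'a"
  assumes e: "\<And>n. orthonormal e n" and sa: "self_adjoint T" and t: "t < ess_upper T"
    and B: "finite B"
  obtains v where "norm v = 1" "\<And>b. b \<in> B \<Longrightarrow> cinner b v = 0" "t \<le> Re (cinner v (T v))"
proof -
  have bc: "bounded_clinear T" using sa by (rule self_adjoint_bounded_clinear)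
  obtain g m where g: "orthonormal g m" "B \<subseteq> cvec.span (g ` {..<m})"
    using orthonormal_span_finite[OF B] by blast
  obtain v where v: "v \<in> orth_compl g m" "\<not> Re (cinner v (T v)) \<le> t * (norm v)\<^sup>2"
    using ess_upper_le_form_bound[OF e sa g(1), of t] t by force
  have "v \<noteq> 0" using v(2) bounded_clinear_simps(4)[OF bc] by auto
  define x where "x = complex_of_real (1 / norm v) *\<^sub>C v"
  have x: "x \<in> orth_compl g m" "norm x = 1"
    unfolding x_def using normalize_in_subspace[OF subspace_orth_compl v(1) \<open>v \<noteq> 0\<close>] by auto
  have "cinner b x = 0" if "b \<in> B" for b
  proof -
    have "cvec.span (g ` {..<m}) \<subseteq> {b. cinner b x = 0}"
    proof (rule cvec.span_minimal)
      show "cvec.subspace {b. cinner b x = 0}" by (auto simp: cvec.subspace_def cinner_algebra)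
    qed (use x(1) in \<open>auto simp: orth_compl_def\<close>)
    then show ?thesis using g(2) that by blast
  qed
  moreover have "t \<le> Re (cinner x (T x))"
    unfolding x_def form_scaleC[OF bc]
    using v(2) \<open>v \<noteq> 0\<close> by (simp add: norm_divide power_divide field_simps)
  ultimately show ?thesis using that x(2) by blast
qed

text \<open>
  The vectors \<open>f q\<close> are chosen one after the other, each orthogonal to the earlier \<open>f p\<close> and also
  to \<open>T (f p)\<close>. The second condition removes the cross terms from the form, so that the bound \<open>t\<close>
  passes from the single vectors to all their combinations.
\<close>

lemma exists_large_form_subspace:
  fixes e :: "nat \<Rightarrow> 'a::chilbert_space" and T :: "'a \<Rightarrow> 'a"
  assumes e: "\<And>n. orthonormal e n" and sa: "self_adjoint T" and t: "t < ess_upper T"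
  obtains f where "orthonormal f k"
    "\<And>c. t * (norm (\<Sum>p<k. c p *\<^sub>C f p))\<^sup>2 \<le> Re (cinner (\<Sum>p<k. c p *\<^sub>C f p) (T (\<Sum>p<k. c p *\<^sub>C f p)))"
proof -
  have bc: "bounded_clinear T" using sa by (rule self_adjoint_bounded_clinear)
  have "\<exists>f. orthonormal f k \<and> (\<forall>p<k. \<forall>q<k. p \<noteq> q \<longrightarrow> cinner (f p) (T (f q)) = 0) \<and>
      (\<forall>p<k. t \<le> Re (cinner (f p) (T (f p))))"
  proof (induction k)
    case 0
    then show ?case by (simp add: orthonormal_def)
  next
    case (Suc k)
    then obtain f where f: "orthonormal f k"
      "\<And>p q. p < k \<Longrightarrow> q < k \<Longrightarrow> p \<noteq> q \<Longrightarrow> cinner (f p) (T (f q)) = 0"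
      "\<And>p. p < k \<Longrightarrow> t \<le> Re (cinner (f p) (T (f p)))" by blast
    obtain v where v: "norm v = 1" "\<And>b. b \<in> f ` {..<k} \<union> (\<lambda>p. T (f p)) ` {..<k} \<Longrightarrow> cinner b v = 0"
      "t \<le> Re (cinner v (T v))"
      using form_gt_below_ess_upper[OF e sa t, of "f ` {..<k} \<union> (\<lambda>p. T (f p)) ` {..<k}"] by auto
    have fT: "cinner (f p) (T v) = 0" if "p < k" for p
      using v(2)[of "T (f p)"] that by (simp add: self_adjoint_cinner[OF sa])
    moreover have "cinner v (T (f p)) = 0" if "p < k" for p
      using v(2)[of "T (f p)"] that cinner_commute[of v "T (f p)"] by simp
    moreover have "orthonormal (f(k := v)) (Suc k)"
      using f(1) v by (intro orthonormal_extend) (auto simp: orth_compl_def)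
    moreover from calculation(1,2)
    have "\<forall>p<Suc k. \<forall>q<Suc k. p \<noteq> q \<longrightarrow> cinner ((f(k := v)) p) (T ((f(k := v)) q)) = 0"
      "\<forall>p<Suc k. t \<le> Re (cinner ((f(k := v)) p) (T ((f(k := v)) p)))"
      using f(2,3) v(3) by (auto simp: less_Suc_eq)
    ultimately show ?case by blast
  qed
  then obtain f where f: "orthonormal f k"
    "\<And>p q. p < k \<Longrightarrow> q < k \<Longrightarrow> p \<noteq> q \<Longrightarrow> cinner (f p) (T (f q)) = 0"
    "\<And>p. p < k \<Longrightarrow> t \<le> Re (cinner (f p) (T (f p)))" by blast
  have "t * (norm (\<Sum>p<k. c p *\<^sub>C f p))\<^sup>2 \<le>
      Re (cinner (\<Sum>p<k. c p *\<^sub>C f p) (T (\<Sum>p<k. c p *\<^sub>C f p)))" for c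
  proof -
    have "cinner (\<Sum>p<k. c p *\<^sub>C f p) (T (\<Sum>p<k. c p *\<^sub>C f p)) =
        (\<Sum>p<k. \<Sum>q<k. cnj (c p) * (c q * cinner (f p) (T (f q))))"
      unfolding bounded_clinear_simps[OF bc] cinner_sum_left
      by (simp only: cinner_sum_right cinner_scaleC_left cinner_scaleC_right sum_distrib_left)
        (simp only: mult.left_commute)
    also have "\<dots> = (\<Sum>p<k. \<Sum>q<k. if p = q then complex_of_real ((cmod (c p))\<^sup>2) * cinner (f p) (T (f p)) else 0)"
    proof (intro sum.cong refl)
      fix p q assume "p \<in> {..<k}" "q \<in> {..<k}"
      then show "cnj (c p) * (c q * cinner (f p) (T (f q))) =
          (if p = q then complex_of_real ((cmod (c p))\<^sup>2) * cinner (f p) (T (f p)) else 0)"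
        using f(2)[of p q] complex_norm_square[of "c p"] by auto
    qed
    also have "\<dots> = (\<Sum>p<k. complex_of_real ((cmod (c p))\<^sup>2) * cinner (f p) (T (f p)))" by simp
    finally have "Re (cinner (\<Sum>p<k. c p *\<^sub>C f p) (T (\<Sum>p<k. c p *\<^sub>C f p))) =
        (\<Sum>p<k. (cmod (c p))\<^sup>2 * Re (cinner (f p) (T (f p))))"
      by simp
    moreover have "(\<Sum>p<k. (cmod (c p))\<^sup>2 * t) \<le> (\<Sum>p<k. (cmod (c p))\<^sup>2 * Re (cinner (f p) (T (f p))))"
      using f(3) by (intro sum_mono mult_left_mono) auto
    ultimately show ?thesis
      unfolding norm_combination[OF f(1)] by (simp add: sum_distrib_left mult.commute)
  qed
  with f(1) that show ?thesis by blast
qed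

text \<open>
  The claimed limit of the \<open>k\<close>-th largest eigenvalue of the truncations.
\<close>

definition top_limit :: "('a::chilbert_space \<Rightarrow> 'a) \<Rightarrow> nat \<Rightarrow> real" where
  "top_limit T k = (if enat k \<le> num_above T then lambda_plus T k else ess_upper T)"

lemma discrete_above_eigenvalues: "discrete_above T \<subseteq> eigenvalues_on UNIV T"
  by (auto simp: discrete_above_def discrete_eigenvalues_def)

lemma top_system_value_discrete:
  assumes sa: "self_adjoint T" and ts: "top_system UNIV T k u l" and i: "i < k"
    and above: "l i > ess_upper T"
  shows "l i \<in> discrete_above T" "finite_cdim (eigenspace_on UNIV T (l i))"
proof -
  have ness: "complex_of_real (l i) \<notin> ess_spectrum T"
    using above ess_upper_upper[OF sa, of "l i"] by auto
  then show fin: "finite_cdim (eigenspace_on UNIV T (l i))"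
    by (simp add: ess_spectrum_def fredholm_def eigenspace_on_def)
  have "u i \<noteq> 0" using orthonormal_norm[OF top_systemD(1)[OF ts] i] by auto
  then have "complex_of_real (l i) isolated_in spectrum T"
    by (rule isolated_in_spectrum[OF sa ness top_systemD(3)[OF ts i]])
  then show "l i \<in> discrete_above T"
    using fin top_system_eigenvalue[OF ts i] above
    by (simp add: discrete_above_def discrete_eigenvalues_def)
qed

lemma top_system_value_entry:
  assumes sa: "self_adjoint T" and ts: "top_system UNIV T k u l"
    and above: "\<forall>i<k. l i > ess_upper T" and i: "i < k"
  shows "kth_largest_entry (discrete_above T) (multiplicity_on UNIV T) (Suc i) (l i)"
  using top_system_value_discrete[OF sa ts] above i
  by (intro top_system_kth_largest_entry[OF ts sa cvec.subspace_UNIV discrete_above_eigenvalues]) auto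

lemma top_limit_eigenvalue:
  assumes sa: "self_adjoint T" and ts: "top_system UNIV T k u l"
    and above: "\<forall>i<k. l i > ess_upper T" and i: "i < k"
  shows "top_limit T (Suc i) = l i"
proof -
  let ?S = "discrete_above T" and ?m = "multiplicity_on UNIV T"
  note entry = top_system_value_entry[OF assms]
  have "enat (Suc i) \<le> num_above T"
  proof (cases "finite ?S")
    case True
    then have "(\<Sum>s \<in> {s \<in> ?S. s \<ge> l i}. ?m s) \<le> (\<Sum>s\<in>?S. ?m s)" by (intro sum_mono2) auto
    then show ?thesis
      using entry True by (simp add: num_above_def count_with_mult_def kth_largest_entry_def)
  qed (simp add: num_above_def count_with_mult_def)
  then show ?thesis
    using kth_largest_eqI[OF entry] by (simp add: top_limit_def lambda_plus_def)
qed

text \<open>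
  Once the form is at most \<open>ess_upper T\<close> on the complement, no further eigenvalue can lie above
  it.
\<close>

lemma num_above_exhausted:
  assumes sa: "self_adjoint T" and ts: "top_system UNIV T j u l"
    and above: "\<forall>i<j. l i > ess_upper T"
    and stop: "\<forall>v\<in>orth_compl u j. Re (cinner v (T v)) \<le> ess_upper T * (norm v)\<^sup>2"
  shows "num_above T = enat j"
proof -
  let ?S = "discrete_above T"
  have S: "l i \<in> ?S" if "i < j" for i
    using top_system_value_discrete(1)[OF sa ts that] above that by blast
  have exh: "v = 0" if "s \<in> ?S" "v \<in> orth_compl u j" "T v = complex_of_real s *\<^sub>C v" for s v
    using top_system_exhausts_above[of UNIV u j T "ess_upper T" s v] stop that
    by (auto simp: discrete_above_def)
  have "finite ?S" "(\<Sum>s\<in>?S. multiplicity_on UNIV T s) = j"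
    using exh S
    by (intro top_system_exhaustive_count[OF ts sa cvec.subspace_UNIV discrete_above_eigenvalues]; blast)+
  then show ?thesis by (simp add: num_above_def count_with_mult_def)
qed

lemma top_system_above_cases:
  fixes e :: "nat \<Rightarrow> 'a::chilbert_space" and T :: "'a \<Rightarrow> 'a"
  assumes e: "\<And>n. orthonormal e n" and sa: "self_adjoint T"
  obtains (eigen) u l where "top_system UNIV T k u l" "\<forall>i<k. l i > ess_upper T"
  | (stop) j u l where "j < k" "top_system UNIV T j u l" "\<forall>i<j. l i > ess_upper T"
      "\<forall>v\<in>orth_compl u j. Re (cinner v (T v)) \<le> ess_upper T * (norm v)\<^sup>2"
proof -
  have "(\<exists>u l. top_system UNIV T k u l \<and> (\<forall>i<k. l i > ess_upper T)) \<or>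
    (\<exists>j<k. \<exists>u l. top_system UNIV T j u l \<and> (\<forall>i<j. l i > ess_upper T) \<and>
      (\<forall>v\<in>orth_compl u j. Re (cinner v (T v)) \<le> ess_upper T * (norm v)\<^sup>2))"
  proof (induction k)
    case 0
    then show ?case using top_system_0 by blast
  next
    case (Suc k)
    then consider u l where "top_system UNIV T k u l" "\<forall>i<k. l i > ess_upper T"
      | "\<exists>j<k. \<exists>u l. top_system UNIV T j u l \<and> (\<forall>i<j. l i > ess_upper T) \<and>
          (\<forall>v\<in>orth_compl u j. Re (cinner v (T v)) \<le> ess_upper T * (norm v)\<^sup>2)" by blast
    then show ?case
    proof cases
      case 1
      then show ?thesis using top_system_above_extend[OF e sa 1] lessI[of k] by blast
    next
      case 2
      then show ?thesis using less_SucI by blast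
    qed
  qed
  then show ?thesis using eigen stop by blast
qed

lemma lambda_trunc_tendsto:
  assumes e: "orthonormal_basis e" and sa: "self_adjoint T" and k: "k \<ge> 1"
  shows "(\<lambda>n. lambda_trunc e T k n) \<longlonglongrightarrow> top_limit T k"
proof -
  note on = orthonormal_basis_orthonormal[OF e]
  have bc: "bounded_clinear T" using sa by (rule self_adjoint_bounded_clinear)
  obtain i where i: "k = Suc i" using k by (cases k) auto
  consider (eigen) u l where "top_system UNIV T k u l" "\<forall>i<k. l i > ess_upper T"
  | (stop) j u l where "j < k" "top_system UNIV T j u l" "\<forall>i<j. l i > ess_upper T"
      "\<forall>v\<in>orth_compl u j. Re (cinner v (T v)) \<le> ess_upper T * (norm v)\<^sup>2"
    by (rule top_system_above_cases[OF on sa, of k])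
  then show ?thesis
  proof cases
    case (eigen u l)
    have lim: "top_limit T k = l i" using top_limit_eigenvalue[OF sa eigen] i by simp
    have upper: "lambda_trunc e T k n \<le> l i" if "n > i" for n
      unfolding i using top_systemD(4)[OF eigen(1), of i] i
      by (intro lambda_trunc_le_form_bound[OF sa on that, of u]) auto
    show ?thesis unfolding lim
    proof (rule order_tendstoI)
      fix a assume "a < l i"
      then show "\<forall>\<^sub>F n in sequentially. a < lambda_trunc e T k n"
        unfolding i using eigen(1)[unfolded i] top_systemD(1)
        by (intro lambda_trunc_eventually_gt[OF e sa, of u i "l i"] top_system_combination_form[OF _ bc])
          auto
    next
      fix a assume "l i < a"
      then show "\<forall>\<^sub>F n in sequentially. lambda_trunc e T k n < a"
        by (intro eventually_mono[OF eventually_gt_at_top[of i]]) (use upper le_less_trans in blast)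
    qed
  next
    case (stop j u l)
    have lim: "top_limit T k = ess_upper T"
      using num_above_exhausted[OF sa stop(2-4)] stop(1) by (simp add: top_limit_def)
    have upper: "lambda_trunc e T k n \<le> ess_upper T" if "n > i" for n
      unfolding i using stop(1,4) orth_compl_antimono[of j i u] i
      by (intro lambda_trunc_le_form_bound[OF sa on that, of u]) auto
    show ?thesis unfolding lim
    proof (rule order_tendstoI)
      fix a assume "a < ess_upper T"
      then obtain t where t: "a < t" "t < ess_upper T" using dense by blast
      obtain f where "orthonormal f k"
        "\<And>c. t * (norm (\<Sum>p<k. c p *\<^sub>C f p))\<^sup>2 \<le> Re (cinner (\<Sum>p<k. c p *\<^sub>C f p) (T (\<Sum>p<k. c p *\<^sub>C f p)))"
        using exists_large_form_subspace[OF on sa t(2)] by blast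
      then show "\<forall>\<^sub>F n in sequentially. a < lambda_trunc e T k n"
        using t(1) unfolding i by (rule lambda_trunc_eventually_gt[OF e sa])
    next
      fix a assume "ess_upper T < a"
      then show "\<forall>\<^sub>F n in sequentially. lambda_trunc e T k n < a"
        by (intro eventually_mono[OF eventually_gt_at_top[of i]]) (use upper le_less_trans in blast)
    qed
  qed
qed

text \<open>
  If deflation stops, the sequence is eventually constant. Otherwise its values decrease to a
  point of the essential spectrum, which is at most \<open>ess_upper T\<close> but a limit of numbers above it.
\<close>

lemma top_limit_tendsto:
  fixes e :: "nat \<Rightarrow> 'a::chilbert_space" and T :: "'a \<Rightarrow> 'a"
  assumes e: "orthonormal_basis e" and sa: "self_adjoint T"
  shows "top_limit T \<longlonglongrightarrow> ess_upper T"
proof (cases "\<exists>j u l. top_system UNIV T j u l \<and> (\<forall>i<j. l i > ess_upper T) \<and>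
      (\<forall>v\<in>orth_compl u j. Re (cinner v (T v)) \<le> ess_upper T * (norm v)\<^sup>2)")
  case True
  then obtain j u l where "top_system UNIV T j u l" "\<forall>i<j. l i > ess_upper T"
      "\<forall>v\<in>orth_compl u j. Re (cinner v (T v)) \<le> ess_upper T * (norm v)\<^sup>2" by blast
  then have "num_above T = enat j" by (rule num_above_exhausted[OF sa])
  then have "\<forall>k>j. top_limit T k = ess_upper T" by (simp add: top_limit_def)
  then have "\<forall>\<^sub>F k in sequentially. top_limit T k = ess_upper T"
    by (intro eventually_mono[OF eventually_gt_at_top[of j]]) simp
  then show ?thesis by (rule tendsto_eventually)
next
  case False
  then have ex: "\<exists>u l. top_system UNIV T k u l \<and> (\<forall>i<k. l i > ess_upper T)" for k
    using top_system_above_cases[OF orthonormal_basis_orthonormal[OF e] sa, of k] by metis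
  then obtain L where L: "\<And>k. \<exists>u. top_system UNIV T k u L"
    using infinite_top_system[OF sa] by metis
  have lim: "top_limit T (Suc i) = L i" and above: "L i > ess_upper T" for i
  proof -
    obtain u where u: "top_system UNIV T (Suc i) u L" using L by blast
    obtain u' l where ul: "top_system UNIV T (Suc i) u' l" "\<forall>j<Suc i. l j > ess_upper T"
      using ex by blast
    have eq: "L j = l j" if "j < Suc i" for j
      using that by (intro top_system_value_unique[OF u ul(1)] self_adjoint_bounded_clinear sa) auto
    then show "L i > ess_upper T" using ul(2) by simp
    show "top_limit T (Suc i) = L i" using top_limit_eigenvalue[OF sa ul, of i] eq by simp
  qed
  obtain r where r: "L \<longlonglongrightarrow> r" "complex_of_real r \<in> ess_spectrum T"
    using limit_of_top_system_values[OF sa L] by blast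
  have "r \<le> ess_upper T" by (rule ess_upper_upper[OF sa r(2)])
  moreover have "ess_upper T \<le> r"
    using above by (intro LIMSEQ_le_const[OF r(1)]) (auto intro: less_imp_le)
  ultimately have "(\<lambda>i. top_limit T (Suc i)) \<longlonglongrightarrow> ess_upper T" using r(1) by (simp add: lim)
  then show ?thesis by (rule LIMSEQ_imp_Suc)
qed

section \<open>Reflection: from the top to the bottom of the spectrum\<close>

lemma self_adjoint_uminus:
  assumes "self_adjoint T"
  shows "self_adjoint (\<lambda>v. - T v)"
  using assms bounded_linear_minus[of T]
  by (auto simp: self_adjoint_def bounded_clinear_def)

lemma eigenspace_uminus: "eigenspace_on V (\<lambda>v. - T v) s = eigenspace_on V T (- s)"
proof -
  have "- T v = complex_of_real s *\<^sub>C v \<longleftrightarrow> T v = complex_of_real (- s) *\<^sub>C v" for v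
    using equation_minus_iff[of "T v" "complex_of_real s *\<^sub>C v"] by auto
  then show ?thesis by (simp add: eigenspace_on_def)
qed

lemma eigenvalues_uminus: "eigenvalues_on V (\<lambda>v. - T v) = uminus ` eigenvalues_on V T"
  unfolding eigenvalues_on_def eigenspace_uminus by (auto simp: image_iff) (metis minus_minus)

lemma multiplicity_uminus: "multiplicity_on V (\<lambda>v. - T v) = (\<lambda>s. multiplicity_on V T (- s))"
  by (simp add: multiplicity_on_def eigenspace_uminus fun_eq_iff)

lemma truncation_uminus: "truncation e n (\<lambda>v. - T v) = (\<lambda>v. - truncation e n T v)"
  by (simp add: truncation_def fun_eq_iff bounded_clinear_simps[OF bounded_clinear_proj])

lemma fredholm_uminus:
  assumes "bounded_clinear S" "fredholm S"
  shows "fredholm (\<lambda>v. - S v)"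
proof -
  have "range (\<lambda>v. - S v) = range S"
  proof (intro set_eqI iffI)
    fix y
    show "y \<in> range S" if "y \<in> range (\<lambda>v. - S v)"
      using that by (auto simp flip: bounded_clinear_simps(3)[OF assms(1)])
    assume "y \<in> range S"
    then obtain x where "y = S x" by blast
    then have "y = - S (- x)" by (simp add: bounded_clinear_simps[OF assms(1)])
    then show "y \<in> range (\<lambda>v. - S v)" by blast
  qed
  then show ?thesis using assms(2) by (simp add: fredholm_def)
qed

lemma ess_spectrum_uminus_subset:
  assumes "bounded_clinear T" "z \<in> ess_spectrum T"
  shows "- z \<in> ess_spectrum (\<lambda>v. - T v)"
proof -
  have bc: "bounded_clinear (\<lambda>v. - T v - (- z) *\<^sub>C v)"
  proof (rule bounded_clinear_shift)
    show "bounded_clinear (\<lambda>v. - T v)"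
      using assms(1) bounded_linear_minus[of T] by (auto simp: bounded_clinear_def)
  qed
  have "(\<lambda>v. - (- T v - (- z) *\<^sub>C v)) = (\<lambda>v. T v - z *\<^sub>C v)" by (simp add: fun_eq_iff)
  then show ?thesis
    using fredholm_uminus[OF bc] assms(2) by (auto simp: ess_spectrum_def)
qed

lemma ess_lower_uminus:
  assumes "self_adjoint T"
  shows "ess_lower T = - ess_upper (\<lambda>v. - T v)"
proof -
  note bc = self_adjoint_bounded_clinear
  have "ess_spectrum (\<lambda>v. - T v) = uminus ` ess_spectrum T"
  proof
    show "uminus ` ess_spectrum T \<subseteq> ess_spectrum (\<lambda>v. - T v)"
      using ess_spectrum_uminus_subset[OF bc[OF assms]] by blast
    show "ess_spectrum (\<lambda>v. - T v) \<subseteq> uminus ` ess_spectrum T"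
    proof
      fix z assume "z \<in> ess_spectrum (\<lambda>v. - T v)"
      from ess_spectrum_uminus_subset[OF bc[OF self_adjoint_uminus[OF assms]] this]
      have "- z \<in> ess_spectrum T" by simp
      then show "z \<in> uminus ` ess_spectrum T" by (metis imageI minus_minus)
    qed
  qed
  then have "Re ` ess_spectrum (\<lambda>v. - T v) = uminus ` Re ` ess_spectrum T"
    by (simp add: image_image)
  then show ?thesis by (simp add: ess_lower_def ess_upper_def Inf_real_def)
qed

lemma spectrum_uminus_subset:
  assumes "z \<notin> spectrum T"
  shows "- z \<notin> spectrum (\<lambda>v. - T v)"
proof -
  obtain B where B: "bounded_clinear B" "\<And>v. B (T v - z *\<^sub>C v) = v" "\<And>v. T (B v) - z *\<^sub>C B v = v"
    using assms by (auto simp: spectrum_def)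
  have nB: "bounded_clinear (\<lambda>v. - B v)"
    using B(1) bounded_linear_minus[of B] by (auto simp: bounded_clinear_def)
  have "- B (- T v - (- z) *\<^sub>C v) = v" for v
  proof -
    have "- T v - (- z) *\<^sub>C v = - (T v - z *\<^sub>C v)" by simp
    then show ?thesis by (simp only: bounded_clinear_simps(3)[OF B(1)] B(2) minus_minus)
  qed
  moreover have "- T (- B v) - (- z) *\<^sub>C (- B v) = v" for v
  proof -
    have "T (- B v) = - v + z *\<^sub>C (- B v)"
      using B(3)[of "- v"] by (simp only: bounded_clinear_simps(3)[OF B(1)] diff_eq_eq)
    then show ?thesis by simp
  qed
  ultimately have "\<exists>R. bounded_clinear R \<and> (\<forall>v. R (- T v - (- z) *\<^sub>C v) = v) \<and>
      (\<forall>v. - T (R v) - (- z) *\<^sub>C R v = v)"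
    using nB by (intro exI[of _ "\<lambda>v. - B v"] conjI allI)
  then show ?thesis by (simp only: spectrum_def mem_Collect_eq not_not)
qed

lemma isolated_in_spectrum_uminus:
  assumes iso: "complex_of_real s isolated_in spectrum T"
  shows "complex_of_real (- s) isolated_in spectrum (\<lambda>v. - T v)"
proof -
  let ?N = "\<lambda>v. - T v"
  have iff: "z \<in> spectrum ?N \<longleftrightarrow> - z \<in> spectrum T" for z
    using spectrum_uminus_subset[of "- z" T] spectrum_uminus_subset[of z ?N] by auto
  obtain r where r: "r > 0" "\<And>y. y \<in> spectrum T \<Longrightarrow> dist (complex_of_real s) y < r \<Longrightarrow> y = complex_of_real s"
    using iso by (auto simp: isolated_in_dist_Ex_iff)
  have "y = complex_of_real (- s)" if "y \<in> spectrum ?N" "dist (complex_of_real (- s)) y < r" for y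
  proof -
    have "dist (complex_of_real s) (- y) = dist (complex_of_real (- s)) y"
      by (simp add: dist_norm norm_minus_commute add.commute)
    then have "- y = complex_of_real s" using r(2)[of "- y"] that iff by simp
    then show ?thesis by (metis minus_minus of_real_minus)
  qed
  then show ?thesis
    using iso r(1) iff by (auto simp: isolated_in_dist_Ex_iff)
qed

lemma discrete_eigenvalues_uminus_subset:
  assumes "s \<in> discrete_eigenvalues T"
  shows "- s \<in> discrete_eigenvalues (\<lambda>v. - T v)"
  using assms isolated_in_spectrum_uminus[of s T]
  by (auto simp: discrete_eigenvalues_def eigenvalues_uminus eigenspace_uminus)

lemma discrete_above_uminus:
  assumes "self_adjoint T"
  shows "discrete_above (\<lambda>v. - T v) = uminus ` discrete_below T"
proof
  show "uminus ` discrete_below T \<subseteq> discrete_above (\<lambda>v. - T v)"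
    using discrete_eigenvalues_uminus_subset[of _ T]
    by (auto simp: discrete_below_def discrete_above_def ess_lower_uminus[OF assms])
  show "discrete_above (\<lambda>v. - T v) \<subseteq> uminus ` discrete_below T"
  proof
    fix s assume s: "s \<in> discrete_above (\<lambda>v. - T v)"
    then have "- s \<in> discrete_below T"
      using discrete_eigenvalues_uminus_subset[of s "\<lambda>v. - T v"]
      by (auto simp: discrete_below_def discrete_above_def ess_lower_uminus[OF assms])
    then show "s \<in> uminus ` discrete_below T" by (metis imageI minus_minus)
  qed
qed

lemma reflected_sums:
  fixes S :: "real set"
  shows "(\<Sum>s \<in> {s \<in> uminus ` S. s > t}. m (- s)) = (\<Sum>s \<in> {s \<in> S. s < - t}. m s)"
    and "(\<Sum>s \<in> {s \<in> uminus ` S. s \<ge> t}. m (- s)) = (\<Sum>s \<in> {s \<in> S. s \<le> - t}. m s)"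
    and "finite {s \<in> uminus ` S. s \<ge> t} \<longleftrightarrow> finite {s \<in> S. s \<le> - t}"
proof -
  have *: "{s \<in> uminus ` S. s > t} = uminus ` {s \<in> S. s < - t}"
    "{s \<in> uminus ` S. s \<ge> t} = uminus ` {s \<in> S. s \<le> - t}" by auto
  show "(\<Sum>s \<in> {s \<in> uminus ` S. s > t}. m (- s)) = (\<Sum>s \<in> {s \<in> S. s < - t}. m s)"
    "(\<Sum>s \<in> {s \<in> uminus ` S. s \<ge> t}. m (- s)) = (\<Sum>s \<in> {s \<in> S. s \<le> - t}. m s)"
    "finite {s \<in> uminus ` S. s \<ge> t} \<longleftrightarrow> finite {s \<in> S. s \<le> - t}"
    unfolding * by (simp_all add: sum.reindex finite_image_iff)
qed

lemma kth_smallest_eq_uminus_kth_largest: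
  "kth_smallest S m k = (THE t. kth_largest_entry (uminus ` S) (\<lambda>s. m (- s)) k (- t))"
  unfolding kth_smallest_def kth_largest_entry_def reflected_sums
  by (simp add: image_iff)

lemma kth_smallest_reflect:
  assumes "kth_largest_entry (uminus ` S) (\<lambda>s. m (- s)) k t"
  shows "kth_smallest S m k = - kth_largest (uminus ` S) (\<lambda>s. m (- s)) k"
  unfolding kth_smallest_eq_uminus_kth_largest kth_largest_eqI[OF assms]
proof (rule the_equality)
  show "kth_largest_entry (uminus ` S) (\<lambda>s. m (- s)) k (- (- t))" using assms by simp
  show "t' = - t" if "kth_largest_entry (uminus ` S) (\<lambda>s. m (- s)) k (- t')" for t'
    using kth_largest_eqI[OF that] kth_largest_eqI[OF assms] by simp
qed

text \<open>
  Counting \<open>n\<close> entries from the other end: the \<open>k\<close>-th smallest is the \<open>(n + 1 - k)\<close>-th largest.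
\<close>

lemma kth_largest_entry_complement:
  assumes entry: "kth_largest_entry (uminus ` S) (\<lambda>s. m (- s)) k t"
    and fin: "finite S" and n: "(\<Sum>s\<in>S. m s) = n" and k: "1 \<le> k" "k \<le> n"
  shows "kth_largest_entry S m (n + 1 - k) (- t)"
proof -
  have 1: "(\<Sum>s \<in> {s \<in> S. s < - t}. m s) + (\<Sum>s \<in> {s \<in> S. s \<ge> - t}. m s) = n"
    unfolding n[symmetric] by (subst sum.union_disjoint[symmetric]) (use fin in \<open>auto intro: sum.cong\<close>)
  have 2: "(\<Sum>s \<in> {s \<in> S. s \<le> - t}. m s) + (\<Sum>s \<in> {s \<in> S. s > - t}. m s) = n"
    unfolding n[symmetric] by (subst sum.union_disjoint[symmetric]) (use fin in \<open>auto intro: sum.cong\<close>)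
  have "- t \<in> S" using entry by (auto simp: kth_largest_entry_def)
  then show ?thesis
    using entry 1 2 k fin unfolding kth_largest_entry_def reflected_sums by auto
qed

lemma lambda_trunc_reflect:
  assumes sa: "self_adjoint T" and e: "orthonormal e n" and k: "1 \<le> k" "k \<le> n"
  shows "lambda_trunc e T (n + 1 - k) n = - lambda_trunc e (\<lambda>v. - T v) k n"
proof -
  let ?V = "cvec.span (e ` {..<n})"
  note sa' = self_adjoint_uminus[OF sa]
  define S where "S = eigenvalues_on ?V (truncation e n T)"
  define m where "m = multiplicity_on ?V (truncation e n T)"
  obtain u l where ul: "top_system ?V (truncation e n T) n u l"
    using truncation_top_system[OF e sa] by blast
  obtain u' l' where ul': "top_system ?V (truncation e n (\<lambda>v. - T v)) n u' l'"
    using truncation_top_system[OF e sa'] by blast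
  obtain i where i: "k = Suc i" using k by (cases k) auto
  have "kth_largest_entry (uminus ` S) (\<lambda>s. m (- s)) k (l' i)"
    using lambda_trunc_entry[OF sa' e ul', of i] k i
    by (simp add: truncation_uminus eigenvalues_uminus multiplicity_uminus S_def m_def)
  from kth_largest_entry_complement[OF this _ _ k]
  have "kth_largest_entry S m (n + 1 - k) (- l' i)"
    using sum_multiplicity_truncation[OF sa e ul] by (simp add: S_def m_def)
  then have "lambda_trunc e T (n + 1 - k) n = - l' i"
    unfolding lambda_trunc_def Let_def S_def m_def by (rule kth_largest_eqI)
  then show ?thesis
    using lambda_trunc_top_system[OF sa' e ul', of i] k i by simp
qed

lemma num_below_reflect:
  assumes "self_adjoint T"
  shows "num_below T = num_above (\<lambda>v. - T v)"
  unfolding num_below_def num_above_def count_with_mult_def discrete_above_uminus[OF assms]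
    multiplicity_uminus
  by (simp add: finite_image_iff sum.reindex)

text \<open>
  The definite description in \<^const>\<open>lambda_minus\<close> can be reflected only if the entry exists. For \<open>k \<le>
  num_below T\<close> it does, because deflation of \<open>-T\<close> cannot stop before step \<open>k\<close>.
\<close>

lemma bottom_limit_reflect:
  fixes e :: "nat \<Rightarrow> 'a::chilbert_space" and T :: "'a \<Rightarrow> 'a"
  assumes e: "orthonormal_basis e" and sa: "self_adjoint T" and k: "1 \<le> k"
  shows "(if enat k \<le> num_below T then lambda_minus T k else ess_lower T) = - top_limit (\<lambda>v. - T v) k"
proof (cases "enat k \<le> num_above (\<lambda>v. - T v)")
  case True
  let ?N = "\<lambda>v. - T v"
  note sa' = self_adjoint_uminus[OF sa]
  obtain i where i: "k = Suc i" using k by (cases k) auto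
  obtain t where "kth_largest_entry (discrete_above ?N) (multiplicity_on UNIV ?N) k t"
  proof (rule top_system_above_cases[OF orthonormal_basis_orthonormal[OF e] sa', of k])
    fix u l assume "top_system UNIV ?N k u l" "\<forall>i<k. ess_upper ?N < l i"
    then have "kth_largest_entry (discrete_above ?N) (multiplicity_on UNIV ?N) k (l i)"
      unfolding i by (rule top_system_value_entry[OF sa']) simp
    then show ?thesis by (rule that)
  next
    fix j u l
    assume "j < k" "top_system UNIV ?N j u l" "\<forall>i<j. ess_upper ?N < l i"
      "\<forall>v\<in>orth_compl u j. Re (cinner v (- T v)) \<le> ess_upper ?N * (norm v)\<^sup>2"
    then show ?thesis using num_above_exhausted[OF sa', of j u l] True by simp
  qed
  then have "lambda_minus T k = - lambda_plus ?N k"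
    unfolding lambda_minus_def lambda_plus_def discrete_above_uminus[OF sa] multiplicity_uminus
    by (rule kth_smallest_reflect)
  then show ?thesis using True by (simp add: top_limit_def num_below_reflect[OF sa])
next
  case False
  then show ?thesis
    by (simp add: top_limit_def num_below_reflect[OF sa] ess_lower_uminus[OF sa])
qed

section \<open>Uniform convergence on compact sets\<close>

text \<open>
  Cover \<open>K\<close> by finitely many balls on which \<open>g\<close> and all but finitely many \<open>f n\<close> vary by less than
  \<open>r / 3\<close>, and use convergence at their centres.
\<close>

lemma equicontinuous_uniform_limit:
  fixes f :: "nat \<Rightarrow> 'a::metric_space \<Rightarrow> real"
  assumes K: "compact K"
    and d: "\<And>y. y \<in> K \<Longrightarrow> ((\<lambda>x. d x y) \<longlongrightarrow> 0) (at y within K)"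
    and lip: "\<And>n x y. n \<ge> N \<Longrightarrow> x \<in> K \<Longrightarrow> y \<in> K \<Longrightarrow> \<bar>f n x - f n y\<bar> \<le> d x y"
    and lim: "\<And>x. x \<in> K \<Longrightarrow> (\<lambda>n. f n x) \<longlonglongrightarrow> g x"
  shows "uniform_limit K f g sequentially"
proof (rule uniform_limitI)
  fix r :: real assume r: "r > 0"
  have lip': "\<bar>g x - g y\<bar> \<le> d x y" if "x \<in> K" "y \<in> K" for x y
  proof (rule LIMSEQ_le_const2)
    show "(\<lambda>n. \<bar>f n x - f n y\<bar>) \<longlonglongrightarrow> \<bar>g x - g y\<bar>" by (intro tendsto_intros lim that)
  qed (use lip that in blast)
  have "\<exists>\<delta>>0. \<forall>x\<in>K. dist x y < \<delta> \<longrightarrow> x = y \<or> d x y < r / 3" if "y \<in> K" for y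
  proof -
    have "\<forall>\<^sub>F x in at y within K. d x y < r / 3"
      using r by (intro order_tendstoD(2)[OF d[OF that]]) auto
    then show ?thesis unfolding eventually_at by blast
  qed
  then obtain \<delta> where \<delta>: "\<And>y. y \<in> K \<Longrightarrow> \<delta> y > 0"
    "\<And>x y. y \<in> K \<Longrightarrow> x \<in> K \<Longrightarrow> dist x y < \<delta> y \<Longrightarrow> x = y \<or> d x y < r / 3"
    by metis
  obtain C where C: "C \<subseteq> K" "finite C" "K \<subseteq> (\<Union>y\<in>C. ball y (\<delta> y))"
  proof (rule compactE_image[OF K, of K "\<lambda>y. ball y (\<delta> y)"])
    show "K \<subseteq> (\<Union>y\<in>K. ball y (\<delta> y))" using \<delta>(1) by force
  qed auto
  have "\<forall>\<^sub>F n in sequentially. \<forall>y\<in>C. dist (f n y) (g y) < r / 3"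
    using C r by (intro eventually_ball_finite ballI tendstoD[OF lim]) auto
  then show "\<forall>\<^sub>F n in sequentially. \<forall>x\<in>K. dist (f n x) (g x) < r"
  proof (rule eventually_mono[OF eventually_conj[OF _ eventually_ge_at_top[of N]]])
    fix n assume n: "(\<forall>y\<in>C. dist (f n y) (g y) < r / 3) \<and> N \<le> n"
    show "\<forall>x\<in>K. dist (f n x) (g x) < r"
    proof
      fix x assume x: "x \<in> K"
      then obtain y where y: "y \<in> C" "dist x y < \<delta> y" using C(3) by (auto simp: dist_commute)
      have yK: "y \<in> K" using y C by blast
      have "\<bar>f n x - f n y\<bar> < r / 3 \<and> \<bar>g x - g y\<bar> < r / 3"
        using \<delta>(2)[OF yK x y(2)]
      proof
        assume "d x y < r / 3"
        then show ?thesis using lip[of n x y] lip'[OF x yK] n x yK by auto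
      qed (use r in simp)
      moreover have "\<bar>f n y - g y\<bar> < r / 3" using n y(1) by (auto simp: dist_real_def)
      ultimately show "dist (f n x) (g x) < r" unfolding dist_real_def by linarith
    qed
  qed
qed

lemma holomorphic_family_onorm_tendsto:
  assumes "holomorphic_family D A" "y \<in> D"
  shows "((\<lambda>x. onorm (\<lambda>v. A x v - A y v)) \<longlongrightarrow> 0) (at y within D)"
proof -
  obtain L where L: "((\<lambda>x. onorm (\<lambda>v. A x v - A y v) / cmod (x - y)) \<longlongrightarrow> L) (at y within D)"
    using assms by (auto simp: holomorphic_family_def)
  have "((\<lambda>x. cmod (x - y)) \<longlongrightarrow> cmod (y - y)) (at y within D)" by (intro tendsto_intros)
  from tendsto_mult[OF L this]
  have "((\<lambda>x. onorm (\<lambda>v. A x v - A y v) / cmod (x - y) * cmod (x - y)) \<longlongrightarrow> 0) (at y within D)"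
    by simp
  then show ?thesis
    by (rule Lim_transform_within[OF _ zero_less_one]) auto
qed

lemma lambda_trunc_lipschitz_abs:
  assumes sa: "self_adjoint S" "self_adjoint T" and e: "orthonormal e n" and k: "1 \<le> k" "k \<le> n"
  shows "\<bar>lambda_trunc e S k n - lambda_trunc e T k n\<bar> \<le> onorm (\<lambda>v. S v - T v)"
proof -
  obtain i where i: "k = Suc i" using k by (cases k) auto
  have "(\<lambda>v. T v - S v) = (\<lambda>v. - (S v - T v))" by auto
  then have "onorm (\<lambda>v. T v - S v) = onorm (\<lambda>v. S v - T v)" by (simp only: onorm_neg)
  then show ?thesis
    using lambda_trunc_lipschitz[OF sa e, of i] lambda_trunc_lipschitz[OF sa(2,1) e, of i] i k by auto
qed

lemma top_limits_of_family:
  fixes A :: "complex \<Rightarrow> 'h::chilbert_space \<Rightarrow> 'h"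
  assumes e: "orthonormal_basis e" and sa: "\<And>x. x \<in> K \<Longrightarrow> self_adjoint (A x)" and K: "compact K"
    and cont: "\<And>y. y \<in> K \<Longrightarrow> ((\<lambda>x. onorm (\<lambda>v. A x v - A y v)) \<longlongrightarrow> 0) (at y within K)"
  shows "k \<ge> 1 \<Longrightarrow> uniform_limit K (\<lambda>n x. lambda_trunc e (A x) k n) (\<lambda>x. top_limit (A x) k) sequentially"
    and "uniform_limit K (\<lambda>k x. top_limit (A x) k) (\<lambda>x. ess_upper (A x)) sequentially"
proof -
  note on = orthonormal_basis_orthonormal[OF e]
  show "uniform_limit K (\<lambda>n x. lambda_trunc e (A x) k n) (\<lambda>x. top_limit (A x) k) sequentially"
    if k: "k \<ge> 1" for k
  \<comment> \<open>A truncation of size \<open>n\<close> has a \<open>k\<close>-th eigenvalue only if \<open>k \<le> n\<close>.\<close>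
  proof (rule equicontinuous_uniform_limit[OF K cont, where N = k])
    show "\<bar>lambda_trunc e (A x) k n - lambda_trunc e (A y) k n\<bar> \<le> onorm (\<lambda>v. A x v - A y v)"
      if "k \<le> n" "x \<in> K" "y \<in> K" for n x y
      using that k by (intro lambda_trunc_lipschitz_abs sa on)
    show "(\<lambda>n. lambda_trunc e (A x) k n) \<longlonglongrightarrow> top_limit (A x) k" if "x \<in> K" for x
      using that k by (intro lambda_trunc_tendsto e sa)
  qed
  show "uniform_limit K (\<lambda>k x. top_limit (A x) k) (\<lambda>x. ess_upper (A x)) sequentially"
  proof (rule equicontinuous_uniform_limit[OF K cont, where N = 1])
    show "\<bar>top_limit (A x) k - top_limit (A y) k\<bar> \<le> onorm (\<lambda>v. A x v - A y v)"
      if "1 \<le> k" "x \<in> K" "y \<in> K" for k x y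
    proof (rule LIMSEQ_le_const2)
      show "(\<lambda>n. \<bar>lambda_trunc e (A x) k n - lambda_trunc e (A y) k n\<bar>) \<longlonglongrightarrow>
          \<bar>top_limit (A x) k - top_limit (A y) k\<bar>"
        using that by (intro tendsto_intros lambda_trunc_tendsto e sa)
      show "\<exists>N. \<forall>n\<ge>N. \<bar>lambda_trunc e (A x) k n - lambda_trunc e (A y) k n\<bar> \<le> onorm (\<lambda>v. A x v - A y v)"
        using that by (intro exI[of _ k] allI impI lambda_trunc_lipschitz_abs sa on)
    qed
    show "(\<lambda>k. top_limit (A x) k) \<longlonglongrightarrow> ess_upper (A x)" if "x \<in> K" for x
      using top_limit_tendsto[OF e sa[OF that]] .
  qed
qed

theorem theorem2p1:
  fixes e :: "nat \<Rightarrow> 'h::chilbert_space"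
    and D0 :: "complex set"
    and A :: "complex \<Rightarrow> 'h \<Rightarrow> 'h"
  assumes basis: "orthonormal_basis e"
    and hol: "holomorphic_family D0 A"
    and sa: "\<forall>x\<in>D0. self_adjoint (A x)"
  shows
    "(\<forall>k\<ge>1. \<forall>x\<in>D0.
        (\<lambda>n. lambda_trunc e (A x) k n) \<longlonglongrightarrow>
          (if enat k \<le> num_above (A x) then lambda_plus (A x) k else ess_upper (A x))) \<and>
     (\<forall>k\<ge>1. \<forall>x\<in>D0.
        (\<lambda>n. lambda_trunc e (A x) (n + 1 - k) n) \<longlonglongrightarrow>
          (if enat k \<le> num_below (A x) then lambda_minus (A x) k else ess_lower (A x))) \<and>
     (\<forall>x\<in>D0.
        (\<lambda>k. lim (\<lambda>n. lambda_trunc e (A x) k n)) \<longlonglongrightarrow> ess_upper (A x)) \<and>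
     (\<forall>x\<in>D0.
        (\<lambda>k. lim (\<lambda>n. lambda_trunc e (A x) (n + 1 - k) n)) \<longlonglongrightarrow> ess_lower (A x)) \<and>
     (\<forall>K. compact K \<and> K \<subseteq> D0 \<longrightarrow>
        (\<forall>k\<ge>1. uniform_limit K (\<lambda>n x. lambda_trunc e (A x) k n)
          (\<lambda>x. if enat k \<le> num_above (A x) then lambda_plus (A x) k else ess_upper (A x))
          sequentially) \<and>
        (\<forall>k\<ge>1. uniform_limit K (\<lambda>n x. lambda_trunc e (A x) (n + 1 - k) n)
          (\<lambda>x. if enat k \<le> num_below (A x) then lambda_minus (A x) k else ess_lower (A x))
          sequentially) \<and>
        uniform_limit K (\<lambda>k x. lim (\<lambda>n. lambda_trunc e (A x) k n))
          (\<lambda>x. ess_upper (A x)) sequentially \<and>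
        uniform_limit K (\<lambda>k x. lim (\<lambda>n. lambda_trunc e (A x) (n + 1 - k) n))
          (\<lambda>x. ess_lower (A x)) sequentially)"
proof -
  note on = orthonormal_basis_orthonormal[OF basis]
  let ?N = "\<lambda>x v. - A x v"
  have saA: "self_adjoint (A x)" and saN: "self_adjoint (?N x)" if "x \<in> D0" for x
    using sa that self_adjoint_uminus by auto
  let ?top = "\<lambda>k x. top_limit (A x) k" and ?bot = "\<lambda>k x. - top_limit (?N x) k"
  have bot: "(if enat k \<le> num_below (A x) then lambda_minus (A x) k else ess_lower (A x)) = ?bot k x"
    if "k \<ge> 1" "x \<in> D0" for k x
    using bottom_limit_reflect[OF basis saA] that by blast
  have reflect: "- lambda_trunc e (?N x) k n = lambda_trunc e (A x) (n + 1 - k) n"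
    if "n \<ge> k" "k \<ge> 1" "x \<in> D0" for n k x
    using lambda_trunc_reflect[OF saA on] that by simp
  have top_lim: "(\<lambda>n. lambda_trunc e (A x) k n) \<longlonglongrightarrow> ?top k x" if "k \<ge> 1" "x \<in> D0" for k x
    using that by (intro lambda_trunc_tendsto basis saA)
  have bot_lim: "(\<lambda>n. lambda_trunc e (A x) (n + 1 - k) n) \<longlonglongrightarrow> ?bot k x" if k: "k \<ge> 1" and x: "x \<in> D0" for k x
  proof (rule Lim_transform_eventually)
    show "(\<lambda>n. - lambda_trunc e (?N x) k n) \<longlonglongrightarrow> ?bot k x"
      using that by (intro tendsto_minus lambda_trunc_tendsto basis saN)
    show "\<forall>\<^sub>F n in sequentially. - lambda_trunc e (?N x) k n = lambda_trunc e (A x) (n + 1 - k) n"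
      by (intro eventually_mono[OF eventually_ge_at_top[of k]] reflect k x)
  qed
  have lim_top: "lim (\<lambda>n. lambda_trunc e (A x) k n) = ?top k x"
    and lim_bot: "lim (\<lambda>n. lambda_trunc e (A x) (n + 1 - k) n) = ?bot k x" if "k \<ge> 1" "x \<in> D0" for k x
    using top_lim bot_lim that by (auto intro: limI)
  have top_bot: "(\<lambda>k. lim (\<lambda>n. lambda_trunc e (A x) k n)) \<longlonglongrightarrow> ess_upper (A x)"
    "(\<lambda>k. lim (\<lambda>n. lambda_trunc e (A x) (n + 1 - k) n)) \<longlonglongrightarrow> ess_lower (A x)" if x: "x \<in> D0" for x
  proof -
    have "\<forall>\<^sub>F k in sequentially. ?top k x = lim (\<lambda>n. lambda_trunc e (A x) k n)"
      using lim_top x by (intro eventually_mono[OF eventually_ge_at_top[of 1]]) simp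
    then show "(\<lambda>k. lim (\<lambda>n. lambda_trunc e (A x) k n)) \<longlonglongrightarrow> ess_upper (A x)"
      by (rule Lim_transform_eventually[OF top_limit_tendsto[OF basis saA[OF x]]])
    have "\<forall>\<^sub>F k in sequentially. ?bot k x = lim (\<lambda>n. lambda_trunc e (A x) (n + 1 - k) n)"
      using lim_bot x by (intro eventually_mono[OF eventually_ge_at_top[of 1]]) simp
    then show "(\<lambda>k. lim (\<lambda>n. lambda_trunc e (A x) (n + 1 - k) n)) \<longlonglongrightarrow> ess_lower (A x)"
      unfolding ess_lower_uminus[OF saA[OF x]]
      by (rule Lim_transform_eventually[OF tendsto_minus[OF top_limit_tendsto[OF basis saN[OF x]]]])
  qed
  have uniform: "uniform_limit K (\<lambda>n x. lambda_trunc e (A x) k n) (\<lambda>x. ?top k x) sequentially \<and>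
      uniform_limit K (\<lambda>n x. lambda_trunc e (A x) (n + 1 - k) n) (\<lambda>x. ?bot k x) sequentially"
    (is "?U1 \<and> ?U2")
    and uniform_ess: "uniform_limit K (\<lambda>k x. lim (\<lambda>n. lambda_trunc e (A x) k n)) (\<lambda>x. ess_upper (A x)) sequentially \<and>
      uniform_limit K (\<lambda>k x. lim (\<lambda>n. lambda_trunc e (A x) (n + 1 - k) n)) (\<lambda>x. ess_lower (A x)) sequentially"
    (is "?U3 \<and> ?U4")
    if K: "compact K" "K \<subseteq> D0" and k: "k \<ge> 1" for K k
  proof -
    have cont: "((\<lambda>x. onorm (\<lambda>v. A x v - A y v)) \<longlongrightarrow> 0) (at y within K)" if "y \<in> K" for y
      using holomorphic_family_onorm_tendsto[OF hol, of y] that K(2)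
      by (auto intro: tendsto_within_subset)
    have "onorm (\<lambda>v. ?N x v - ?N y v) = onorm (\<lambda>v. A x v - A y v)" for x y
    proof -
      have "(\<lambda>v. ?N x v - ?N y v) = (\<lambda>v. - (A x v - A y v))" by auto
      then show ?thesis by (simp only: onorm_neg)
    qed
    then have contN: "((\<lambda>x. onorm (\<lambda>v. ?N x v - ?N y v)) \<longlongrightarrow> 0) (at y within K)" if "y \<in> K" for y
      using cont[OF that] by simp
    have saK: "self_adjoint (A x)" "self_adjoint (?N x)" if "x \<in> K" for x
      using saA saN that K(2) by auto
    have top: "uniform_limit K (\<lambda>n x. lambda_trunc e (A x) k n) (\<lambda>x. ?top k x) sequentially"
      "uniform_limit K (\<lambda>k x. ?top k x) (\<lambda>x. ess_upper (A x)) sequentially"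
      by (rule top_limits_of_family[OF basis saK(1) K(1) cont]; (assumption | rule k))+
    have neg: "uniform_limit K (\<lambda>n x. lambda_trunc e (?N x) k n) (\<lambda>x. top_limit (?N x) k) sequentially"
      "uniform_limit K (\<lambda>k x. top_limit (?N x) k) (\<lambda>x. ess_upper (?N x)) sequentially"
      by (rule top_limits_of_family[OF basis saK(2) K(1) contN]; (assumption | rule k))+
    have "uniform_limit K (\<lambda>n x. - lambda_trunc e (?N x) k n) (\<lambda>x. ?bot k x) sequentially"
      by (intro uniform_limit_uminus neg(1))
    moreover have "\<forall>\<^sub>F n in sequentially. \<forall>x\<in>K. - lambda_trunc e (?N x) k n = lambda_trunc e (A x) (n + 1 - k) n"
      using reflect k K(2) by (intro eventually_mono[OF eventually_ge_at_top[of k]]) blast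
    ultimately have ?U2 by (subst (asm) uniform_limit_cong) auto
    with top(1) show "?U1 \<and> ?U2" by blast
    have "\<forall>\<^sub>F k in sequentially. \<forall>x\<in>K. ?top k x = lim (\<lambda>n. lambda_trunc e (A x) k n)"
      using lim_top K(2) by (intro eventually_mono[OF eventually_ge_at_top[of 1]]) auto
    then have ?U3 using top(2) by (subst (asm) uniform_limit_cong) auto
    have "uniform_limit K (\<lambda>k x. ?bot k x) (\<lambda>x. - ess_upper (?N x)) sequentially"
      by (intro uniform_limit_uminus neg(2))
    moreover have "\<forall>\<^sub>F k in sequentially. \<forall>x\<in>K. ?bot k x = lim (\<lambda>n. lambda_trunc e (A x) (n + 1 - k) n)"
      using lim_bot K(2) by (intro eventually_mono[OF eventually_ge_at_top[of 1]]) auto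
    moreover have "\<forall>x\<in>K. - ess_upper (?N x) = ess_lower (A x)"
      using ess_lower_uminus[OF saK(1)] by simp
    ultimately have ?U4 by (subst (asm) uniform_limit_cong) auto
    with \<open>?U3\<close> show "?U3 \<and> ?U4" by blast
  qed
  have uniform_bot: "uniform_limit K (\<lambda>n x. lambda_trunc e (A x) (n + 1 - k) n)
      (\<lambda>x. if enat k \<le> num_below (A x) then lambda_minus (A x) k else ess_lower (A x)) sequentially"
    if K: "compact K" "K \<subseteq> D0" and k: "k \<ge> 1" for K k
  proof -
    have U: "uniform_limit K (\<lambda>n x. lambda_trunc e (A x) (n + 1 - k) n) (\<lambda>x. ?bot k x) sequentially"
      using uniform[OF K k] by blast
    show ?thesis
      by (rule uniform_limit_cong'[THEN iffD2, OF refl bot[OF k subsetD[OF K(2)]] U])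
  qed
  \<comment> \<open>The conclusion of \<open>uniform_ess\<close> does not mention \<open>k\<close>, so \<open>1\<close> is as good as any value.\<close>
  show ?thesis
    using top_lim bot_lim top_bot uniform uniform_ess[of _ 1] uniform_bot bot
    unfolding top_limit_def[symmetric]
    by (intro conjI allI impI ballI) simp_all
qed

end
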